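(* Let $X$ be a finite set with $|X|\geq 3$ and let $(X,S)$ be a non-degenerate symmetric set-theoretical solution of the quantum Yang–Baxter equation which is not trivial and which is retractable. Let $G(X,S)$ be its structure group. Then: (i) $G(X,S)$ has a recurrent left order; (ii) the space of left orders of $G(X,S)$ is homeomorphic to the Cantor set; (iii) $G(X,S)$ has infinitely many Conradian left orders.
   Context: A set-theoretical solution is a pair $(X,S)$ with $S:X\times X\to X\times X$ a bijection written $S(x,y)=(g_x(y),f_y(x))$. It is non-degenerate if all $f_x,g_x$ are bijections of $X$; symmetric if $S\circ S=\mathrm{Id}$ and $S^{12}S^{23}S^{12}=S^{23}S^{12}S^{23}$ on $X^3$. It is trivial if $f_x=g_x=\mathrm{Id}_X$ for all $x$. The structure group is $G(X,S)=\langle X\mid xy=g_x(y)f_y(x),\ x,y\in X\rangle$. Retract relation: $x\equiv y$ iff $f_x=f_y$; this is a congruence and $X/\!\equiv$ carries an induced non-degenerate symmetric solution whose structure group is $\mathrm{Ret}^1(G)=G(X,S)/\!\equiv$; iterate $\mathrm{Ret}^{m+1}(G)=\mathrm{Ret}^1(\mathrm{Ret}^m(G))$. The solution is retractable if $\mathrm{Ret}^m(G)$ is cyclic for some $m\geq1$. A left order on a group $G$ is a strict total order with $g\prec h\Rightarrow fg\prec fh$. It is Conradian if for all $a,b\succ 1$ there is $n\in\mathbb{N}$ with $b\prec ab^n$. A left order on a countable group is recurrent if for every $g\in G$ and every finite chain $h_1\prec\dots\prec h_r$ there is a sequence $n_i\to\infty$ with $h_1g^{n_i}\prec\dots\prec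 h_rg^{n_i}$ for all $i$. The space of left orders $LO(G)$ is topologized as a subspace of the power set of $G$ (identifying an order with its positive cone, or with the set of pairs it relates) with the product (Tychonoff) topology. *)

theory Defs
  imports "HOL-Algebra.Group" "HOL-Analysis.Analysis"
begin

definition sol_map :: "('a \<Rightarrow> 'a \<Rightarrow> 'a) \<Rightarrow> ('a \<Rightarrow> 'a \<Rightarrow> 'a) \<Rightarrow> 'a \<times> 'a \<Rightarrow> 'a \<times> 'a" where
  "sol_map g f = (\<lambda>(x, y). (g x y, f y x))"

definition S12 :: "('a \<times> 'a \<Rightarrow> 'a \<times> 'a) \<Rightarrow> 'a \<times> 'a \<times> 'a \<Rightarrow> 'a \<times> 'a \<times> 'a" where
  "S12 S = (\<lambda>(x, y, z). (fst (S (x, y)), snd (S (x, y)), z))"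

definition S23 :: "('a \<times> 'a \<Rightarrow> 'a \<times> 'a) \<Rightarrow> 'a \<times> 'a \<times> 'a \<Rightarrow> 'a \<times> 'a \<times> 'a" where
  "S23 S = (\<lambda>(x, y, z). (x, fst (S (y, z)), snd (S (y, z))))"

definition is_solution :: "'a set \<Rightarrow> ('a \<Rightarrow> 'a \<Rightarrow> 'a) \<Rightarrow> ('a \<Rightarrow> 'a \<Rightarrow> 'a) \<Rightarrow> bool" where
  "is_solution X g f \<longleftrightarrow> bij_betw (sol_map g f) (X \<times> X) (X \<times> X)"

definition non_degenerate :: "'a set \<Rightarrow> ('a \<Rightarrow> 'a \<Rightarrow> 'a) \<Rightarrow> ('a \<Rightarrow> 'a \<Rightarrow> 'a) \<Rightarrow> bool" where
  "non_degenerate X g f \<longleftrightarrow> (\<forall>x\<in>X. bij_betw (f x) X X \<and> bij_betw (g x) X X)"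

definition symmetric_sol :: "'a set \<Rightarrow> ('a \<Rightarrow> 'a \<Rightarrow> 'a) \<Rightarrow> ('a \<Rightarrow> 'a \<Rightarrow> 'a) \<Rightarrow> bool" where
  "symmetric_sol X g f \<longleftrightarrow>
     (\<forall>p\<in>X \<times> X. sol_map g f (sol_map g f p) = p) \<and>
     (\<forall>t\<in>X \<times> X \<times> X.
        S12 (sol_map g f) (S23 (sol_map g f) (S12 (sol_map g f) t)) =
        S23 (sol_map g f) (S12 (sol_map g f) (S23 (sol_map g f) t)))"

definition trivial_sol :: "'a set \<Rightarrow> ('a \<Rightarrow> 'a \<Rightarrow> 'a) \<Rightarrow> ('a \<Rightarrow> 'a \<Rightarrow> 'a) \<Rightarrow> bool" where
  "trivial_sol X g f \<longleftrightarrow> (\<forall>x\<in>X. \<forall>y\<in>X. f x y = y \<and> g x y = y)"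

text \<open>Words are lists of letters (x, b): b = True means x, b = False means x^-1.
  The group generated by X subject to the relations x = y for (x,y) in E and
  x y = g_x(y) f_y(x) is the set of classes of words modulo the congruence below.\<close>

type_synonym 'a word = "('a \<times> bool) list"

inductive sg_eq :: "'a set \<Rightarrow> ('a \<times> 'a) set \<Rightarrow> ('a \<Rightarrow> 'a \<Rightarrow> 'a) \<Rightarrow> ('a \<Rightarrow> 'a \<Rightarrow> 'a)
                     \<Rightarrow> 'a word \<Rightarrow> 'a word \<Rightarrow> bool"
  for X E g f where
  refl: "fst ` set w \<subseteq> X \<Longrightarrow> sg_eq X E g f w w"
| sym: "sg_eq X E g f v w \<Longrightarrow> sg_eq X E g f w v"
| trans: "sg_eq X E g f u v \<Longrightarrow> sg_eq X E g f v w \<Longrightarrow> sg_eq X E g f u w"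
| cancel: "fst ` set u \<subseteq> X \<Longrightarrow> fst ` set v \<subseteq> X \<Longrightarrow> x \<in> X \<Longrightarrow>
           sg_eq X E g f (u @ [(x, b), (x, \<not> b)] @ v) (u @ v)"
| braid: "fst ` set u \<subseteq> X \<Longrightarrow> fst ` set v \<subseteq> X \<Longrightarrow> x \<in> X \<Longrightarrow> y \<in> X \<Longrightarrow>
          sg_eq X E g f (u @ [(x, True), (y, True)] @ v)
                        (u @ [(g x y, True), (f y x, True)] @ v)"
| gen: "fst ` set u \<subseteq> X \<Longrightarrow> fst ` set v \<subseteq> X \<Longrightarrow> (x, y) \<in> E \<Longrightarrow> x \<in> X \<Longrightarrow> y \<in> X \<Longrightarrow>
        sg_eq X E g f (u @ [(x, True)] @ v) (u @ [(y, True)] @ v)"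

definition pres_group :: "'a set \<Rightarrow> ('a \<times> 'a) set \<Rightarrow> ('a \<Rightarrow> 'a \<Rightarrow> 'a) \<Rightarrow> ('a \<Rightarrow> 'a \<Rightarrow> 'a)
                          \<Rightarrow> ('a word set) monoid" where
  "pres_group X E g f =
     \<lparr> carrier = {{v. sg_eq X E g f w v} | w. fst ` set w \<subseteq> X},
       monoid.mult = (\<lambda>A B. {v. \<exists>a\<in>A. \<exists>b\<in>B. sg_eq X E g f (a @ b) v}),
       one = {v. sg_eq X E g f [] v} \<rparr>"

definition structure_group :: "'a set \<Rightarrow> ('a \<Rightarrow> 'a \<Rightarrow> 'a) \<Rightarrow> ('a \<Rightarrow> 'a \<Rightarrow> 'a) \<Rightarrow> ('a word set) monoid" where
  "structure_group X g f = pres_group X {} g f"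

text \<open>ret_rel X f m x y: x and y become equal in the m-th retraction
  Ret^m(X,S), i.e. the m-th iterated retraction is (X / ret_rel m) with the induced maps.
  Ret^{m+1} identifies [x],[y] iff the induced maps f_[x], f_[y] on X/ret_rel m coincide.\<close>
fun ret_rel :: "'a set \<Rightarrow> ('a \<Rightarrow> 'a \<Rightarrow> 'a) \<Rightarrow> nat \<Rightarrow> 'a \<Rightarrow> 'a \<Rightarrow> bool" where
  "ret_rel X f 0 x y \<longleftrightarrow> x = y"
| "ret_rel X f (Suc m) x y \<longleftrightarrow> (\<forall>z\<in>X. ret_rel X f m (f x z) (f y z))"

text \<open>Ret^m(G): the structure group of the m-th retraction, presented on the
  generators X modulo the identifications of ret_rel m.\<close>
definition ret_group :: "'a set \<Rightarrow> ('a \<Rightarrow> 'a \<Rightarrow> 'a) \<Rightarrow> ('a \<Rightarrow> 'a \<Rightarrow> 'a) \<Rightarrow> nat \<Rightarrow> ('a word set) monoid" where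
  "ret_group X g f m = pres_group X {(x, y). x \<in> X \<and> y \<in> X \<and> ret_rel X f m x y} g f"

definition cyclic_group :: "('b, 'c) monoid_scheme \<Rightarrow> bool" where
  "cyclic_group G \<longleftrightarrow> (\<exists>a\<in>carrier G. \<forall>x\<in>carrier G. \<exists>n::int. x = a [^]\<^bsub>G\<^esub> n)"

definition retractable :: "'a set \<Rightarrow> ('a \<Rightarrow> 'a \<Rightarrow> 'a) \<Rightarrow> ('a \<Rightarrow> 'a \<Rightarrow> 'a) \<Rightarrow> bool" where
  "retractable X g f \<longleftrightarrow> (\<exists>m\<ge>1. cyclic_group (ret_group X g f m))"

definition left_order :: "('b, 'c) monoid_scheme \<Rightarrow> ('b \<times> 'b) set \<Rightarrow> bool" where
  "left_order G R \<longleftrightarrow>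
     R \<subseteq> carrier G \<times> carrier G \<and>
     (\<forall>x\<in>carrier G. (x, x) \<notin> R) \<and>
     (\<forall>x y z. (x, y) \<in> R \<longrightarrow> (y, z) \<in> R \<longrightarrow> (x, z) \<in> R) \<and>
     (\<forall>x\<in>carrier G. \<forall>y\<in>carrier G. x \<noteq> y \<longrightarrow> (x, y) \<in> R \<or> (y, x) \<in> R) \<and>
     (\<forall>a\<in>carrier G. \<forall>x y. (x, y) \<in> R \<longrightarrow> (a \<otimes>\<^bsub>G\<^esub> x, a \<otimes>\<^bsub>G\<^esub> y) \<in> R)"

definition conradian :: "('b, 'c) monoid_scheme \<Rightarrow> ('b \<times> 'b) set \<Rightarrow> bool" where
  "conradian G R \<longleftrightarrow>
     (\<forall>a b. (\<one>\<^bsub>G\<^esub>, a) \<in> R \<longrightarrow> (\<one>\<^bsub>G\<^esub>, b) \<in> R \<longrightarrow>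
        (\<exists>n::nat. n \<ge> 1 \<and> (b, a \<otimes>\<^bsub>G\<^esub> (b [^]\<^bsub>G\<^esub> n)) \<in> R))"

definition recurrent :: "('b, 'c) monoid_scheme \<Rightarrow> ('b \<times> 'b) set \<Rightarrow> bool" where
  "recurrent G R \<longleftrightarrow>
     (\<forall>a\<in>carrier G. \<forall>hs. set hs \<subseteq> carrier G \<longrightarrow> sorted_wrt (\<lambda>x y. (x, y) \<in> R) hs \<longrightarrow>
        (\<exists>n::nat \<Rightarrow> nat. filterlim n at_top sequentially \<and>
           (\<forall>i. sorted_wrt (\<lambda>x y. (x, y) \<in> R) (map (\<lambda>h. h \<otimes>\<^bsub>G\<^esub> (a [^]\<^bsub>G\<^esub> n i)) hs))))"

definition lo_indicator :: "('b, 'c) monoid_scheme \<Rightarrow> ('b \<times> 'b) set \<Rightarrow> ('b \<times> 'b \<Rightarrow> bool)" where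
  "lo_indicator G R = restrict (\<lambda>p. p \<in> R) (carrier G \<times> carrier G)"

definition LO_space :: "('b, 'c) monoid_scheme \<Rightarrow> ('b \<times> 'b \<Rightarrow> bool) topology" where
  "LO_space G = subtopology
     (product_topology (\<lambda>_. discrete_topology (UNIV :: bool set)) (carrier G \<times> carrier G))
     (lo_indicator G ` {R. left_order G R})"

definition cantor_set :: "real set" where
  "cantor_set = range (\<lambda>d::nat \<Rightarrow> bool. \<Sum>n. (if d n then 2 else 0) / 3 ^ Suc n)"

end

theory Submission
  imports Defs
begin

text \<open>
  The permutation action \<open>x \<mapsto> g\<^sub>x\<close> makes the structure group \<open>G\<close> act on \<open>X\<close>, and \<open>x \<mapsto> e\<^sub>x\<close> extends
  to an injective 1-cocycle \<open>G \<rightarrow> \<int>\<^sup>X\<close>. Hence the kernel of the action is abelian of finite index: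
  some \<open>N\<close>-th power of every element lies in an abelian normal subgroup. This alone forces every left
  order to be recurrent (\<open>b\<^sup>-\<^sup>1 p b\<close> and \<open>p\<close> have the same \<open>N\<close>-th power when \<open>b\<close> lies in the kernel) and
  Conradian (if \<open>a b\<^sup>n \<prec> b\<close> for all \<open>n\<close>, then \<open>a\<^sup>N b\<^sup>N \<prec> b \<preceq> b\<^sup>N a\<^sup>N\<close>).

  The cocycles of the iterated retracts filter \<open>G\<close> by subgroups with free abelian quotients, because an
  element whose cocycle in the \<open>(m+1)\<close>-st retract vanishes acts trivially on the \<open>m\<close>-th retract. So \<open>G\<close>
  is poly-\<open>\<int>\<close> and left orderable.

  Every left order has a nonzero monotone homomorphism \<open>\<tau> : G \<rightarrow> \<real>\<close>, the transfer of the
  translation number of the abelian kernel. If the order is isolated, perturbing \<open>\<tau>\<close> to \<open>\<tau> + \<epsilon> \<tau>'\<close> shows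
  inductively that all homomorphisms to \<open>\<real>\<close> are multiples of \<open>\<tau>\<close>, and then that there are only finitely
  many left orders. If there were finitely many, each retraction step could identify at most one pair of
  points; for \<open>|X| \<ge> 3\<close> the retract with two points then has a point fixed by \<open>G\<close>, whose cocycle
  coordinate is independent of the degree, a contradiction. Thus the compact space of left orders has no
  isolated points.
\<close>

section \<open>Perfect closed subsets of a Cantor cube\<close>

text \<open>Coordinates of a cocycle are homomorphisms only where the permutation action is trivial.
  The filtration therefore alternates two kinds of subgroup: \<open>act_ker m\<close>, acting
  trivially on the m-th retract, and inside it \<open>coc_ker m\<close>, the common kernel of the
  cocycle coordinates of that retract. The inclusion of \<open>coc_ker (Suc m)\<close> in
  \<open>act_ker m\<close> links neighbouring levels and makes the level m coordinates homomorphisms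
  on \<open>coc_ker (Suc m)\<close>. If x and y are merged exactly at step m + 1, some element of
  \<open>coc_ker (Suc m)\<close> has level m cocycle e_x - e_y. Finiteness of the set of cones
  descends from the group to all these kernels, because cones of a kernel extend lexicographically
  and injectively; it then makes any two integer homomorphisms there dependent. Testing this on e_x
  - e_y and e_u - e_v forces x into the pair {u, v}, which is what limits the merging. The objects
  of all inductions are hence positive cones of subgroups rather than orders of the whole group.
  Retractability enters through the degree: generators have degree 1, so in a cyclic group they all
  coincide and the retract is a single point.\<close>

definition ternary :: "(nat \<Rightarrow> bool) \<Rightarrow> real" where
  "ternary d = (\<Sum>n. (if d n then 2 else 0) / 3 ^ Suc n)"

lemma summable_ternary: "summable (\<lambda>n. (if d n then 2 else 0) / 3 ^ Suc n :: real)"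
proof (rule summable_comparison_test')
  show "summable (\<lambda>n. (2/3) * (1/3) ^ n :: real)" by (intro summable_mult summable_geometric) simp
  show "norm ((if d n then 2 else 0) / 3 ^ Suc n :: real) \<le> (2/3) * (1/3) ^ n" if "n \<ge> 0" for n
    by (simp add: power_one_over)
qed

lemma ternary_nonneg: "ternary d \<ge> 0"
  unfolding ternary_def by (rule suminf_nonneg[OF summable_ternary]) simp

lemma ternary_le_one: "ternary d \<le> 1"
proof -
  have geo: "(\<lambda>n. (2/3) * (1/3) ^ n :: real) sums ((2/3) * (1 / (1 - 1/3)))"
    by (intro sums_mult geometric_sums) simp
  have "ternary d \<le> (\<Sum>n. (2/3) * (1/3) ^ n)"
    unfolding ternary_def
    by (rule suminf_le[OF _ summable_ternary sums_summable[OF geo]]) (simp add: power_one_over)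
  also have "\<dots> = 1" using sums_unique[OF geo] by simp
  finally show ?thesis .
qed

lemma ternary_shift:
  "ternary d = (\<Sum>n<J. (if d n then 2 else 0) / 3 ^ Suc n) + ternary (\<lambda>n. d (n + J)) / 3 ^ J"
proof -
  have "ternary d = (\<Sum>n. (if d (n + J) then 2 else 0) / 3 ^ Suc (n + J)) + (\<Sum>n<J. (if d n then 2 else 0) / 3 ^ Suc n)"
    unfolding ternary_def by (rule suminf_split_initial_segment[OF summable_ternary])
  also have "(\<Sum>n. (if d (n + J) then 2 else 0) / 3 ^ Suc (n + J)) = (\<Sum>n. ((if d (n + J) then 2 else 0) / 3 ^ Suc n) / 3 ^ J :: real)"
    by (rule suminf_cong) (simp add: power_add)
  also have "\<dots> = ternary (\<lambda>n. d (n + J)) / 3 ^ J"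
    unfolding ternary_def by (rule suminf_divide[OF summable_ternary])
  finally show ?thesis by simp
qed

lemma ternary_close:
  assumes "\<And>n. n < J \<Longrightarrow> d n = d' n"
  shows "\<bar>ternary d - ternary d'\<bar> \<le> 1 / 3 ^ J"
proof -
  have "ternary d - ternary d' = (ternary (\<lambda>n. d (n + J)) - ternary (\<lambda>n. d' (n + J))) / 3 ^ J"
    using ternary_shift[of d J] ternary_shift[of d' J] assms by (simp add: diff_divide_distrib)
  moreover have "\<bar>ternary (\<lambda>n. d (n + J)) - ternary (\<lambda>n. d' (n + J))\<bar> \<le> 1"
    using ternary_nonneg[of "\<lambda>n. d (n + J)"] ternary_nonneg[of "\<lambda>n. d' (n + J)"]
      ternary_le_one[of "\<lambda>n. d (n + J)"] ternary_le_one[of "\<lambda>n. d' (n + J)"] by linarith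
  ultimately show ?thesis by (simp add: abs_divide divide_right_mono)
qed

text \<open>After rescaling at the first differing digit \<open>J\<close>, one of the numbers is at
  most 1/3 and the other at least 2/3.\<close>

lemma inj_ternary: "inj ternary"
proof (rule injI, rule ccontr)
  fix d d' assume eq: "ternary d = ternary d'" and "d \<noteq> d'"
  then have ex: "\<exists>n. d n \<noteq> d' n" by auto
  define J where "J = (LEAST n. d n \<noteq> d' n)"
  have J: "d J \<noteq> d' J" unfolding J_def by (rule LeastI_ex[OF ex])
  have below: "d n = d' n" if "n < J" for n using not_less_Least that unfolding J_def by blast
  have "ternary (\<lambda>n. d (n + J)) = ternary (\<lambda>n. d' (n + J))"
    using ternary_shift[of d J] ternary_shift[of d' J] eq below by simp
  moreover have "ternary (\<lambda>n. c (n + J)) = (if c J then 2/3 else 0) + ternary (\<lambda>n. c (n + 1 + J)) / 3" for c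
    using ternary_shift[of "\<lambda>n. c (n + J)" 1] by simp
  ultimately show False
    using J ternary_nonneg[of "\<lambda>n. d (n + 1 + J)"] ternary_nonneg[of "\<lambda>n. d' (n + 1 + J)"]
      ternary_le_one[of "\<lambda>n. d (n + 1 + J)"] ternary_le_one[of "\<lambda>n. d' (n + 1 + J)"]
    by (cases "d J"; cases "d' J") (auto simp: field_simps)
qed

text \<open>Increasing enumeration of an infinite set by rank; it will number the branching levels
  of a point.\<close>

lemma infinite_nat_rank_exists:
  assumes "infinite (B :: nat set)"
  shows "\<exists>n\<in>B. card (B \<inter> {..<n}) = j"
proof (induction j)
  case 0
  obtain b where "b \<in> B" using assms by (metis finite.emptyI ex_in_conv)
  then have 1: "(LEAST n. n \<in> B) \<in> B" by (rule LeastI)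
  have "B \<inter> {..<LEAST n. n \<in> B} = {}" using not_less_Least by blast
  then show ?case using 1 by (metis card.empty)
next
  case (Suc j)
  then obtain n where n: "n \<in> B" "card (B \<inter> {..<n}) = j" by blast
  have ex: "\<exists>m. m \<in> B \<and> n < m" using assms by (meson infinite_nat_iff_unbounded)
  define m where "m = (LEAST m. m \<in> B \<and> n < m)"
  have m: "m \<in> B" "n < m" using LeastI_ex[OF ex] unfolding m_def by auto
  have "k \<le> n" if "k \<in> B" "k < m" for k using not_less_Least that unfolding m_def by (metis not_le)
  then have "B \<inter> {..<m} = insert n (B \<inter> {..<n})" using m n by force
  then show ?case using m n by (intro bexI[of _ m]) auto
qed

lemma infinite_nat_rank_strict:
  assumes "n \<in> (B :: nat set)" "n < m"
  shows "card (B \<inter> {..<n}) < card (B \<inter> {..<m})"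
  using assms by (intro psubset_card_mono) auto

lemma openin_cylinder:
  fixes s :: "'i \<Rightarrow> bool"
  assumes "finite K" "K \<subseteq> I"
  shows "openin (product_topology (\<lambda>_. discrete_topology UNIV) I)
    {t \<in> topspace (product_topology (\<lambda>_. discrete_topology UNIV) I). \<forall>k\<in>K. t k = s k}"
  using assms
proof (induction K rule: finite_induct)
  case empty
  show ?case using openin_topspace by (simp del: topspace_product_topology)
next
  case (insert k K)
  let ?T = "product_topology (\<lambda>_. discrete_topology (UNIV :: bool set)) I"
  have "k \<in> I" using insert.prems by simp
  then have "openin ?T {t \<in> topspace ?T. t k \<in> {s k}}"
    by (intro openin_continuous_map_preimage[OF continuous_map_product_projection]) simp_all
  moreover have "openin ?T {t \<in> topspace ?T. \<forall>k\<in>K. t k = s k}" using insert by simp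
  ultimately have "openin ?T ({t \<in> topspace ?T. t k \<in> {s k}} \<inter> {t \<in> topspace ?T. \<forall>k\<in>K. t k = s k})"
    by (rule openin_Int)
  then show ?case by (rule back_subst[of "openin ?T"]) auto
qed

section \<open>Branching levels of a perfect set of binary sequences\<close>

context
  fixes I :: "'i set" and S :: "('i \<Rightarrow> bool) set"
  assumes countable_I: "countable I" and infinite_I: "infinite I"
    and closed_S: "closedin (product_topology (\<lambda>_. discrete_topology UNIV) I) S"
    and perfect_S: "\<And>s F. s \<in> S \<Longrightarrow> finite F \<Longrightarrow> F \<subseteq> I \<Longrightarrow> \<exists>t\<in>S. t \<noteq> s \<and> (\<forall>i\<in>F. t i = s i)"
begin

private definition "coord = from_nat_into I"

text \<open>\<open>S\<close> is seen as a binary tree of coordinate prefixes; these are the levels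
  at which the path \<open>s\<close> has a sibling inside \<open>S\<close>.\<close>

private definition branching :: "('i \<Rightarrow> bool) \<Rightarrow> nat set" where
  "branching s = {n. \<exists>t\<in>S. (\<forall>k<n. t (coord k) = s (coord k)) \<and> t (coord n) \<noteq> s (coord n)}"

private definition branch_pos :: "('i \<Rightarrow> bool) \<Rightarrow> nat \<Rightarrow> nat" where
  "branch_pos s j = (SOME n. n \<in> branching s \<and> card (branching s \<inter> {..<n}) = j)"

text \<open>Reading \<open>s\<close> only at its branching levels discards the coordinates that are
  forced by earlier ones, so that every bit sequence can be attained.\<close>

private definition branch_bits :: "('i \<Rightarrow> bool) \<Rightarrow> nat \<Rightarrow> bool" where
  "branch_bits s j = s (coord (branch_pos s j))"

private lemma coord_in: "coord n \<in> I"
  unfolding coord_def by (rule from_nat_into) (use infinite_I in auto)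

private lemma coord_surj: "i \<in> I \<Longrightarrow> \<exists>n. coord n = i"
  unfolding coord_def using from_nat_into_surj[OF countable_I] by blast

private lemma first_difference:
  assumes "s \<in> S" "t \<in> S" "s \<noteq> t"
  obtains n where "\<And>k. k < n \<Longrightarrow> t (coord k) = s (coord k)" "t (coord n) \<noteq> s (coord n)"
proof -
  have "S \<subseteq> extensional I" using closedin_subset[OF closed_S] by (auto simp: PiE_def)
  then have "\<exists>i\<in>I. t i \<noteq> s i" using extensionalityI[of s I t] assms by (metis subsetD)
  then have ex: "\<exists>n. t (coord n) \<noteq> s (coord n)" using coord_surj by metis
  show ?thesis
    by (rule that[of "LEAST n. t (coord n) \<noteq> s (coord n)"])
       (use LeastI_ex[OF ex] not_less_Least in blast)+
qed

private lemma infinite_branching: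
  assumes "s \<in> S" shows "infinite (branching s)"
  unfolding infinite_nat_iff_unbounded_le
proof
  fix m
  obtain t where t: "t \<in> S" "t \<noteq> s" "\<forall>i\<in>coord ` {..<m}. t i = s i"
    using perfect_S[OF assms, of "coord ` {..<m}"] coord_in by auto
  obtain n where n: "\<And>k. k < n \<Longrightarrow> t (coord k) = s (coord k)" "t (coord n) \<noteq> s (coord n)"
    using first_difference[OF assms t(1)] t(2) by metis
  have "m \<le> n" using t(3) n(2) by (metis imageI lessThan_iff not_le)
  then show "\<exists>n\<ge>m. n \<in> branching s" using n t(1) unfolding branching_def by blast
qed

text \<open>The node below level \<open>n\<close> is shared by both paths. If the sibling
  \<open>w\<close> of \<open>u\<close> agrees with \<open>v\<close> at level \<open>n\<close>, then
  \<open>u\<close> itself is a sibling of \<open>v\<close>; otherwise \<open>w\<close> is.\<close>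

private lemma branching_local:
  assumes "s \<in> S" "t \<in> S" "\<And>k. k < n \<Longrightarrow> t (coord k) = s (coord k)"
  shows "n \<in> branching t \<longleftrightarrow> n \<in> branching s"
proof -
  have "n \<in> branching v" if u: "n \<in> branching u" and "u \<in> S" "v \<in> S" "\<And>k. k < n \<Longrightarrow> u (coord k) = v (coord k)" for u v
  proof -
    obtain w where w: "w \<in> S" "\<forall>k<n. w (coord k) = u (coord k)" "w (coord n) \<noteq> u (coord n)"
      using u unfolding branching_def by blast
    show ?thesis
    proof (cases "w (coord n) = v (coord n)")
      case True
      then show ?thesis unfolding branching_def using w that by (auto intro!: bexI[of _ u])
    next
      case False
      then show ?thesis unfolding branching_def using w that by (auto intro!: bexI[of _ w])
    qed
  qed
  from this[of t s] this[of s t] show ?thesis using assms by auto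
qed

private lemma branch_pos:
  assumes "s \<in> S"
  shows "branch_pos s j \<in> branching s" "card (branching s \<inter> {..<branch_pos s j}) = j"
  using someI_ex[OF infinite_nat_rank_exists[OF infinite_branching[OF assms], of j, unfolded Bex_def]]
  unfolding branch_pos_def by blast+

private lemma branch_pos_unique:
  assumes "s \<in> S" "n \<in> branching s" "card (branching s \<inter> {..<n}) = j"
  shows "branch_pos s j = n"
  using infinite_nat_rank_strict[of "branch_pos s j" "branching s" n]
    infinite_nat_rank_strict[of n "branching s" "branch_pos s j"] branch_pos[OF assms(1), of j] assms(2,3)
  by (metis less_irrefl linorder_neqE_nat)

private lemma branch_pos_local:
  assumes "s \<in> S" "t \<in> S" "\<And>k. k < branch_pos s j \<Longrightarrow> t (coord k) = s (coord k)"
  shows "branch_pos t j = branch_pos s j"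
proof (rule branch_pos_unique[OF assms(2)])
  have loc: "k \<in> branching t \<longleftrightarrow> k \<in> branching s" if "k \<le> branch_pos s j" for k
    by (rule branching_local) (use assms that in auto)
  show "branch_pos s j \<in> branching t" using loc branch_pos(1)[OF assms(1)] by blast
  have "branching t \<inter> {..<branch_pos s j} = branching s \<inter> {..<branch_pos s j}" using loc by auto
  then show "card (branching t \<inter> {..<branch_pos s j}) = j" using branch_pos(2)[OF assms(1)] by simp
qed

private lemma branch_pos_mono:
  assumes "s \<in> S" "i < j" shows "branch_pos s i < branch_pos s j"
  using infinite_nat_rank_strict[OF branch_pos(1)[OF assms(1), of j], of "branch_pos s i"]
    branch_pos(2)[OF assms(1)] assms(2) by (metis less_asym less_irrefl linorder_neqE_nat)

text \<open>Bits are corrected one at a time: a wrong bit is repaired by moving to the sibling at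
  that branching level, which leaves all earlier levels and their bits intact.\<close>

private lemma branch_bits_approx:
  assumes "S \<noteq> {}" shows "\<exists>s\<in>S. \<forall>j<J. branch_bits s j = d j"
proof (induction J)
  case 0
  then show ?case using assms by auto
next
  case (Suc J)
  then obtain s where s: "s \<in> S" "\<forall>j<J. branch_bits s j = d j" by blast
  show ?case
  proof (cases "branch_bits s J = d J")
    case True
    then show ?thesis using s by (auto simp: less_Suc_eq)
  next
    case False
    let ?n = "branch_pos s J"
    obtain t where t: "t \<in> S" "\<And>k. k < ?n \<Longrightarrow> t (coord k) = s (coord k)" "t (coord ?n) \<noteq> s (coord ?n)"
      using branch_pos(1)[OF s(1), of J] unfolding branching_def by blast
    have "branch_pos t J = ?n" by (rule branch_pos_local[OF s(1) t(1) t(2)])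
    then have "branch_bits t J = d J" using t(3) False by (auto simp: branch_bits_def)
    moreover have "branch_bits t j = d j" if "j < J" for j
    proof -
      have lt: "branch_pos s j < ?n" by (rule branch_pos_mono[OF s(1) that])
      have "branch_pos t j = branch_pos s j"
        by (rule branch_pos_local[OF s(1) t(1)]) (use t(2) lt in auto)
      then show ?thesis using t(2)[OF lt] s(2) that by (simp add: branch_bits_def)
    qed
    ultimately show ?thesis using t(1) by (auto simp: less_Suc_eq)
  qed
qed

text \<open>The first coordinate where two points differ is a branching level of both, with the same
  rank, so the difference is recorded.\<close>

private lemma inj_on_branch_bits: "inj_on branch_bits S"
proof (rule inj_onI, rule ccontr)
  fix s t assume s: "s \<in> S" and t: "t \<in> S" and eq: "branch_bits s = branch_bits t" and ne: "s \<noteq> t"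
  obtain n where n: "\<And>k. k < n \<Longrightarrow> t (coord k) = s (coord k)" "t (coord n) \<noteq> s (coord n)"
    using first_difference[OF s t ne] by metis
  have nb: "n \<in> branching s" using n t unfolding branching_def by blast
  define j where "j = card (branching s \<inter> {..<n})"
  have ps: "branch_pos s j = n" using branch_pos_unique[OF s nb] j_def by simp
  moreover have "branch_pos t j = n" using branch_pos_local[OF s t, of j] n(1) ps by simp
  ultimately show False using n(2) fun_cong[OF eq, of j] by (simp add: branch_bits_def)
qed

text \<open>A continuous injection of a compact space into a Hausdorff space is a homeomorphism onto
  its image. The image is all of the Cantor set because it is closed and, by
  \<open>branch_bits_approx\<close>, dense there.\<close>

lemma perfect_closed_homeomorphic_cantor:
  assumes "S \<noteq> {}"
  shows "subtopology (product_topology (\<lambda>_. discrete_topology UNIV) I) S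
    homeomorphic_space subtopology euclideanreal cantor_set"
proof -
  let ?T = "product_topology (\<lambda>_. discrete_topology (UNIV :: bool set)) I"
  define \<Phi> where "\<Phi> s = ternary (branch_bits s)" for s
  have ST: "S \<subseteq> topspace ?T" using closedin_subset[OF closed_S] .
  have top: "topspace (subtopology ?T S) = S" using ST by auto
  have compact: "compact_space (subtopology ?T S)"
    by (intro compact_space_subtopology closedin_compact_space[OF _ closed_S])
       (simp add: compact_space_product_topology compact_space_discrete_topology)
  have cont: "continuous_map (subtopology ?T S) euclideanreal \<Phi>"
    unfolding continuous_map_def
  proof (intro conjI allI impI)
    fix U :: "real set" assume "openin euclidean U"
    then have U: "open U" by simp
    show "openin (subtopology ?T S) {s \<in> topspace (subtopology ?T S). \<Phi> s \<in> U}"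
      unfolding top
    proof (subst openin_subopen, intro ballI)
      fix s assume "s \<in> {s \<in> S. \<Phi> s \<in> U}"
      then have s: "s \<in> S" "\<Phi> s \<in> U" by auto
      obtain e where e: "e > 0" "\<And>y. \<bar>y - \<Phi> s\<bar> < e \<Longrightarrow> y \<in> U"
        using U s(2) unfolding open_real by blast
      obtain J where J: "1 / 3 ^ J < e" using real_arch_pow_inv[OF e(1), of "1/3"] by (auto simp: power_one_over)
      \<comment> \<open>Agreement with \<open>s\<close> on these coordinates fixes the first
        \<open>J\<close> branching levels together with their bits.\<close>
      define K where "K = coord ` {..branch_pos s J}"
      define V where "V = {t \<in> topspace ?T. \<forall>k\<in>K. t k = s k} \<inter> S"
      have "openin (subtopology ?T S) V"
        unfolding V_def by (intro openin_subtopology_Int openin_cylinder) (auto simp: K_def coord_in)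
      moreover have "s \<in> V" using s ST by (auto simp: V_def)
      moreover have "V \<subseteq> {s \<in> S. \<Phi> s \<in> U}"
      proof
        fix t assume tV: "t \<in> V"
        then have t: "t \<in> S" and agree: "\<And>k. k \<le> branch_pos s J \<Longrightarrow> t (coord k) = s (coord k)"
          by (auto simp: V_def K_def)
        have "branch_bits t j = branch_bits s j" if "j < J" for j
        proof -
          have lt: "branch_pos s j < branch_pos s J" by (rule branch_pos_mono[OF s(1) that])
          have "branch_pos t j = branch_pos s j"
            by (rule branch_pos_local[OF s(1) t]) (use agree lt in auto)
          then show ?thesis using agree lt by (simp add: branch_bits_def)
        qed
        then have "\<bar>\<Phi> t - \<Phi> s\<bar> \<le> 1 / 3 ^ J" unfolding \<Phi>_def by (rule ternary_close)
        then show "t \<in> {s \<in> S. \<Phi> s \<in> U}" using t e(2) J by force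
      qed
      ultimately show "\<exists>V. openin (subtopology ?T S) V \<and> s \<in> V \<and> V \<subseteq> {s \<in> S. \<Phi> s \<in> U}" by blast
    qed
  qed auto
  have cantor: "cantor_set = range ternary"
    unfolding cantor_set_def ternary_def ..
  have "compactin euclideanreal (\<Phi> ` S)"
    using image_compactin[OF _ cont] compact unfolding compact_space_def top by blast
  then have closed: "closed (\<Phi> ` S)" by (simp add: compact_imp_closed)
  have "range ternary \<subseteq> \<Phi> ` S"
  proof
    fix y assume "y \<in> range ternary"
    then obtain d where d: "y = ternary d" by blast
    have "\<forall>J. \<exists>s. s \<in> S \<and> (\<forall>j<J. branch_bits s j = d j)" using branch_bits_approx[OF assms] by blast
    then obtain w where w: "\<And>J. w J \<in> S" "\<And>J j. j < J \<Longrightarrow> branch_bits (w J) j = d j" by metis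
    have close: "\<bar>\<Phi> (w J) - y\<bar> \<le> 1 / 3 ^ J" for J
      unfolding \<Phi>_def d by (rule ternary_close) (use w in auto)
    have "(\<lambda>J. 1 / 3 ^ J :: real) \<longlonglongrightarrow> 0"
      using LIMSEQ_power_zero[of "1/3 :: real"] by (simp add: power_one_over)
    then have "(\<lambda>J. \<Phi> (w J) - y) \<longlonglongrightarrow> 0"
      by (rule Lim_null_comparison[rotated]) (use close in auto)
    then have "(\<lambda>J. \<Phi> (w J)) \<longlonglongrightarrow> y" by (simp add: LIM_zero_iff)
    then show "y \<in> \<Phi> ` S" using closed_sequentially[OF closed, of "\<lambda>J. \<Phi> (w J)"] w(1) by blast
  qed
  then have image: "\<Phi> ` S = cantor_set" unfolding cantor \<Phi>_def by auto
  have "homeomorphic_map (subtopology ?T S) (subtopology euclideanreal cantor_set) \<Phi>"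
  proof (rule continuous_imp_homeomorphic_map)
    show "continuous_map (subtopology ?T S) (subtopology euclideanreal cantor_set) \<Phi>"
      using cont image top by (auto simp: continuous_map_in_subtopology)
    show "inj_on \<Phi> (topspace (subtopology ?T S))"
      unfolding top \<Phi>_def using inj_on_branch_bits inj_ternary
      by (auto simp: inj_on_def inj_def)
  qed (use compact image top in \<open>auto intro: Hausdorff_space_subtopology\<close>)
  then show ?thesis by (rule homeomorphic_map_imp_homeomorphic_space)
qed

end

section \<open>Homomorphisms, poly-cyclic filtrations and positive cones\<close>

context group
begin

text \<open>Relative to a subset of one fixed group, so that the subgroups of a filtration never
  have to become groups of their own.\<close>

definition add_hom :: "'a set \<Rightarrow> ('a \<Rightarrow> 'c::ab_group_add) \<Rightarrow> bool" where
  "add_hom H \<phi> \<longleftrightarrow> (\<forall>a\<in>H. \<forall>b\<in>H. \<phi> (a \<otimes> b) = \<phi> a + \<phi> b)"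

lemma add_homD: "add_hom H \<phi> \<Longrightarrow> a \<in> H \<Longrightarrow> b \<in> H \<Longrightarrow> \<phi> (a \<otimes> b) = \<phi> a + \<phi> b"
  by (simp add: add_hom_def)

lemma add_hom_subset: "add_hom H \<phi> \<Longrightarrow> L \<subseteq> H \<Longrightarrow> add_hom L \<phi>"
  by (auto simp: add_hom_def)

lemma subgroup_nat_pow_closed:
  "subgroup H G \<Longrightarrow> a \<in> H \<Longrightarrow> a [^] (n::nat) \<in> H"
  by (induction n) (auto simp: subgroup.one_closed subgroup.m_closed)

lemma subgroup_int_pow_closed:
  "subgroup H G \<Longrightarrow> a \<in> H \<Longrightarrow> a [^] (n::int) \<in> H"
  by (cases n rule: int_cases2)
     (auto simp: int_pow_int int_pow_neg_int subgroup.mem_carrier subgroup.m_inv_closed subgroup_nat_pow_closed)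

lemma add_hom_one:
  assumes "add_hom H \<phi>" "subgroup H G" shows "\<phi> \<one> = 0"
  using add_homD[OF assms(1) subgroup.one_closed[OF assms(2)] subgroup.one_closed[OF assms(2)]] by simp

lemma add_hom_inv:
  assumes "add_hom H \<phi>" "subgroup H G" "a \<in> H" shows "\<phi> (inv a) = - \<phi> a"
proof -
  have "a \<in> carrier G" using assms subgroup.subset by blast
  hence "\<phi> (inv a \<otimes> a) = 0" using add_hom_one[OF assms(1,2)] by simp
  moreover have "\<phi> (inv a \<otimes> a) = \<phi> (inv a) + \<phi> a"
    using assms by (simp add: add_homD subgroup.m_inv_closed)
  ultimately show ?thesis by (simp add: eq_neg_iff_add_eq_0)
qed

lemma add_hom_nat_pow:
  assumes "add_hom H (\<phi> :: 'a \<Rightarrow> 'c::comm_ring_1)" "subgroup H G" "a \<in> H"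
  shows "\<phi> (a [^] (n::nat)) = of_nat n * \<phi> a"
  by (induction n) (use assms in \<open>auto simp: add_hom_one add_homD subgroup_nat_pow_closed algebra_simps\<close>)

lemma add_hom_int_pow:
  assumes "add_hom H (\<phi> :: 'a \<Rightarrow> 'c::comm_ring_1)" "subgroup H G" "a \<in> H"
  shows "\<phi> (a [^] (n::int)) = of_int n * \<phi> a"
  using assms subgroup.mem_carrier[OF assms(2,3)]
  by (cases n rule: int_cases2)
     (auto simp: int_pow_int int_pow_neg_int add_hom_inv[OF assms(1,2)] subgroup_nat_pow_closed add_hom_nat_pow)

lemma add_hom_ker_subgroup:
  assumes "add_hom H \<phi>" "subgroup H G"
  shows "subgroup {a \<in> H. \<phi> a = 0} G"
proof (rule subgroupI)
  show "{a \<in> H. \<phi> a = 0} \<subseteq> carrier G" using subgroup.subset[OF assms(2)] by auto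
  show "{a \<in> H. \<phi> a = 0} \<noteq> {}"
    using add_hom_one[OF assms] subgroup.one_closed[OF assms(2)] by auto
qed (auto simp: add_hom_inv[OF assms] add_homD[OF assms(1)] subgroup.m_inv_closed[OF assms(2)]
      subgroup.m_closed[OF assms(2)])

lemma add_hom_family_ker_subgroup:
  assumes sub: "subgroup H G" and hom: "\<And>i. add_hom H (\<phi> i)"
  shows "subgroup {a \<in> H. \<forall>i\<in>I. \<phi> i a = 0} G"
proof (rule subgroupI)
  show "{a \<in> H. \<forall>i\<in>I. \<phi> i a = 0} \<subseteq> carrier G" using subgroup.subset[OF sub] by auto
  show "{a \<in> H. \<forall>i\<in>I. \<phi> i a = 0} \<noteq> {}"
    using add_hom_one[OF hom sub] subgroup.one_closed[OF sub] by auto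
qed (auto simp: add_hom_inv[OF hom sub] add_homD[OF hom] subgroup.m_inv_closed[OF sub]
      subgroup.m_closed[OF sub])

text \<open>\<open>\<phi>\<close> may vanish or have any image in the integers, so \<open>k\<close>
  only bounds the length of the filtration; this lets \<open>poly_Z_mono\<close> keep the same
  \<open>k\<close> for subgroups.\<close>

inductive poly_Z :: "nat \<Rightarrow> 'a set \<Rightarrow> bool" where
  poly_Z_one: "poly_Z 0 {\<one>}"
| poly_Z_step: "subgroup H G \<Longrightarrow> add_hom H (\<phi> :: 'a \<Rightarrow> int) \<Longrightarrow> poly_Z k {a \<in> H. \<phi> a = 0}
    \<Longrightarrow> poly_Z (Suc k) H"

lemma poly_Z_subgroup: "poly_Z k H \<Longrightarrow> subgroup H G"
  by (cases rule: poly_Z.cases) (auto simp: triv_subgroup)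

lemma poly_Z_zeroD: "poly_Z 0 H \<Longrightarrow> H = {\<one>}"
  by (auto elim: poly_Z.cases)

lemma poly_Z_mono:
  assumes "poly_Z k H" "subgroup L G" "L \<subseteq> H"
  shows "poly_Z k L"
  using assms
proof (induction arbitrary: L)
  case poly_Z_one
  then have "L = {\<one>}" using subgroup.one_closed by blast
  then show ?case by (simp add: poly_Z.poly_Z_one)
next
  case (poly_Z_step H \<phi> k)
  have hom: "add_hom L \<phi>" using poly_Z_step.hyps(2) poly_Z_step.prems(2) by (rule add_hom_subset)
  have "poly_Z k {a \<in> L. \<phi> a = 0}"
    by (rule poly_Z_step.IH) (use poly_Z_step.prems hom in \<open>auto intro: add_hom_ker_subgroup\<close>)
  with hom show ?case using poly_Z_step.prems(1) by (blast intro: poly_Z.poly_Z_step)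
qed

text \<open>The product of the \<open>\<phi> a\<close>-th power of \<open>h\<close> and the
  \<open>- \<phi> h\<close>-th power of \<open>a\<close> lies in the kernel of
  \<open>\<phi>\<close>, hence in that of \<open>\<tau>\<close>. This gives
  \<open>\<phi> a * \<tau> h = \<phi> h * \<tau> a\<close>.\<close>

lemma add_hom_ker_subset:
  assumes \<tau>: "add_hom H (\<tau> :: 'a \<Rightarrow> real)" and \<phi>: "add_hom H (\<phi> :: 'a \<Rightarrow> int)" and sub: "subgroup H G"
    and h: "h \<in> H" "\<tau> h \<noteq> 0" and zero: "\<And>a. a \<in> H \<Longrightarrow> \<phi> a = 0 \<Longrightarrow> \<tau> a = 0"
  shows "{a \<in> H. \<tau> a = 0} \<subseteq> {a \<in> H. \<phi> a = 0}"
proof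
  fix a assume a: "a \<in> {a \<in> H. \<tau> a = 0}"
  let ?y = "h [^] \<phi> a \<otimes> a [^] (- \<phi> h)"
  have mem: "h [^] \<phi> a \<in> H" "a [^] (- \<phi> h) \<in> H"
    using a h sub by (auto intro: subgroup_int_pow_closed)
  have "\<phi> ?y = 0" using a h sub by (simp add: add_homD[OF \<phi> mem] add_hom_int_pow[OF \<phi> sub])
  then have "\<tau> ?y = 0" using zero mem sub by (simp add: subgroup.m_closed)
  then have "real_of_int (\<phi> a) * \<tau> h = 0"
    using a h sub by (simp add: add_homD[OF \<tau> mem] add_hom_int_pow[OF \<tau> sub])
  then show "a \<in> {a \<in> H. \<phi> a = 0}" using a h by simp
qed

text \<open>A real homomorphism may have non-cyclic image, yet its kernel still costs one step of
  the filtration, which drives the later induction on \<open>k\<close>. Either \<open>\<tau>\<close>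
  vanishes on the kernel of \<open>\<phi>\<close>, and then the kernel of \<open>\<tau>\<close> lies
  inside it, or the induction applies to the kernel of \<open>\<phi>\<close> and the two kernels are
  taken in the other order.\<close>

lemma poly_Z_ker:
  assumes "poly_Z (Suc k) H" "add_hom H (\<tau> :: 'a \<Rightarrow> real)" "h \<in> H" "\<tau> h \<noteq> 0"
  shows "poly_Z k {a \<in> H. \<tau> a = 0}"
  using assms
proof (induction k arbitrary: H h)
  case 0
  then obtain \<phi> :: "'a \<Rightarrow> int" where sub: "subgroup H G" and \<phi>: "add_hom H \<phi>"
    and ker: "poly_Z 0 {a \<in> H. \<phi> a = 0}" by (auto elim: poly_Z.cases)
  have "\<tau> a = 0" if "a \<in> H" "\<phi> a = 0" for a
  proof -
    have "a \<in> {\<one>}" using that poly_Z_zeroD[OF ker] by blast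
    then show ?thesis using add_hom_one[OF 0(2) sub] by simp
  qed
  from poly_Z_mono[OF ker add_hom_ker_subgroup[OF 0(2) sub] add_hom_ker_subset[OF 0(2) \<phi> sub 0(3,4) this]]
  show ?case .
next
  case (Suc k)
  then obtain \<phi> :: "'a \<Rightarrow> int" where sub: "subgroup H G" and \<phi>: "add_hom H \<phi>"
    and ker: "poly_Z (Suc k) {a \<in> H. \<phi> a = 0}" by (auto elim: poly_Z.cases)
  let ?M = "{a \<in> H. \<tau> a = 0}" and ?K = "{a \<in> H. \<phi> a = 0}"
  have Msub: "subgroup ?M G" by (rule add_hom_ker_subgroup[OF Suc.prems(2) sub])
  show ?case
  proof (cases "\<forall>a\<in>?K. \<tau> a = 0")
    case True
    then have "?M \<subseteq> ?K" by (intro add_hom_ker_subset[OF Suc.prems(2) \<phi> sub Suc.prems(3,4)]) auto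
    then show ?thesis using poly_Z_mono[OF ker Msub] by blast
  next
    case False
    then obtain b where b: "b \<in> ?K" "\<tau> b \<noteq> 0" by blast
    have "poly_Z k {a \<in> ?K. \<tau> a = 0}"
      by (rule Suc.IH[OF ker _ b]) (rule add_hom_subset[OF Suc.prems(2)], auto)
    also have "{a \<in> ?K. \<tau> a = 0} = {a \<in> ?M. \<phi> a = 0}" by auto
    finally show ?thesis
      by (intro poly_Z_step[OF Msub, where \<phi> = \<phi>] add_hom_subset[OF \<phi>]) auto
  qed
qed

lemma poly_Z_family:
  assumes "finite I" "subgroup H G" "\<And>i. i \<in> I \<Longrightarrow> add_hom H (\<phi> i :: 'a \<Rightarrow> int)"
    "poly_Z k {a \<in> H. \<forall>i\<in>I. \<phi> i a = 0}"
  shows "\<exists>k. poly_Z k H"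
  using assms
proof (induction I arbitrary: H rule: finite_induct)
  case empty
  then show ?case by auto
next
  case (insert i I)
  have hom: "add_hom H (\<phi> i)" using insert.prems by blast
  let ?K = "{a \<in> H. \<phi> i a = 0}"
  have eq: "{a \<in> H. \<forall>j\<in>insert i I. \<phi> j a = 0} = {a \<in> ?K. \<forall>j\<in>I. \<phi> j a = 0}" by auto
  have "add_hom ?K (\<phi> j)" if "j \<in> I" for j
    by (rule add_hom_subset[of H]) (use insert.prems(2)[of j] that in auto)
  then have "\<exists>k. poly_Z k ?K"
    using insert.prems(3) unfolding eq
    by (intro insert.IH add_hom_ker_subgroup[OF hom insert.prems(1)])
  then show ?case using poly_Z_step[OF insert.prems(1) hom] by blast
qed

text \<open>Finite generation, phrased through the subgroups containing \<open>S\<close>. To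
  generators of the kernel one adds an element on which \<open>\<phi>\<close> takes its least
  positive value \<open>d\<close>; division with remainder by \<open>d\<close> moves any element
  into the kernel.\<close>

lemma poly_Z_fg:
  assumes "poly_Z k H"
  shows "\<exists>S. finite S \<and> S \<subseteq> H \<and> (\<forall>L. subgroup L G \<longrightarrow> S \<subseteq> L \<longrightarrow> H \<subseteq> L)"
  using assms
proof induction
  case poly_Z_one
  show ?case by (rule exI[of _ "{}"]) (auto simp: subgroup.one_closed)
next
  case (poly_Z_step H \<phi> k)
  note sub = poly_Z_step.hyps(1) and \<phi> = poly_Z_step.hyps(2)
  from poly_Z_step.IH obtain S where S: "finite S" "S \<subseteq> {a \<in> H. \<phi> a = 0}"
    "\<And>L. subgroup L G \<Longrightarrow> S \<subseteq> L \<Longrightarrow> {a \<in> H. \<phi> a = 0} \<subseteq> L" by blast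
  show ?case
  proof (cases "\<forall>a\<in>H. \<phi> a = 0")
    case True
    then have "{a \<in> H. \<phi> a = 0} = H" by auto
    then show ?thesis using S by (intro exI[of _ S]) auto
  next
    case False
    then obtain a where a: "a \<in> H" "\<phi> a \<noteq> 0" by blast
    define D where "D = (\<lambda>n. n > 0 \<and> (\<exists>x\<in>H. \<phi> x = int n))"
    have "\<exists>n. D n"
    proof (cases "\<phi> a > 0")
      case True
      then show ?thesis unfolding D_def using a by (intro exI[of _ "nat (\<phi> a)"]) auto
    next
      case False
      then show ?thesis unfolding D_def using a sub
        by (intro exI[of _ "nat (- \<phi> a)"] conjI bexI[of _ "inv a"])
           (auto simp: add_hom_inv[OF \<phi>] subgroup.m_inv_closed)
    qed
    define d where "d = (LEAST n. D n)"
    have "D d" unfolding d_def using \<open>\<exists>n. D n\<close> by (rule LeastI_ex)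
    then obtain x where d: "d > 0" and x: "x \<in> H" "\<phi> x = int d" unfolding D_def by blast
    have min: "\<not> D n" if "n < d" for n using that not_less_Least unfolding d_def by blast
    have "H \<subseteq> L" if L: "subgroup L G" "insert x S \<subseteq> L" for L
    proof
      fix h assume h: "h \<in> H"
      define q where "q = \<phi> h div int d"
      have hc: "h \<in> carrier G" "x \<in> carrier G" using h x sub subgroup.subset by blast+
      define y where "y = h \<otimes> x [^] (- q)"
      have xq: "x [^] (- q) \<in> H" using x sub by (auto intro: subgroup_int_pow_closed)
      have yH: "y \<in> H" unfolding y_def using h xq sub by (simp add: subgroup.m_closed)
      have "\<phi> y = \<phi> h mod int d" unfolding y_def q_def using h xq x sub
        by (simp add: add_homD[OF \<phi>] add_hom_int_pow[OF \<phi>] q_def minus_div_mult_eq_mod flip: minus_mult_left)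
      then have "0 \<le> \<phi> y" "\<phi> y < int d" using d by simp_all
      then have "\<phi> y = 0" using min[of "nat (\<phi> y)"] yH unfolding D_def
        by (metis nat_less_iff nat_0_le of_nat_0_less_iff order_less_le)
      then have "y \<in> L" using S(3)[OF L(1)] L(2) yH by auto
      moreover have "x [^] q \<in> L" using L by (auto intro: subgroup_int_pow_closed)
      moreover have "h = y \<otimes> x [^] q" unfolding y_def using hc
        by (simp add: m_assoc int_pow_mult[symmetric])
      ultimately show "h \<in> L" using L(1) by (simp add: subgroup.m_closed)
    qed
    then show ?thesis using S(1,2) x by (intro exI[of _ "insert x S"]) auto
  qed
qed

text \<open>The elements above the identity in a left order of \<open>H\<close>. That
  \<open>P\<close> contains no element together with its inverse follows from closure under products
  and the absence of the identity.\<close>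

definition pos_cone :: "'a set \<Rightarrow> 'a set \<Rightarrow> bool" where
  "pos_cone H P \<longleftrightarrow> P \<subseteq> H \<and> \<one> \<notin> P \<and> (\<forall>a\<in>P. \<forall>b\<in>P. a \<otimes> b \<in> P) \<and>
     (\<forall>a\<in>H. a \<noteq> \<one> \<longrightarrow> a \<in> P \<or> inv a \<in> P)"

lemma pos_coneD:
  assumes "pos_cone H P"
  shows "P \<subseteq> H" "\<one> \<notin> P" "a \<in> P \<Longrightarrow> b \<in> P \<Longrightarrow> a \<otimes> b \<in> P"
    "a \<in> H \<Longrightarrow> a \<noteq> \<one> \<Longrightarrow> a \<notin> P \<Longrightarrow> inv a \<in> P"
  using assms unfolding pos_cone_def by auto

lemma pos_cone_inv_notin:
  assumes "pos_cone H P" "subgroup H G" "a \<in> P" shows "inv a \<notin> P"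
proof
  assume "inv a \<in> P"
  then have "a \<otimes> inv a \<in> P" using assms pos_coneD(3) by blast
  moreover have "a \<in> carrier G" using assms pos_coneD(1) subgroup.subset by blast
  ultimately show False using assms(1) by (simp add: pos_coneD(2))
qed

lemma pos_cone_eqI:
  assumes "pos_cone H P" "pos_cone H Q" "subgroup H G" "P \<subseteq> Q" shows "P = Q"
proof
  show "Q \<subseteq> P"
  proof
    fix a assume a: "a \<in> Q"
    then have "a \<in> H" "a \<noteq> \<one>" using assms(2) pos_coneD(1,2) by blast+
    then show "a \<in> P" using pos_coneD(4)[OF assms(1)] assms(4) a
        pos_cone_inv_notin[OF assms(2,3) a] by blast
  qed
qed fact

lemma pos_cone_restrict:
  assumes "pos_cone H P" "subgroup L G" "L \<subseteq> H" shows "pos_cone L (P \<inter> L)"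
  using assms unfolding pos_cone_def by (auto simp: subgroup.m_closed subgroup.m_inv_closed)

lemma pos_cone_nat_pow:
  assumes "pos_cone H P" "subgroup H G" "a \<in> P" "n > 0" shows "a [^] (n::nat) \<in> P"
  using assms(4)
proof (induction n)
  case (Suc n)
  have "a \<in> carrier G" using assms pos_coneD(1) subgroup.subset by blast
  then show ?case using Suc assms by (cases "n = 0") (auto intro: pos_coneD(3))
qed simp

text \<open>Compare by \<open>\<tau>\<close> first and break ties by \<open>Q\<close>. This one
  construction yields the existence of cones, the descent of finiteness to kernels and the
  perturbation of isolated cones.\<close>

lemma pos_cone_lex:
  assumes "add_hom H (\<tau> :: 'a \<Rightarrow> 'c::{linordered_ab_group_add})" "subgroup H G" "pos_cone {a \<in> H. \<tau> a = 0} Q"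
  shows "pos_cone H ({a \<in> H. \<tau> a > 0} \<union> Q)"
  unfolding pos_cone_def
proof (intro conjI ballI impI)
  have Q: "a \<in> H" "\<tau> a = 0" if "a \<in> Q" for a using pos_coneD(1)[OF assms(3)] that by auto
  show "{a \<in> H. \<tau> a > 0} \<union> Q \<subseteq> H" using Q by auto
  show "\<one> \<notin> {a \<in> H. \<tau> a > 0} \<union> Q"
    using add_hom_one[OF assms(1,2)] pos_coneD(2)[OF assms(3)] by auto
  show "a \<otimes> b \<in> {a \<in> H. \<tau> a > 0} \<union> Q"
    if "a \<in> {a \<in> H. \<tau> a > 0} \<union> Q" "b \<in> {a \<in> H. \<tau> a > 0} \<union> Q" for a b
    using that Q pos_coneD(3)[OF assms(3)] assms(1,2)
    by (auto simp: subgroup.m_closed add_homD add_pos_pos)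
  show "a \<in> {a \<in> H. \<tau> a > 0} \<union> Q \<or> inv a \<in> {a \<in> H. \<tau> a > 0} \<union> Q" if "a \<in> H" "a \<noteq> \<one>" for a
    using that pos_coneD(4)[OF assms(3), of a] assms(1,2)
    by (cases "\<tau> a = 0") (auto simp: subgroup.m_inv_closed add_hom_inv)
qed

lemma poly_Z_pos_cone: "poly_Z k H \<Longrightarrow> \<exists>P. pos_cone H P"
proof (induction rule: poly_Z.induct)
  case poly_Z_one
  show ?case by (rule exI[of _ "{}"]) (simp add: pos_cone_def)
next
  case (poly_Z_step H \<phi> k)
  then show ?case using pos_cone_lex by blast
qed

text \<open>Ties are broken by \<open>P\<close> itself, so a finite part of \<open>P\<close> on
  which \<open>\<tau>\<close> is nonnegative survives in the new cone.\<close>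

lemma pos_cone_perturb:
  assumes "add_hom H (\<tau> :: 'a \<Rightarrow> real)" "subgroup H G" "pos_cone H P"
  shows "pos_cone H ({a \<in> H. \<tau> a > 0} \<union> (P \<inter> {a \<in> H. \<tau> a = 0}))"
  using assms by (auto intro!: pos_cone_lex pos_cone_restrict add_hom_ker_subgroup)

text \<open>Archimedean argument: for each \<open>n\<close> some product of powers of
  \<open>u\<close> and \<open>h\<close>, with exponent \<open>n\<close> on \<open>h\<close>, has
  \<open>\<sigma>\<close>-value in a bounded positive interval. Nonnegativity of
  \<open>\<tau>\<close> there bounds \<open>n * (\<tau> h - c * \<sigma> h)\<close> from below
  uniformly in the integer \<open>n\<close>, so the factor is zero.\<close>

lemma add_hom_proportional:
  assumes \<sigma>: "add_hom H (\<sigma> :: 'a \<Rightarrow> real)" and \<tau>: "add_hom H (\<tau> :: 'a \<Rightarrow> real)" and sub: "subgroup H G"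
    and mono: "\<And>a. a \<in> H \<Longrightarrow> \<sigma> a > 0 \<Longrightarrow> \<tau> a \<ge> 0"
    and h0: "h0 \<in> H" "\<sigma> h0 \<noteq> 0"
  shows "\<exists>c\<ge>0. \<forall>a\<in>H. \<tau> a = c * \<sigma> a"
proof -
  obtain u where u: "u \<in> H" "\<sigma> u > 0"
  proof (cases "\<sigma> h0 > 0")
    case False
    then show ?thesis using that[of "inv h0"] h0 sub
      by (simp add: add_hom_inv[OF \<sigma>] subgroup.m_inv_closed)
  qed (use that h0 in auto)
  define c where "c = \<tau> u / \<sigma> u"
  have c0: "c \<ge> 0" unfolding c_def using mono[OF u] u by simp
  have cu: "\<tau> u = c * \<sigma> u" unfolding c_def using u by simp
  have key: "real_of_int n * (\<tau> h - c * \<sigma> h) \<ge> - (c * \<sigma> u)" if h: "h \<in> H" for h and n :: int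
  proof -
    \<comment> \<open>The least exponent making \<open>\<sigma> y\<close> below positive; hence
      \<open>\<sigma> y\<close> is also at most \<open>\<sigma> u\<close>.\<close>
    define m where "m = \<lfloor>- (of_int n * \<sigma> h) / \<sigma> u\<rfloor> + 1"
    have m1: "of_int m * \<sigma> u > - (of_int n * \<sigma> h)"
      unfolding m_def using u(2) by (metis floor_correct pos_divide_less_eq of_int_1 of_int_add)
    have "of_int m - 1 \<le> - (of_int n * \<sigma> h) / \<sigma> u" unfolding m_def by simp
    then have "(of_int m - 1) * \<sigma> u \<le> - (of_int n * \<sigma> h)"
      using u(2) by (simp only: pos_le_divide_eq)
    then have m2: "of_int m * \<sigma> u \<le> - (of_int n * \<sigma> h) + \<sigma> u" by (simp add: algebra_simps)
    define y where "y = u [^] m \<otimes> h [^] n"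
    have mem: "u [^] m \<in> H" "h [^] n \<in> H" using u h sub by (auto intro: subgroup_int_pow_closed)
    have "\<sigma> y = of_int m * \<sigma> u + of_int n * \<sigma> h" unfolding y_def
      using mem u h sub by (simp add: add_homD[OF \<sigma>] add_hom_int_pow[OF \<sigma>])
    then have "\<tau> y \<ge> 0" using m1 mono[of y] mem sub by (simp add: y_def subgroup.m_closed)
    moreover have "\<tau> y = of_int m * \<tau> u + of_int n * \<tau> h" unfolding y_def
      using mem u h sub by (simp add: add_homD[OF \<tau>] add_hom_int_pow[OF \<tau>])
    ultimately have "0 \<le> c * (of_int m * \<sigma> u) + of_int n * \<tau> h" by (simp add: cu algebra_simps)
    also have "\<dots> \<le> c * (- (of_int n * \<sigma> h) + \<sigma> u) + of_int n * \<tau> h"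
      using c0 m2 by (intro add_right_mono mult_left_mono) auto
    finally show ?thesis by (simp add: algebra_simps)
  qed
  have "\<tau> h = c * \<sigma> h" if h: "h \<in> H" for h
  proof (rule ccontr)
    define e where "e = \<tau> h - c * \<sigma> h"
    assume "\<tau> h \<noteq> c * \<sigma> h"
    then have e: "\<bar>e\<bar> > 0" unfolding e_def by simp
    obtain n :: nat where n: "real n * \<bar>e\<bar> > c * \<sigma> u"
      using reals_Archimedean3[OF e] by blast
    have "real_of_int (int n) * e \<ge> - (c * \<sigma> u)" "real_of_int (- int n) * e \<ge> - (c * \<sigma> u)"
      unfolding e_def by (rule key[OF h])+
    then show False using n by (cases "e \<ge> 0") auto
  qed
  then show ?thesis using c0 by blast
qed

end

section \<open>Virtually abelian groups\<close>

text \<open>Comparing \<open>u (k * n)\<close> with both \<open>k * u n\<close> and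
  \<open>n * u k\<close> bounds the distance of the quotients at \<open>k\<close> and
  \<open>n\<close> by 2/k + 2/n, so they form a Cauchy sequence.\<close>

lemma quasi_additive_convergent:
  fixes u :: "nat \<Rightarrow> real"
  assumes "\<And>k l. \<bar>u (k + l) - u k - u l\<bar> \<le> 1"
  shows "convergent (\<lambda>n. u n / n)"
proof -
  have mult: "\<bar>u (k * n) - k * u n\<bar> \<le> k + 1" for k n :: nat
  proof (induction k)
    case 0
    show ?case using assms[of 0 0] by simp
  next
    case (Suc k)
    show ?case using Suc assms[of n "k * n"] by (simp add: algebra_simps)
  qed
  have near: "\<bar>u (k * n) / (k * n) - u n / n\<bar> \<le> 2 / n" if "k > 0" "n > 0" for k n :: nat
  proof -
    have "u (k * n) / (k * n) - u n / n = (u (k * n) - k * u n) / (k * n)"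
      using that by (simp add: field_simps)
    also have "\<bar>\<dots>\<bar> \<le> (k + 1) / (k * n)"
      using mult[of k n] by (simp add: abs_mult divide_right_mono)
    also have "\<dots> \<le> 2 / n" using that by (simp add: field_simps)
    finally show ?thesis .
  qed
  have close: "\<bar>u k / k - u n / n\<bar> \<le> 2 / k + 2 / n" if "k > 0" "n > 0" for k n :: nat
    using near[of k n] near[of n k] that by (simp add: mult.commute)
  have "Cauchy (\<lambda>n. u n / n)"
  proof (rule metric_CauchyI)
    fix e :: real assume e: "e > 0"
    obtain M :: nat where M: "real M > 4 / e" using reals_Archimedean2 by blast
    then have M0: "M > 0" using e by (metis divide_pos_pos gr0I less_trans of_nat_0 order_less_irrefl zero_less_numeral)
    have small: "2 / real k < e / 2" if "k \<ge> M" for k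
    proof -
      have "4 / e < real k" using M that by linarith
      moreover have "real k > 0" using M0 that by simp
      ultimately show ?thesis using e by (simp add: field_simps)
    qed
    show "\<exists>M. \<forall>m\<ge>M. \<forall>n\<ge>M. dist (u m / m) (u n / n) < e"
    proof (intro exI allI impI)
      fix m n assume "m \<ge> M" "n \<ge> M"
      then show "dist (u m / m) (u n / n) < e"
        using close[of m n] small[of m] small[of n] M0 by (simp add: dist_real_def)
    qed
  qed
  then show ?thesis by (simp add: Cauchy_convergent_iff)
qed

lemma int_crossing:
  assumes "A (i::int)" "\<not> A j" "i \<le> j"
  shows "\<exists>m. A m \<and> \<not> A (m + 1)"
proof (rule ccontr)
  assume no: "\<not> ?thesis"
  have "A k" if "i \<le> k" for k using that
    by (induction rule: int_ge_induct) (use assms no in auto)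
  then show False using assms by blast
qed

text \<open>The abelian normal subgroup of finite index is given as the kernel of an action
  \<open>lam\<close> with finite image; the values of \<open>lam\<close> later serve as names of its
  cosets.\<close>

locale virt_abelian = group G for G (structure) +
  fixes lam :: "'a \<Rightarrow> 'q \<Rightarrow> 'q"
  assumes lam_mult: "a \<in> carrier G \<Longrightarrow> b \<in> carrier G \<Longrightarrow> lam (a \<otimes> b) = lam a \<circ> lam b"
    and lam_one: "lam \<one> = id"
    and finite_lam: "finite (lam ` carrier G)"
    and lam_ker_comm: "a \<in> carrier G \<Longrightarrow> b \<in> carrier G \<Longrightarrow> lam a = id \<Longrightarrow> lam b = id \<Longrightarrow> a \<otimes> b = b \<otimes> a"
begin

lemma lam_inv: "a \<in> carrier G \<Longrightarrow> lam (inv a) \<circ> lam a = id" "a \<in> carrier G \<Longrightarrow> lam a \<circ> lam (inv a) = id"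
  using lam_mult[of "inv a" a] lam_mult[of a "inv a"] lam_one by auto

lemma lam_inv_id: "a \<in> carrier G \<Longrightarrow> lam a = id \<Longrightarrow> lam (inv a) = id"
  using lam_inv(1)[of a] by simp

lemma lam_pow_id: "a \<in> carrier G \<Longrightarrow> lam a = id \<Longrightarrow> lam (a [^] (n::nat)) = id"
  by (induction n) (auto simp: lam_one lam_mult)

text \<open>By pigeonhole some power \<open>d\<close> of \<open>a\<close>, with \<open>d\<close> at
  most the size \<open>?K\<close> of the image, acts trivially, and every such \<open>d\<close>
  divides the factorial of \<open>?K\<close>.\<close>

lemma exponent_exists: "\<exists>N>0. \<forall>a\<in>carrier G. lam (a [^] (N::nat)) = id"
proof (intro exI conjI ballI)
  let ?K = "card (lam ` carrier G)"
  show "0 < (fact ?K :: nat)" by simp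
  fix a assume a: "a \<in> carrier G"
  have "\<not> inj_on (\<lambda>i::nat. lam (a [^] i)) {0..?K}"
  proof
    assume "inj_on (\<lambda>i::nat. lam (a [^] i)) {0..?K}"
    then have "card {0..?K} \<le> ?K" by (rule card_inj_on_le) (use a finite_lam in auto)
    then show False by simp
  qed
  then obtain i j :: nat where ij: "i < j" "j \<le> ?K" "lam (a [^] i) = lam (a [^] j)"
    unfolding inj_on_def by (metis atLeastAtMost_iff linorder_neqE_nat)
  define d where "d = j - i"
  have "lam (a [^] j) = lam (a [^] i) \<circ> lam (a [^] d)"
    using a ij(1) by (simp add: lam_mult[symmetric] nat_pow_mult d_def)
  then have "lam (inv (a [^] i)) \<circ> lam (a [^] i) = (lam (inv (a [^] i)) \<circ> lam (a [^] i)) \<circ> lam (a [^] d)"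
    using ij(3) by (simp add: comp_assoc)
  then have d: "lam (a [^] d) = id" using lam_inv(1)[of "a [^] i"] a by simp
  have "d dvd fact ?K" using ij by (intro dvd_fact) (auto simp: d_def)
  then obtain e where "fact ?K = d * e" by (auto elim: dvdE)
  then show "lam (a [^] (fact ?K :: nat)) = id"
    using d a by (simp add: nat_pow_pow[symmetric] lam_pow_id)
qed

end

section \<open>The left-invariant comparison defined by a cone\<close>

context group begin

definition lt :: "'a set \<Rightarrow> 'a \<Rightarrow> 'a \<Rightarrow> bool" where
  "lt P x y \<longleftrightarrow> inv x \<otimes> y \<in> P"

lemma mult_inv_cancel: "x \<in> carrier G \<Longrightarrow> y \<in> carrier G \<Longrightarrow> x \<otimes> (inv x \<otimes> y) = y"
   "x \<in> carrier G \<Longrightarrow> y \<in> carrier G \<Longrightarrow> inv x \<otimes> (x \<otimes> y) = y"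
  by (simp_all add: m_assoc[symmetric])

lemma lt_trans:
  assumes "pos_cone H P" "x \<in> carrier G" "y \<in> carrier G" "z \<in> carrier G" "lt P x y" "lt P y z"
  shows "lt P x z"
  using pos_coneD(3)[OF assms(1) assms(5,6)[unfolded lt_def]] assms(2-4)
  by (simp add: lt_def m_assoc mult_inv_cancel)

lemma lt_left:
  assumes "x \<in> carrier G" "y \<in> carrier G" "a \<in> carrier G"
  shows "lt P (a \<otimes> x) (a \<otimes> y) = lt P x y"
  using assms by (simp add: lt_def m_assoc inv_mult_group mult_inv_cancel)

lemma lt_one: "a \<in> carrier G \<Longrightarrow> lt P \<one> a \<longleftrightarrow> a \<in> P"
  by (simp add: lt_def)

lemma lt_inv_one: "a \<in> carrier G \<Longrightarrow> lt P (inv a) \<one> \<longleftrightarrow> a \<in> P" "a \<in> carrier G \<Longrightarrow> lt P a \<one> \<longleftrightarrow> inv a \<in> P"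
  by (simp_all add: lt_def)

lemma lt_irrefl: "pos_cone H P \<Longrightarrow> x \<in> carrier G \<Longrightarrow> \<not> lt P x x"
  by (simp add: lt_def pos_coneD(2))

lemma lt_total:
  assumes "pos_cone H P" "subgroup H G" "x \<in> H" "y \<in> H" "\<not> lt P x y" "x \<noteq> y"
  shows "lt P y x"
proof -
  have c: "x \<in> carrier G" "y \<in> carrier G" using assms by (auto simp: subgroup.mem_carrier)
  have "inv x \<otimes> y \<noteq> \<one>" using mult_inv_cancel(1)[OF c] c assms(6) by auto
  moreover have "inv x \<otimes> y \<in> H" using assms by (simp add: subgroup.m_closed subgroup.m_inv_closed)
  ultimately have "inv (inv x \<otimes> y) \<in> P" using assms(1,5) pos_coneD(4) unfolding lt_def by blast
  then show ?thesis using c by (simp add: lt_def inv_mult_group)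
qed

lemma lt_le_trans:
  assumes "pos_cone H P" "subgroup H G" "x \<in> H" "y \<in> H" "z \<in> H" "lt P x y" "\<not> lt P z y"
  shows "lt P x z"
proof (cases "y = z")
  case False
  then have "lt P y z" using lt_total[OF assms(1,2,5,4,7)] by auto
  then show ?thesis using lt_trans[OF assms(1)] assms by (meson subgroup.mem_carrier)
qed (use assms in auto)

lemma le_lt_trans:
  assumes "pos_cone H P" "subgroup H G" "x \<in> H" "y \<in> H" "z \<in> H" "\<not> lt P y x" "lt P y z"
  shows "lt P x z"
proof (cases "y = x")
  case False
  then have "lt P x y" using lt_total[OF assms(1,2,4,3,6)] by auto
  then show ?thesis using lt_trans[OF assms(1)] assms by (meson subgroup.mem_carrier)
qed (use assms in auto)

lemma pow_pos_iff:
  assumes "pos_cone H P" "subgroup H G" "a \<in> H" "n > 0"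
  shows "a [^] (n::nat) \<in> P \<longleftrightarrow> a \<in> P"
proof
  assume an: "a [^] n \<in> P"
  have ac: "a \<in> carrier G" using assms by (auto simp: subgroup.mem_carrier)
  show "a \<in> P"
  proof (rule ccontr)
    assume "a \<notin> P"
    moreover have "a \<noteq> \<one>" using an pos_coneD(2)[OF assms(1)] by auto
    ultimately have "inv a \<in> P" using pos_coneD(4)[OF assms(1,3)] by blast
    then have "inv a [^] n \<in> P" by (rule pos_cone_nat_pow[OF assms(1,2) _ assms(4)])
    then show False using pos_cone_inv_notin[OF assms(1,2) an] ac by (simp add: nat_pow_inv)
  qed
qed (rule pos_cone_nat_pow[OF assms(1,2) _ assms(4)])

lemma pow_lt_mono:
  assumes "pos_cone H P" "subgroup H G" "c \<in> P"
  shows "lt P (c [^] (i::int)) (c [^] j) \<longleftrightarrow> i < j"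
proof -
  have cH: "c \<in> H" using assms pos_coneD(1) by blast
  have cc: "c \<in> carrier G" using assms cH by (auto simp: subgroup.mem_carrier)
  have eq: "inv (c [^] i) \<otimes> c [^] j = c [^] (j - i)"
    using cc by (simp add: int_pow_neg[symmetric] int_pow_mult[symmetric])
  show ?thesis
  proof (cases "i < j")
    case True
    then obtain n :: nat where "j - i = int n" "n > 0" by (metis diff_gt_0_iff_gt zero_less_imp_eq_int)
    then show ?thesis using True pos_cone_nat_pow[OF assms] by (simp add: lt_def eq int_pow_int)
  next
    case False
    then obtain n :: nat where n: "j - i = - int n"
      by (metis diff_gt_0_iff_gt int_cases2 le_iff_diff_le_0 linorder_not_le neg_le_0_iff_le nonneg_int_cases minus_diff_eq diff_ge_0_iff_ge)
    have "c [^] (j - i) \<notin> P"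
    proof (cases "n = 0")
      case True then show ?thesis using n pos_coneD(2)[OF assms(1)] by simp
    next
      case False
      then have "c [^] n \<in> P" using pos_cone_nat_pow[OF assms] by simp
      then show ?thesis unfolding n using pos_cone_inv_notin[OF assms(1,2)] cc by (simp add: int_pow_neg_int)
    qed
    then show ?thesis using False by (simp add: lt_def eq)
  qed
qed

lemma conj_nat_pow:
  assumes "a \<in> carrier G" "p \<in> carrier G"
  shows "(inv a \<otimes> p \<otimes> a) [^] (n::nat) = inv a \<otimes> p [^] n \<otimes> a"
  using assms by (induction n) (simp_all add: m_assoc mult_inv_cancel)

lemma finite_max:
  assumes P: "pos_cone H P" and sub: "subgroup H G" and "finite W" "W \<noteq> {}" "W \<subseteq> H"
  shows "\<exists>c\<in>W. \<forall>w\<in>W. \<not> lt P c w"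
  using assms(3-5)
proof (induction rule: finite_ne_induct)
  case (singleton x)
  then show ?case using lt_irrefl[OF P] sub by (auto simp: subgroup.mem_carrier)
next
  case (insert x F)
  then obtain c where c: "c \<in> F" "\<forall>w\<in>F. \<not> lt P c w" by auto
  show ?case
  proof (cases "lt P c x")
    case True
    have "\<not> lt P x w" if "w \<in> F" for w
      using lt_trans[OF P _ _ _ True, of w] c that insert.prems sub
      by (meson in_mono insert_subset subgroup.mem_carrier)
    moreover have "\<not> lt P x x" using lt_irrefl[OF P] sub insert.prems by (auto simp: subgroup.mem_carrier)
    ultimately show ?thesis by auto
  next
    case False
    then show ?thesis using c by auto
  qed
qed

end

section \<open>Cones of virtually abelian groups: conjugation, the Conrad property, cofinal
  elements\<close>

context virt_abelian begin

lemma lam_ker_subgroup: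
  assumes "subgroup H G" shows "subgroup {a \<in> H. lam a = id} G"
proof (rule subgroupI)
  show "{a \<in> H. lam a = id} \<subseteq> carrier G" using subgroup.subset[OF assms] by auto
  show "{a \<in> H. lam a = id} \<noteq> {}" using lam_one subgroup.one_closed[OF assms] by auto
qed (auto simp: lam_mult lam_inv_id subgroup.mem_carrier[OF assms] subgroup.m_inv_closed[OF assms]
      subgroup.m_closed[OF assms])

lemma conj_pos:
  assumes P: "pos_cone H P" and sub: "subgroup H G" and p: "p \<in> P" and a: "a \<in> H" "lam a = id"
  shows "inv a \<otimes> p \<otimes> a \<in> P"
proof -
  obtain N :: nat where N: "N > 0" "\<And>a. a \<in> carrier G \<Longrightarrow> lam (a [^] N) = id"
    using exponent_exists by blast
  have pH: "p \<in> H" using P p pos_coneD(1) by blast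
  have c: "a \<in> carrier G" "p \<in> carrier G" using a pH sub by (auto simp: subgroup.mem_carrier)
  have "(inv a \<otimes> p \<otimes> a) [^] N = inv a \<otimes> (p [^] N \<otimes> a)"
    using c by (simp only: conj_nat_pow) (simp add: m_assoc)
  also have "p [^] N \<otimes> a = a \<otimes> p [^] N" using c a N by (intro lam_ker_comm) auto
  also have "inv a \<otimes> (a \<otimes> p [^] N) = p [^] N" using c by (simp add: mult_inv_cancel)
  finally have "(inv a \<otimes> p \<otimes> a) [^] N \<in> P" using pos_cone_nat_pow[OF P sub p N(1)] by simp
  then show ?thesis using pow_pos_iff[OF P sub _ N(1)] a pH sub
    by (simp add: subgroup.m_closed subgroup.m_inv_closed)
qed

text \<open>Multiplying both sides by \<open>a\<close> on the right conjugates the quotient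
  \<open>inv x \<otimes> y\<close> by \<open>a\<close>; the converse direction uses
  \<open>inv a\<close>.\<close>

lemma lt_right:
  assumes P: "pos_cone H P" and sub: "subgroup H G" and x: "x \<in> carrier G" and y: "y \<in> carrier G"
    and a: "a \<in> H" "lam a = id"
  shows "lt P (x \<otimes> a) (y \<otimes> a) \<longleftrightarrow> lt P x y"
proof -
  have ac: "a \<in> carrier G" using a(1) sub by (auto simp: subgroup.mem_carrier)
  have "lt P (u \<otimes> b) (v \<otimes> b)" if "lt P u v" "u \<in> carrier G" "v \<in> carrier G" "b \<in> H" "lam b = id" for u v b
    using conj_pos[OF P sub that(1)[unfolded lt_def] that(4,5)] that(2,3) subgroup.mem_carrier[OF sub that(4)]
    by (simp add: lt_def inv_mult_group m_assoc)
  from this[of x y a] this[of "x \<otimes> a" "y \<otimes> a" "inv a"] show ?thesis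
    using x y a ac lam_inv_id[OF ac] sub by (auto simp: m_assoc subgroup.m_inv_closed)
qed

lemma conradian_cone:
  assumes P: "pos_cone H P" and sub: "subgroup H G" and a: "a \<in> P" and b: "b \<in> P"
  shows "\<exists>n::nat. n \<ge> 1 \<and> lt P b (a \<otimes> b [^] n)"
proof (rule ccontr)
  assume "\<not> ?thesis"
  then have no: "\<not> lt P b (a \<otimes> b [^] n)" if "n \<ge> 1" for n :: nat using that by blast
  obtain N :: nat where N: "N > 0" "\<And>a. a \<in> carrier G \<Longrightarrow> lam (a [^] N) = id"
    using exponent_exists by blast
  have H: "a \<in> H" "b \<in> H" using P a b pos_coneD(1) by blast+
  have c: "a \<in> carrier G" "b \<in> carrier G" using H sub by (auto simp: subgroup.mem_carrier)
  \<comment> \<open>The negated claim at exponent \<open>Suc n\<close> is a weak inequality;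
    strictness, and the case \<open>n = 0\<close>, come from comparing the exponents
    \<open>n\<close> and \<open>Suc n\<close>.\<close>
  have less: "lt P (a \<otimes> b [^] n) b" for n :: nat
  proof -
    have "lt P (a \<otimes> b [^] n) (a \<otimes> b [^] Suc n)"
      using c b lt_left[of "b [^] n" "b [^] Suc n" a P] by (simp add: lt_def mult_inv_cancel)
    then show ?thesis
      by (rule lt_le_trans[OF P sub, rotated 3]) (use no[of "Suc n"] H sub in
          \<open>auto simp: subgroup.m_closed subgroup_nat_pow_closed simp del: nat_pow_Suc\<close>)
  qed
  have "lt P (a [^] Suc k \<otimes> b [^] N) b" for k :: nat
  proof (induction k)
    case 0
    show ?case using less[of N] c by simp
  next
    case (Suc k)
    have "a [^] Suc (Suc k) \<otimes> b [^] N = a \<otimes> (a [^] Suc k \<otimes> b [^] N)"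
      using c nat_pow_Suc2[OF c(1), of "Suc k"] by (simp add: m_assoc)
    moreover have "lt P (a \<otimes> (a [^] Suc k \<otimes> b [^] N)) (a \<otimes> b)"
      using Suc c by (simp only: lt_left nat_pow_closed m_closed)
    moreover have "lt P (a \<otimes> b) b" using less[of 1] c by simp
    ultimately show ?case using lt_trans[OF P, of "a \<otimes> (a [^] Suc k \<otimes> b [^] N)" "a \<otimes> b" b] c by simp
  qed
  from this[of "N - 1"] have "lt P (a [^] N \<otimes> b [^] N) b" using N(1) by simp
  also have "a [^] N \<otimes> b [^] N = b [^] N \<otimes> a [^] N" using c N by (intro lam_ker_comm) auto
  finally have 1: "lt P (b [^] N \<otimes> a [^] N) b" .
  have "b [^] N = b \<otimes> b [^] (N - 1)" using N(1) c by (metis Suc_diff_1 nat_pow_Suc2)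
  then have "inv b \<otimes> (b [^] N \<otimes> a [^] N) = b [^] (N - 1) \<otimes> a [^] N"
    using c by (simp add: m_assoc mult_inv_cancel)
  also have "\<dots> \<in> P"
  proof (cases "N - 1 = 0")
    case True
    then show ?thesis using pos_cone_nat_pow[OF P sub a N(1)] c by simp
  next
    case False
    then show ?thesis using pos_cone_nat_pow[OF P sub a N(1)] pos_cone_nat_pow[OF P sub b, of "N - 1"]
        pos_coneD(3)[OF P] by simp
  qed
  finally have "lt P b (b [^] N \<otimes> a [^] N)" by (simp add: lt_def)
  then show False using 1 lt_trans[OF P] lt_irrefl[OF P] c by (meson m_closed nat_pow_closed)
qed

text \<open>The abelian kernel \<open>A\<close> is finitely generated. For \<open>c\<close> the
  largest positive element among the generators and their inverses, the elements of \<open>A\<close>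
  enclosed between powers of \<open>c\<close> form a subgroup containing all generators, hence all
  of \<open>A\<close>; passing to \<open>N\<close>-th powers extends this to
  \<open>H\<close>.\<close>

lemma cofinal_exists:
  assumes pz: "poly_Z k H" and P: "pos_cone H P" and nontriv: "H \<noteq> {\<one>}"
  shows "\<exists>c\<in>P. lam c = id \<and> (\<forall>h\<in>H. \<exists>(i::int) (j::int). lt P (c [^] i) h \<and> lt P h (c [^] j))"
proof -
  have sub: "subgroup H G" by (rule poly_Z_subgroup[OF pz])
  define A where "A = {a \<in> H. lam a = id}"
  have subA: "subgroup A G" unfolding A_def by (rule lam_ker_subgroup[OF sub])
  have AH: "A \<subseteq> H" by (auto simp: A_def)
  obtain N :: nat where N: "N > 0" "\<And>a. a \<in> carrier G \<Longrightarrow> lam (a [^] N) = id"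
    using exponent_exists by blast
  have powA: "h [^] N \<in> A" if "h \<in> H" for h
    using that N sub by (simp add: A_def subgroup_nat_pow_closed subgroup.mem_carrier)
  obtain h0 where h0: "h0 \<in> P"
  proof -
    obtain h where h: "h \<in> H" "h \<noteq> \<one>" using nontriv subgroup.one_closed[OF sub] by blast
    then show ?thesis using pos_coneD(4)[OF P h] that by blast
  qed
  have h0H: "h0 \<in> H" using h0 P pos_coneD(1) by blast
  obtain S where S: "finite S" "S \<subseteq> A" "\<And>L. subgroup L G \<Longrightarrow> S \<subseteq> L \<Longrightarrow> A \<subseteq> L"
    using poly_Z_fg[OF poly_Z_mono[OF pz subA AH]] by blast
  \<comment> \<open>The power of \<open>h0\<close> is a positive element of \<open>A\<close>; it
    guarantees that a maximum exists.\<close>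
  define W where "W = (insert (h0 [^] N) (S \<union> (\<lambda>s. inv s) ` S)) \<inter> P"
  have WA: "W \<subseteq> A" unfolding W_def using S(2) powA[OF h0H] subgroup.m_inv_closed[OF subA] by auto
  have "finite W" "W \<noteq> {}" unfolding W_def using S(1) pos_cone_nat_pow[OF P sub h0 N(1)] by auto
  then obtain c where c: "c \<in> W" and cmax: "\<forall>w\<in>W. \<not> lt P c w"
    using finite_max[OF P sub] WA AH by (meson order_trans)
  have cP: "c \<in> P" using c by (auto simp: W_def)
  have cA: "c \<in> A" using c WA by blast
  have cH: "c \<in> H" using cA AH by blast
  have cc: "c \<in> carrier G" using cH sub by (auto simp: subgroup.mem_carrier)
  have ciA: "c [^] i \<in> A" for i :: int using cA subA by (rule subgroup_int_pow_closed[rotated])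
  have ciH: "c [^] i \<in> H" for i :: int using ciA AH by blast
  have cA': "lam (c [^] i) = id" for i :: int using ciA by (simp add: A_def)
  define L where "L = {a \<in> A. \<exists>(i::int) (j::int). lt P (c [^] i) a \<and> lt P a (c [^] j)}"
  have Ac: "a \<in> carrier G" if "a \<in> A" for a using that subA by (auto simp: subgroup.mem_carrier)
  have Acomm: "a \<otimes> b = b \<otimes> a" if "a \<in> A" "b \<in> A" for a b
    using that Ac by (intro lam_ker_comm) (auto simp: A_def)
  have "subgroup L G"
  proof (rule subgroupI)
    show "L \<subseteq> carrier G" using Ac by (auto simp: L_def)
    have "lt P (c [^] (-1::int)) (c [^] (0::int))" "lt P (c [^] (0::int)) (c [^] (1::int))"
      by (simp_all only: pow_lt_mono[OF P sub cP])
    then have "lt P (c [^] (-1::int)) \<one>" "lt P \<one> (c [^] (1::int))" by (simp_all only: int_pow_0)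
    then have "\<one> \<in> L" unfolding L_def using subgroup.one_closed[OF subA]
      by blast
    then show "L \<noteq> {}" by auto
  next
    fix a assume "a \<in> L"
    then obtain i j :: int where a: "a \<in> A" and i: "lt P (c [^] i) a" and j: "lt P a (c [^] j)"
      by (auto simp: L_def)
    have ia: "inv a \<in> A" using a subA by (simp add: subgroup.m_inv_closed)
    have "inv (c [^] (- j)) \<otimes> inv a = inv a \<otimes> c [^] j"
      using Acomm[OF ciA[of j] ia] cc by (simp add: int_pow_neg)
    then have "lt P (c [^] (- j)) (inv a)" using j by (simp only: lt_def)
    have "inv (inv a) \<otimes> c [^] (- i) = inv (c [^] i) \<otimes> a"
      using Acomm[OF a ciA[of "- i"]] cc Ac[OF a] by (simp add: int_pow_neg)
    then have "lt P (inv a) (c [^] (- i))" using i by (simp only: lt_def)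
    then show "inv a \<in> L" using \<open>lt P (c [^] (- j)) (inv a)\<close> ia by (auto simp: L_def)
  next
    fix a b assume "a \<in> L" "b \<in> L"
    then obtain i j i' j' :: int where a: "a \<in> A" and i: "lt P (c [^] i) a" and j: "lt P a (c [^] j)"
      and b: "b \<in> A" and i': "lt P (c [^] i') b" and j': "lt P b (c [^] j')"
      by (auto simp: L_def)
    have "lt P (a \<otimes> b) (a \<otimes> c [^] j')" "lt P (a \<otimes> c [^] i') (a \<otimes> b)"
      using i' j' Ac[OF a] Ac[OF b] cc by (simp_all add: lt_left)
    moreover have "lt P (a \<otimes> c [^] j') (c [^] j \<otimes> c [^] j')" "lt P (c [^] i \<otimes> c [^] i') (a \<otimes> c [^] i')"
      using i j Ac[OF a] cc lt_right[OF P sub _ _ ciH cA'] by simp_all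
    ultimately have "lt P (a \<otimes> b) (c [^] (j + j'))" "lt P (c [^] (i + i')) (a \<otimes> b)"
      using lt_trans[OF P, of "a \<otimes> b" "a \<otimes> c [^] j'" "c [^] j \<otimes> c [^] j'"]
        lt_trans[OF P, of "c [^] i \<otimes> c [^] i'" "a \<otimes> c [^] i'" "a \<otimes> b"] Ac[OF a] Ac[OF b] cc
      by (simp_all add: int_pow_mult)
    then show "a \<otimes> b \<in> L" using a b subA by (auto simp: L_def subgroup.m_closed)
  qed
  have posL: "s \<in> L" if "s \<in> W" for s
  proof -
    have s: "s \<in> A" "s \<in> H" "s \<in> P" "s \<in> carrier G" using that WA AH Ac by (auto simp: W_def)
    have "lt P (c [^] (1::int)) (c [^] (2::int))" by (simp only: pow_lt_mono[OF P sub cP])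
    then have "lt P s (c [^] (2::int))"
      by (intro le_lt_trans[OF P sub s(2) cH ciH]) (use cmax that cc in simp_all)
    moreover have "lt P (c [^] (-1::int)) s"
      by (rule lt_trans[OF P, of _ \<one>]) (use s cc cP in \<open>simp_all add: lt_one lt_inv_one int_pow_neg\<close>)
    ultimately show ?thesis using s by (auto simp: L_def)
  qed
  have "S \<subseteq> L"
  proof
    fix s assume s: "s \<in> S"
    have sA: "s \<in> A" "s \<in> H" using s S(2) AH by auto
    consider "s = \<one>" | "s \<in> P" | "inv s \<in> P" using pos_coneD(4)[OF P sA(2)] by blast
    then show "s \<in> L"
    proof cases
      case 1
      then show ?thesis using subgroup.one_closed[OF \<open>subgroup L G\<close>] by simp
    next
      case 2
      then show ?thesis using posL s by (simp add: W_def)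
    next
      case 3
      then have "inv s \<in> L" using posL s by (simp add: W_def)
      then have "inv (inv s) \<in> L" by (rule subgroup.m_inv_closed[OF \<open>subgroup L G\<close>])
      then show ?thesis using Ac[OF sA(1)] by simp
    qed
  qed
  then have AL: "A \<subseteq> L" by (rule S(3)[OF \<open>subgroup L G\<close>])
  \<comment> \<open>A non-identity \<open>h\<close> lies between the identity and its
    \<open>N\<close>-th power, or equals that power when \<open>N = 1\<close>; the power is in
    \<open>A\<close>.\<close>
  have "\<exists>(i::int) (j::int). lt P (c [^] i) h \<and> lt P h (c [^] j)" if h: "h \<in> H" for h
  proof -
    have hc: "h \<in> carrier G" using h sub by (auto simp: subgroup.mem_carrier)
    obtain i j :: int where ij: "lt P (c [^] i) (h [^] N)" "lt P (h [^] N) (c [^] j)"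
      using powA[OF h] AL by (auto simp: L_def)
    have hN: "h [^] N \<in> H" using powA[OF h] AH by blast
    consider "h = \<one>" | "h \<in> P" | "inv h \<in> P" using pos_coneD(4)[OF P h] by blast
    then show ?thesis
    proof cases
      case 1
      then show ?thesis using ij by auto
    next
      case 2
      have "\<not> lt P (h [^] N) h"
        using pow_lt_mono[OF P sub 2, of "int N" 1] N(1) hc by (simp add: int_pow_int)
      then have "lt P h (c [^] j)" using le_lt_trans[OF P sub h hN ciH _ ij(2)] by simp
      moreover have "lt P (c [^] (-1::int)) h"
        by (rule lt_trans[OF P, of _ \<one>]) (use 2 hc cc cP in \<open>simp_all add: lt_one lt_inv_one int_pow_neg\<close>)
      ultimately show ?thesis by blast
    next
      case 3
      have "\<not> lt P h (h [^] N)"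
        using pow_lt_mono[OF P sub 3, of "-1" "- int N"] N(1) hc
        by (simp add: int_pow_neg int_pow_int nat_pow_inv)
      then have "lt P (c [^] i) h" using lt_le_trans[OF P sub ciH hN h ij(1)] by simp
      moreover have "lt P h (c [^] (1::int))"
        by (rule lt_trans[OF P, of _ \<one>]) (use 3 hc cc cP in \<open>simp_all add: lt_one lt_inv_one\<close>)
      ultimately show ?thesis by blast
    qed
  qed
  then show ?thesis using cP cA by (auto simp: A_def)
qed

end

section \<open>Monotone homomorphisms\<close>

context virt_abelian begin

text \<open>\<open>\<tau> a\<close> is the translation number of \<open>a\<close> measured in units
  of \<open>c\<close>. The last clause, that a positive translation number carries the powers of
  \<open>a\<close> beyond every power of \<open>c\<close>, is what later controls conjugates of
  \<open>\<tau>\<close>.\<close>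

lemma abelian_part_hom:
  assumes P: "pos_cone H P" and sub: "subgroup H G" and cP: "c \<in> P" and lc: "lam c = id"
    and cof: "\<And>h. h \<in> H \<Longrightarrow> \<exists>(i::int) (j::int). lt P (c [^] i) h \<and> lt P h (c [^] j)"
  defines "A \<equiv> {a \<in> H. lam a = id}"
  shows "\<exists>\<tau>. add_hom A (\<tau> :: 'a \<Rightarrow> real) \<and> (\<forall>a\<in>A \<inter> P. \<tau> a \<ge> 0) \<and> \<tau> c = 1 \<and>
    (\<forall>a\<in>A. \<tau> a > 0 \<longrightarrow> (\<forall>k::int. \<exists>n::nat. n > 0 \<and> lt P (c [^] k) (a [^] n)))"
proof -
  have subA: "subgroup A G" unfolding A_def by (rule lam_ker_subgroup[OF sub])
  have AH: "a \<in> H" if "a \<in> A" for a using that by (auto simp: A_def)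
  have Ac: "a \<in> carrier G" if "a \<in> A" for a using that subA by (auto simp: subgroup.mem_carrier)
  have cA: "c \<in> A" using cP lc P pos_coneD(1) by (auto simp: A_def)
  have cc: "c \<in> carrier G" using Ac[OF cA] .
  have ciA: "c [^] i \<in> A" for i :: int by (rule subgroup_int_pow_closed[OF subA cA])
  have ciH: "c [^] i \<in> H" for i :: int using AH[OF ciA] .
  have lci: "lam (c [^] i) = id" for i :: int using ciA by (simp add: A_def)
  note mono = pow_lt_mono[OF P sub cP]
  have ex: "\<exists>m::int. \<not> lt P a (c [^] m) \<and> lt P a (c [^] (m + 1))" if aA: "a \<in> A" for a
  proof -
    obtain i j :: int where ij: "lt P (c [^] i) a" "lt P a (c [^] j)" using cof[OF AH[OF aA]] by blast
    then have "lt P (c [^] i) (c [^] j)" using lt_trans[OF P] cc Ac[OF aA] by (meson int_pow_closed)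
    then have "i \<le> j" using mono by simp
    moreover have "\<not> lt P a (c [^] i)"
      using ij lt_trans[OF P] lt_irrefl[OF P] cc Ac[OF aA] by (meson int_pow_closed)
    ultimately show ?thesis
      using ij int_crossing[of "\<lambda>m. \<not> lt P a (c [^] m)" i j] by simp
  qed
  \<comment> \<open>The integer part of \<open>a\<close> on the scale of powers of \<open>c\<close>;
    it is additive up to an error of 1 because right multiplication by powers of \<open>c\<close>
    preserves the order.\<close>
  define fl where "fl a = (SOME m::int. \<not> lt P a (c [^] m) \<and> lt P a (c [^] (m + 1)))" for a
  have fl: "\<not> lt P a (c [^] fl a)" "lt P a (c [^] (fl a + 1))" if "a \<in> A" for a
    using someI_ex[OF ex[OF that]] unfolding fl_def by blast+
  have fl_less: "fl a < k" if "a \<in> A" "lt P a (c [^] k)" for a and k :: int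
  proof -
    have "lt P (c [^] fl a) (c [^] k)"
      by (rule le_lt_trans[OF P sub ciH AH[OF that(1)] ciH fl(1)[OF that(1)] that(2)])
    then show ?thesis using mono by simp
  qed
  have fl_ge: "k \<le> fl a" if "a \<in> A" "\<not> lt P a (c [^] k)" for a and k :: int
  proof -
    have "lt P (c [^] k) (c [^] (fl a + 1))"
      by (rule le_lt_trans[OF P sub ciH AH[OF that(1)] ciH that(2) fl(2)[OF that(1)]])
    then show ?thesis using mono by simp
  qed
  have fl_mult: "fl a + fl b \<le> fl (a \<otimes> b)" "fl (a \<otimes> b) \<le> fl a + fl b + 1" if a: "a \<in> A" and b: "b \<in> A" for a b
  proof -
    have ab: "a \<otimes> b \<in> A" using a b subA by (simp add: subgroup.m_closed)
    have 1: "lt P (a \<otimes> b) (a \<otimes> c [^] (fl b + 1))"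
      using fl(2)[OF b] Ac a b cc by (simp add: lt_left)
    have 2: "lt P (a \<otimes> c [^] (fl b + 1)) (c [^] (fl a + 1) \<otimes> c [^] (fl b + 1))"
      using fl(2)[OF a] Ac a cc lt_right[OF P sub _ _ ciH lci] by simp
    have "lt P (a \<otimes> b) (c [^] (fl a + 1) \<otimes> c [^] (fl b + 1))"
      using lt_trans[OF P _ _ _ 1 2] Ac a b cc by simp
    then have "lt P (a \<otimes> b) (c [^] (fl a + fl b + 2))"
      using cc by (simp add: int_pow_mult[symmetric] algebra_simps)
    then show "fl (a \<otimes> b) \<le> fl a + fl b + 1" using fl_less[OF ab] by fastforce
    show "fl a + fl b \<le> fl (a \<otimes> b)"
    proof (rule fl_ge[OF ab], rule notI)
      assume "lt P (a \<otimes> b) (c [^] (fl a + fl b))"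
      then have 3: "lt P (a \<otimes> b) (c [^] fl a \<otimes> c [^] fl b)" using cc by (simp add: int_pow_mult)
      have 4: "\<not> lt P (a \<otimes> b) (a \<otimes> c [^] fl b)" using fl(1)[OF b] Ac a b cc by (simp add: lt_left)
      have 5: "\<not> lt P (a \<otimes> c [^] fl b) (c [^] fl a \<otimes> c [^] fl b)"
        using fl(1)[OF a] Ac a cc lt_right[OF P sub _ _ ciH lci] by simp
      have mem: "a \<otimes> c [^] fl b \<in> H" "c [^] fl a \<otimes> c [^] fl b \<in> H"
        using AH[OF a] ciH sub by (auto simp: subgroup.m_closed)
      have "lt P (a \<otimes> c [^] fl b) (c [^] fl a \<otimes> c [^] fl b)"
        by (rule le_lt_trans[OF P sub mem(1) AH[OF ab] mem(2) 4 3])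
      then show False using 5 by simp
    qed
  qed
  have powA: "a [^] n \<in> A" if "a \<in> A" for a and n :: nat by (rule subgroup_nat_pow_closed[OF subA that])
  define u where "u a n = real_of_int (fl (a [^] n))" for a and n :: nat
  have u_conv: "convergent (\<lambda>n. u a n / n)" if a: "a \<in> A" for a
  proof (rule quasi_additive_convergent)
    fix k l :: nat
    have eq: "a [^] (k + l) = a [^] k \<otimes> a [^] l" using Ac[OF a] by (simp add: nat_pow_mult)
    show "\<bar>u a (k + l) - u a k - u a l\<bar> \<le> 1"
      using fl_mult[OF powA[OF a, of k] powA[OF a, of l]] unfolding u_def eq by linarith
  qed
  define \<tau> where "\<tau> a = lim (\<lambda>n. u a n / n)" for a
  have lim: "(\<lambda>n. u a n / n) \<longlonglongrightarrow> \<tau> a" if "a \<in> A" for a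
    using u_conv[OF that] unfolding \<tau>_def by (simp add: convergent_LIMSEQ_iff)
  \<comment> \<open>Commutativity splits the n-th power of a product, so the defect of
    \<open>fl\<close> is still at most 1 and vanishes after division by \<open>n\<close>.\<close>
  have hom: "add_hom A \<tau>"
    unfolding add_hom_def
  proof (intro ballI)
    fix a b assume a: "a \<in> A" and b: "b \<in> A"
    have ab: "a \<otimes> b \<in> A" using a b subA by (simp add: subgroup.m_closed)
    have comm: "a \<otimes> b = b \<otimes> a" using a b Ac by (intro lam_ker_comm) (auto simp: A_def)
    have pw: "(a \<otimes> b) [^] n = a [^] n \<otimes> b [^] n" for n :: nat
      using pow_mult_distrib[OF comm] Ac a b by blast
    have bd: "\<bar>u (a \<otimes> b) n / n - u a n / n - u b n / n\<bar> \<le> 1 / n" for n :: nat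
    proof -
      have "\<bar>u (a \<otimes> b) n - u a n - u b n\<bar> \<le> 1"
        using fl_mult[OF powA[OF a, of n] powA[OF b, of n]] unfolding u_def pw by linarith
      then have "\<bar>u (a \<otimes> b) n - u a n - u b n\<bar> / n \<le> 1 / n" by (rule divide_right_mono) simp
      then show ?thesis by (simp add: diff_divide_distrib[symmetric])
    qed
    have "(\<lambda>n. u (a \<otimes> b) n / n - u a n / n - u b n / n) \<longlonglongrightarrow> 0"
      by (rule tendsto_rabs_zero_cancel, rule tendsto_sandwich[OF _ _ tendsto_const lim_1_over_n])
         (use bd in auto)
    moreover have "(\<lambda>n. u (a \<otimes> b) n / n - u a n / n - u b n / n) \<longlonglongrightarrow> \<tau> (a \<otimes> b) - \<tau> a - \<tau> b"
      by (intro tendsto_diff lim a b ab)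
    ultimately have "\<tau> (a \<otimes> b) - \<tau> a - \<tau> b = 0" by (rule LIMSEQ_unique[rotated])
    then show "\<tau> (a \<otimes> b) = \<tau> a + \<tau> b" by simp
  qed
  have nonneg: "\<tau> a \<ge> 0" if a: "a \<in> A" "a \<in> P" for a
  proof (rule LIMSEQ_le_const[OF lim[OF a(1)]], intro exI allI impI)
    fix n :: nat
    have "\<not> lt P (a [^] n) (c [^] (0::int))"
    proof (cases "n = 0")
      case True then show ?thesis using lt_irrefl[OF P] by simp
    next
      case False
      then have "a [^] n \<in> P" using pos_cone_nat_pow[OF P sub a(2)] by simp
      then show ?thesis using pos_cone_inv_notin[OF P sub] Ac[OF a(1)] by (simp add: lt_inv_one)
    qed
    then have "fl (a [^] n) \<ge> 0" by (rule fl_ge[OF powA[OF a(1)]])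
    then show "0 \<le> u a n / n" by (simp add: u_def)
  qed
  have "\<tau> c = 1"
  proof -
    have "fl (c [^] n) = int n" for n :: nat
    proof (rule antisym)
      have "lt P (c [^] int n) (c [^] (int n + 1))" using mono by simp
      then show "fl (c [^] n) \<le> int n" using fl_less[OF powA[OF cA], of n "int n + 1"] by (simp add: int_pow_int)
      show "int n \<le> fl (c [^] n)"
        using fl_ge[OF powA[OF cA], of n "int n"] lt_irrefl[OF P] cc by (simp add: int_pow_int)
    qed
    then have "eventually (\<lambda>n. 1 = u c n / n) sequentially"
      unfolding u_def by (intro eventually_sequentiallyI[of 1]) auto
    then have "(\<lambda>n. u c n / n) \<longlonglongrightarrow> 1" by (rule Lim_transform_eventually[OF tendsto_const])
    then show ?thesis using lim[OF cA] LIMSEQ_unique by blast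
  qed
  moreover have "\<exists>n::nat. n > 0 \<and> lt P (c [^] k) (a [^] n)" if a: "a \<in> A" and pos: "\<tau> a > 0" for a and k :: int
  proof -
    have "eventually (\<lambda>n. u a n / n > \<tau> a / 2) sequentially"
      by (rule order_tendstoD(1)[OF lim[OF a]]) (use pos in simp)
    moreover have "eventually (\<lambda>n::nat. real n > 2 * (k + 1) / \<tau> a) sequentially"
      using filterlim_real_sequentially unfolding filterlim_at_top_dense by blast
    moreover have "eventually (\<lambda>n::nat. n > 0) sequentially" by (rule eventually_gt_at_top)
    ultimately have "eventually (\<lambda>n. n > 0 \<and> u a n / n > \<tau> a / 2 \<and> real n > 2 * (k + 1) / \<tau> a) sequentially"
      by eventually_elim auto
    then obtain n :: nat where n: "n > 0" "u a n / n > \<tau> a / 2" "real n > 2 * (k + 1) / \<tau> a"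
      by (metis (mono_tags, lifting) eventually_sequentially order_refl)
    have "u a n > \<tau> a / 2 * n" using n(1,2) by (simp add: field_simps)
    moreover have "\<tau> a / 2 * n > k + 1" using n(3) pos by (simp add: field_simps)
    ultimately have "fl (a [^] n) > k" unfolding u_def by linarith
    then have "lt P (c [^] k) (c [^] fl (a [^] n))" using mono by simp
    then have "lt P (c [^] k) (a [^] n)"
      by (rule lt_le_trans[OF P sub ciH ciH AH[OF powA[OF a]] _ fl(1)[OF powA[OF a]]])
    then show ?thesis using n(1) by blast
  qed
  ultimately show ?thesis using hom nonneg by blast
qed

text \<open>The transfer sums conjugates of \<open>\<sigma>\<close> over the cosets of
  \<open>A\<close>. It is monotone and nonzero because each conjugate turns out to be a nonnegative
  multiple of \<open>\<sigma>\<close>, so the terms cannot cancel.\<close>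

lemma conrad_hom_exists:
  assumes pz: "poly_Z k H" and P: "pos_cone H P" and nontriv: "H \<noteq> {\<one>}"
  shows "\<exists>\<tau>. add_hom H (\<tau> :: 'a \<Rightarrow> real) \<and> (\<forall>p\<in>P. \<tau> p \<ge> 0) \<and> (\<exists>h\<in>H. \<tau> h \<noteq> 0)"
proof -
  have sub: "subgroup H G" by (rule poly_Z_subgroup[OF pz])
  have Hc: "h \<in> carrier G" if "h \<in> H" for h using that sub by (auto simp: subgroup.mem_carrier)
  obtain c where c: "c \<in> P" "lam c = id"
    and cof: "\<And>h. h \<in> H \<Longrightarrow> \<exists>(i::int) (j::int). lt P (c [^] i) h \<and> lt P h (c [^] j)"
    using cofinal_exists[OF pz P nontriv] by blast
  define A where "A = {a \<in> H. lam a = id}"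
  obtain \<sigma> :: "'a \<Rightarrow> real" where \<sigma>: "add_hom A \<sigma>" and \<sigma>P: "\<And>a. a \<in> A \<Longrightarrow> a \<in> P \<Longrightarrow> \<sigma> a \<ge> 0"
    and \<sigma>c: "\<sigma> c = 1"
    and \<sigma>big: "\<And>a k. a \<in> A \<Longrightarrow> \<sigma> a > 0 \<Longrightarrow> \<exists>n::nat. n > 0 \<and> lt P (c [^] (k::int)) (a [^] n)"
    using abelian_part_hom[OF P sub c cof] unfolding A_def[symmetric] by blast
  have subA: "subgroup A G" unfolding A_def by (rule lam_ker_subgroup[OF sub])
  have AH: "a \<in> H" if "a \<in> A" for a using that by (auto simp: A_def)
  have cH: "c \<in> H" using c P pos_coneD(1) by blast
  have cA: "c \<in> A" using c cH by (simp add: A_def)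
  have cc: "c \<in> carrier G" using Hc[OF cH] .
  have ciH: "c [^] i \<in> H" "lam (c [^] i) = id" for i :: int
    using subgroup_int_pow_closed[OF subA cA, of i] by (auto simp: A_def)
  have conjA: "inv x \<otimes> a \<otimes> x \<in> A" if "x \<in> H" "a \<in> A" for x a
  proof -
    have "lam (inv x \<otimes> a \<otimes> x) = lam (inv x) \<circ> lam x"
      using that Hc[of x] Hc[OF AH[of a]] by (simp add: lam_mult) (simp add: A_def)
    also have "\<dots> = id" using that Hc by (simp only: lam_inv)
    finally show ?thesis using that AH[of a] sub
      by (simp add: A_def subgroup.m_closed subgroup.m_inv_closed)
  qed
  \<comment> \<open>Otherwise the conjugate \<open>?b\<close> is negative and
    \<open>a^n x = x ?b^n\<close> stays below \<open>x\<close>. With \<open>x\<close> between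
    \<open>c^i\<close> and \<open>c^j\<close> and \<open>a^n\<close> above \<open>c^(j - i)\<close>,
    this closes a cycle through \<open>c^j\<close>, \<open>a^n c^i\<close>, \<open>a^n x\<close> and
    \<open>x\<close> back to \<open>c^j\<close>.\<close>
  have conj_sign: "\<sigma> (inv x \<otimes> a \<otimes> x) \<ge> 0" if x: "x \<in> H" and a: "a \<in> A" "\<sigma> a > 0" for x a
  proof (rule ccontr)
    let ?b = "inv x \<otimes> a \<otimes> x"
    assume neg: "\<not> \<sigma> ?b \<ge> 0"
    have b: "?b \<in> A" using conjA x a by blast
    have "?b \<noteq> \<one>" using neg add_hom_one[OF \<sigma> subA] by auto
    then have bP: "inv ?b \<in> P" using pos_coneD(4)[OF P AH[OF b]] \<sigma>P[OF b] neg by blast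
    obtain i j :: int where ij: "lt P (c [^] i) x" "lt P x (c [^] j)" using cof[OF x] by blast
    obtain n :: nat where n: "n > 0" "lt P (c [^] (j - i)) (a [^] n)" using \<sigma>big[OF a] by blast
    have cr: "x \<in> carrier G" "a \<in> carrier G" "?b \<in> carrier G" using Hc x AH a b by auto
    have 1: "lt P (a [^] n \<otimes> c [^] i) (a [^] n \<otimes> x)" using ij(1) cr cc by (simp add: lt_left)
    have "lt P (c [^] (j - i) \<otimes> c [^] i) (a [^] n \<otimes> c [^] i)"
      using n(2) cr cc lt_right[OF P sub _ _ ciH] by simp
    then have 2: "lt P (c [^] j) (a [^] n \<otimes> c [^] i)" using cc by (simp add: int_pow_mult[symmetric])
    have "inv ?b [^] n \<in> P" using pos_cone_nat_pow[OF P sub bP n(1)] .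
    then have "lt P (?b [^] n) \<one>" using cr(3) by (simp only: lt_inv_one(2) nat_pow_inv nat_pow_closed)
    then have "lt P (x \<otimes> ?b [^] n) (x \<otimes> \<one>)" using cr by (simp only: lt_left nat_pow_closed one_closed)
    moreover have "x \<otimes> ?b [^] n = a [^] n \<otimes> x"
      using cr by (simp only: conj_nat_pow) (simp add: m_assoc mult_inv_cancel)
    ultimately have 3: "lt P (a [^] n \<otimes> x) x" using cr by simp
    have "lt P (c [^] j) (c [^] j)"
      using lt_trans[OF P _ _ _ 2 1] lt_trans[OF P _ _ _ 3 ij(2)]
        lt_trans[OF P, of "c [^] j" "a [^] n \<otimes> x" "c [^] j"] cr cc by simp
    then show False using lt_irrefl[OF P] cc by simp
  qed
  have conj_hom: "\<exists>r\<ge>0. \<forall>a\<in>A. \<sigma> (inv x \<otimes> a \<otimes> x) = r * \<sigma> a" if x: "x \<in> H" for x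
  proof (rule add_hom_proportional[OF \<sigma> _ subA _ cA])
    show "add_hom A (\<lambda>a. \<sigma> (inv x \<otimes> a \<otimes> x))"
      unfolding add_hom_def
    proof (intro ballI)
      fix a b assume "a \<in> A" "b \<in> A"
      moreover have "inv x \<otimes> (a \<otimes> b) \<otimes> x = (inv x \<otimes> a \<otimes> x) \<otimes> (inv x \<otimes> b \<otimes> x)"
        using Hc x AH \<open>a \<in> A\<close> \<open>b \<in> A\<close> by (simp add: m_assoc mult_inv_cancel)
      ultimately show "\<sigma> (inv x \<otimes> (a \<otimes> b) \<otimes> x) = \<sigma> (inv x \<otimes> a \<otimes> x) + \<sigma> (inv x \<otimes> b \<otimes> x)"
        using add_homD[OF \<sigma>] conjA x by simp
    qed
  qed (use conj_sign x \<sigma>c in auto)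
  \<comment> \<open>\<open>Q\<close> indexes the cosets of \<open>A\<close> in \<open>H\<close> by
    their permutations, \<open>s\<close> chooses representatives, and \<open>e g q\<close> is the
    element of \<open>A\<close> that compares \<open>g\<close> times the representative of
    \<open>q\<close> with the representative of the image coset.\<close>
  define Q where "Q = lam ` H"
  have finQ: "finite Q" unfolding Q_def
    by (rule finite_subset[OF _ finite_lam]) (use Hc in auto)
  define s where "s q = (SOME h. h \<in> H \<and> lam h = q)" for q
  have s: "s q \<in> H" "lam (s q) = q" if "q \<in> Q" for q
    using someI_ex[of "\<lambda>h. h \<in> H \<and> lam h = q"] that unfolding s_def Q_def by auto
  have Qc: "lam g \<circ> q \<in> Q" if "g \<in> H" "q \<in> Q" for g q
    using that Hc sub unfolding Q_def by (auto simp: lam_mult[symmetric] subgroup.m_closed)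
  define e where "e g q = inv (s (lam g \<circ> q)) \<otimes> g \<otimes> s q" for g q
  have eA: "e g q \<in> A" if g: "g \<in> H" and q: "q \<in> Q" for g q
  proof -
    have mem: "s (lam g \<circ> q) \<in> H" "s q \<in> H" using s Qc g q by auto
    have "lam (e g q) = lam (inv (s (lam g \<circ> q))) \<circ> (lam g \<circ> lam (s q))"
      unfolding e_def using mem g Hc by (simp add: lam_mult comp_assoc)
    also have "lam g \<circ> lam (s q) = lam (s (lam g \<circ> q))" using s Qc g q by simp
    also have "lam (inv (s (lam g \<circ> q))) \<circ> lam (s (lam g \<circ> q)) = id"
      using lam_inv(1) Hc mem by blast
    finally show ?thesis unfolding e_def A_def using mem g sub
      by (simp add: subgroup.m_closed subgroup.m_inv_closed)
  qed
  define \<tau> where "\<tau> g = (\<Sum>q\<in>Q. \<sigma> (e g q))" for g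
  have hom: "add_hom H \<tau>"
    unfolding add_hom_def
  proof (intro ballI)
    fix g h assume g: "g \<in> H" and h: "h \<in> H"
    have split: "e (g \<otimes> h) q = e g (lam h \<circ> q) \<otimes> e h q" if q: "q \<in> Q" for q
    proof -
      have mem: "s (lam g \<circ> (lam h \<circ> q)) \<in> carrier G" "s q \<in> carrier G" "s (lam h \<circ> q) \<in> carrier G"
        using s Qc g h q Hc by auto
      show ?thesis unfolding e_def using mem Hc[OF g] Hc[OF h]
        by (simp add: lam_mult comp_assoc m_assoc mult_inv_cancel)
    qed
    have inj: "inj_on (\<lambda>q. lam h \<circ> q) Q"
      by (rule inj_on_inverseI[of _ "\<lambda>q. lam (inv h) \<circ> q"])
         (use lam_inv(1)[OF Hc[OF h]] in \<open>simp add: comp_assoc[symmetric]\<close>)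
    have "(\<lambda>q. lam h \<circ> q) ` Q = Q"
      by (rule endo_inj_surj[OF finQ _ inj]) (use Qc h in auto)
    then have "(\<Sum>q\<in>Q. \<sigma> (e g (lam h \<circ> q))) = \<tau> g"
      unfolding \<tau>_def using sum.reindex[OF inj, of "\<lambda>q. \<sigma> (e g q)"] by simp
    moreover have "\<tau> (g \<otimes> h) = (\<Sum>q\<in>Q. \<sigma> (e g (lam h \<circ> q)) + \<sigma> (e h q))"
      unfolding \<tau>_def by (rule sum.cong) (use split add_homD[OF \<sigma>] eA g h Qc in auto)
    ultimately show "\<tau> (g \<otimes> h) = \<tau> g + \<tau> h" by (simp add: sum.distrib \<tau>_def)
  qed
  have eAA: "e a q = inv (s q) \<otimes> a \<otimes> s q" if "a \<in> A" for a q
    using that by (simp add: e_def A_def)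
  have termpos: "\<sigma> (e a q) \<ge> 0" if a: "a \<in> A" "\<sigma> a \<ge> 0" and q: "q \<in> Q" for a q
    using conj_hom[OF s(1)[OF q]] a unfolding eAA[OF a(1)] by fastforce
  have nonneg: "\<tau> p \<ge> 0" if p: "p \<in> P" for p
  proof -
    obtain N :: nat where N: "N > 0" "\<And>a. a \<in> carrier G \<Longrightarrow> lam (a [^] N) = id"
      using exponent_exists by blast
    have pH: "p \<in> H" using p P pos_coneD(1) by blast
    have "p [^] N \<in> A" using N Hc[OF pH] subgroup_nat_pow_closed[OF sub pH] by (simp add: A_def)
    moreover have "p [^] N \<in> P" using pos_cone_nat_pow[OF P sub p N(1)] .
    ultimately have "\<tau> (p [^] N) \<ge> 0" unfolding \<tau>_def using termpos \<sigma>P by (intro sum_nonneg) auto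
    then show ?thesis using add_hom_nat_pow[OF hom sub pH, of N] N(1) by (simp add: zero_le_mult_iff)
  qed
  \<comment> \<open>The trivial coset contributes exactly \<open>\<sigma> c = 1\<close>, since its
    representative lies in \<open>A\<close> and commutes with \<open>c\<close>; the other terms are
    nonnegative.\<close>
  have idQ: "id \<in> Q" using lam_one subgroup.one_closed[OF sub] unfolding Q_def by force
  have "\<tau> c \<ge> \<sigma> (e c id)" unfolding \<tau>_def
    by (rule member_le_sum[OF idQ _ finQ]) (use termpos cA \<sigma>c in auto)
  moreover have "s id \<otimes> c = c \<otimes> s id" using s[OF idQ] Hc cc c by (intro lam_ker_comm) auto
  then have "e c id = c" unfolding eAA[OF cA] using s(1)[OF idQ] Hc cc
    by (simp add: m_assoc mult_inv_cancel flip: \<open>s id \<otimes> c = c \<otimes> s id\<close>)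
  ultimately have "\<tau> c \<noteq> 0" using \<sigma>c by simp
  then show ?thesis using hom nonneg cH by blast
qed

end

section \<open>Isolated orders\<close>

context group begin

text \<open>Being an isolated point of the space of cones. Finite sets of positive elements suffice
  as neighbourhoods, because a non-identity element is outside a cone exactly when its inverse is
  inside.\<close>

definition isolated_cone :: "'a set \<Rightarrow> 'a set \<Rightarrow> bool" where
  "isolated_cone H P \<longleftrightarrow> pos_cone H P \<and>
     (\<exists>F. finite F \<and> F \<subseteq> P \<and> (\<forall>Q. pos_cone H Q \<longrightarrow> F \<subseteq> Q \<longrightarrow> Q = P))"

lemma finite_cones_isolated:
  assumes fin: "finite {Q. pos_cone H Q}" and P: "pos_cone H P" and sub: "subgroup H G"
  shows "isolated_cone H P"
proof -
  define D where "D = {Q. pos_cone H Q \<and> Q \<noteq> P}"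
  have "finite D" unfolding D_def by (rule finite_subset[OF _ fin]) auto
  have "\<exists>p. p \<in> P \<and> p \<notin> Q" if "Q \<in> D" for Q
    using pos_cone_eqI[OF P _ sub, of Q] that unfolding D_def by auto
  then obtain w where w: "\<And>Q. Q \<in> D \<Longrightarrow> w Q \<in> P \<and> w Q \<notin> Q" by metis
  show ?thesis unfolding isolated_cone_def
  proof (intro conjI P exI[of _ "w ` D"] allI impI)
    show "finite (w ` D)" using \<open>finite D\<close> by simp
    show "w ` D \<subseteq> P" using w by auto
    fix Q assume Q: "pos_cone H Q" "w ` D \<subseteq> Q"
    show "Q = P"
    proof (rule ccontr)
      assume "Q \<noteq> P"
      then have "Q \<in> D" using Q by (simp add: D_def)
      then show False using w[of Q] Q by auto
    qed
  qed
qed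

lemma finite_cones_ker:
  assumes fin: "finite {Q. pos_cone H Q}" and \<tau>: "add_hom H (\<tau> :: 'a \<Rightarrow> int)" and sub: "subgroup H G"
  shows "finite {Q. pos_cone {a \<in> H. \<tau> a = 0} Q}"
proof (rule finite_imageD)
  let ?f = "\<lambda>Q. {a \<in> H. \<tau> a > 0} \<union> Q"
  show "finite (?f ` {Q. pos_cone {a \<in> H. \<tau> a = 0} Q})"
    by (rule finite_subset[OF _ fin]) (use pos_cone_lex[OF \<tau> sub] in auto)
  show "inj_on ?f {Q. pos_cone {a \<in> H. \<tau> a = 0} Q}"
  proof (rule inj_onI)
    fix Q Q' assume "Q \<in> {Q. pos_cone {a \<in> H. \<tau> a = 0} Q}" "Q' \<in> {Q. pos_cone {a \<in> H. \<tau> a = 0} Q}"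
      and eq: "?f Q = ?f Q'"
    then have "Q \<subseteq> {a \<in> H. \<tau> a = 0}" "Q' \<subseteq> {a \<in> H. \<tau> a = 0}" using pos_coneD(1) by blast+
    then have "Q = ?f Q \<inter> {a \<in> H. \<tau> a = 0}" "Q' = ?f Q' \<inter> {a \<in> H. \<tau> a = 0}" by auto
    then show "Q = Q'" using eq by simp
  qed
qed

lemma finite_cones_family:
  assumes "finite I" "finite {Q. pos_cone H Q}" "subgroup H G"
    "\<And>i. i \<in> I \<Longrightarrow> add_hom H (\<phi> i :: 'a \<Rightarrow> int)"
  shows "finite {Q. pos_cone {a \<in> H. \<forall>i\<in>I. \<phi> i a = 0} Q}"
  using assms
proof (induction I arbitrary: H rule: finite_induct)
  case (insert i I)
  have hom: "add_hom H (\<phi> i)" using insert.prems by blast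
  let ?K = "{a \<in> H. \<phi> i a = 0}"
  have eq: "{a \<in> H. \<forall>j\<in>insert i I. \<phi> j a = 0} = {a \<in> ?K. \<forall>j\<in>I. \<phi> j a = 0}" by auto
  have "add_hom ?K (\<phi> j)" if "j \<in> I" for j
    by (rule add_hom_subset[of H]) (use insert.prems(3)[of j] that in auto)
  then show ?case unfolding eq
    by (intro insert.IH finite_cones_ker[OF insert.prems(1) hom] insert.prems(2)
        add_hom_ker_subgroup[OF hom])
qed simp

end

context virt_abelian begin

lemma trivial_cone_rigid:
  "finite {Q. pos_cone {\<one>} Q} \<and> (\<exists>\<tau>0. add_hom {\<one>} (\<tau>0 :: 'a \<Rightarrow> real) \<and> (\<forall>p\<in>P. \<tau>0 p \<ge> 0) \<and>
    (\<forall>\<tau>. add_hom {\<one>} \<tau> \<longrightarrow> (\<exists>r. \<forall>a\<in>{\<one>}. \<tau> a = r * \<tau>0 a)))"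
proof
  show "finite {Q. pos_cone {\<one>} Q}"
    by (rule finite_subset[of _ "Pow {\<one>}"]) (use pos_coneD(1) in auto)
  have "\<tau> \<one> = 0" if "add_hom {\<one>} (\<tau> :: 'a \<Rightarrow> real)" for \<tau>
    by (rule add_hom_one[OF that triv_subgroup])
  then show "\<exists>\<tau>0. add_hom {\<one>} (\<tau>0 :: 'a \<Rightarrow> real) \<and> (\<forall>p\<in>P. \<tau>0 p \<ge> 0) \<and>
    (\<forall>\<tau>. add_hom {\<one>} \<tau> \<longrightarrow> (\<exists>r. \<forall>a\<in>{\<one>}. \<tau> a = r * \<tau>0 a))"
    by (intro exI[of _ "\<lambda>_. 0"]) (auto simp: add_hom_def)
qed

text \<open>Finiteness and proportionality are proved together by induction on \<open>k\<close>,
  passing to the kernel \<open>M\<close> of a monotone \<open>\<tau>0\<close>, where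
  \<open>P\<close> stays isolated. Proportionality on \<open>M\<close> controls the sign of a
  perturbation there; proportionality on \<open>H\<close> then leaves a cone only the sign of its
  monotone homomorphism and its trace on \<open>M\<close> to choose.\<close>

lemma isolated_cone_rigid:
  assumes "poly_Z k H" "isolated_cone H P"
  shows "finite {Q. pos_cone H Q} \<and> (\<exists>\<tau>0. add_hom H (\<tau>0 :: 'a \<Rightarrow> real) \<and> (\<forall>p\<in>P. \<tau>0 p \<ge> 0) \<and>
    (\<forall>\<tau>. add_hom H \<tau> \<longrightarrow> (\<exists>r. \<forall>a\<in>H. \<tau> a = r * \<tau>0 a)))"
  using assms
proof (induction k arbitrary: H P)
  case 0
  then have "H = {\<one>}" using poly_Z_zeroD by blast
  then show ?case using trivial_cone_rigid by simp
next
  case (Suc k)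
  show ?case
  proof (cases "H = {\<one>}")
    case True
    then show ?thesis using trivial_cone_rigid by simp
  next
    case nontriv: False
    have sub: "subgroup H G" by (rule poly_Z_subgroup[OF Suc.prems(1)])
    obtain F where P: "pos_cone H P" and F: "finite F" "F \<subseteq> P"
      and iso: "\<And>Q. pos_cone H Q \<Longrightarrow> F \<subseteq> Q \<Longrightarrow> Q = P"
      using Suc.prems(2) unfolding isolated_cone_def by blast
    have PH: "P \<subseteq> H" using pos_coneD(1)[OF P] .
    obtain \<tau>0 :: "'a \<Rightarrow> real" and h0 where \<tau>0: "add_hom H \<tau>0" and pos: "\<And>p. p \<in> P \<Longrightarrow> \<tau>0 p \<ge> 0"
      and h0: "h0 \<in> H" "\<tau>0 h0 \<noteq> 0"
      using conrad_hom_exists[OF Suc.prems(1) P nontriv] by blast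
    define M where "M = {a \<in> H. \<tau>0 a = 0}"
    have pzM: "poly_Z k M" unfolding M_def by (rule poly_Z_ker[OF Suc.prems(1) \<tau>0 h0])
    have subM: "subgroup M G" by (rule poly_Z_subgroup[OF pzM])
    have MH: "M \<subseteq> H" by (auto simp: M_def)
    \<comment> \<open>A competing cone of \<open>M\<close> that contains the part of
      \<open>F\<close> in \<open>M\<close> extends lexicographically by \<open>\<tau>0\<close> to a
      cone of \<open>H\<close> containing \<open>F\<close>, which must be \<open>P\<close>.\<close>
    have isoM: "isolated_cone M (P \<inter> M)"
      unfolding isolated_cone_def
    proof (intro conjI pos_cone_restrict[OF P subM MH] exI[of _ "F \<inter> M"] allI impI)
      fix Q assume Q: "pos_cone M Q" "F \<inter> M \<subseteq> Q"
      have "{a \<in> H. \<tau>0 a > 0} \<union> Q = P"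
      proof (rule iso)
        show "pos_cone H ({a \<in> H. \<tau>0 a > 0} \<union> Q)"
          using pos_cone_lex[OF \<tau>0 sub] Q(1) by (simp add: M_def)
        show "F \<subseteq> {a \<in> H. \<tau>0 a > 0} \<union> Q"
          using F(2) pos Q(2) PH by (force simp: M_def)
      qed
      moreover have "Q \<subseteq> M" using pos_coneD(1)[OF Q(1)] .
      ultimately show "Q = P \<inter> M" by (auto simp: M_def)
    qed (use F in auto)
    obtain \<tau>1 :: "'a \<Rightarrow> real" where finM: "finite {Q. pos_cone M Q}"
      and \<tau>1: "\<And>p. p \<in> P \<Longrightarrow> p \<in> M \<Longrightarrow> \<tau>1 p \<ge> 0"
      and mult: "\<And>\<tau>. add_hom M \<tau> \<Longrightarrow> \<exists>r. \<forall>a\<in>M. \<tau> a = r * \<tau>1 a"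
      using Suc.IH[OF pzM isoM] by blast
    \<comment> \<open>The perturbation \<open>\<sigma>\<close> of \<open>\<tau>0\<close> by
      \<open>\<epsilon> * \<tau>\<close> is nonnegative on \<open>F\<close>: by smallness of
      \<open>\<epsilon>\<close> where \<open>\<tau>0\<close> is positive, by the sign of
      \<open>r\<close> where \<open>\<tau>0\<close> vanishes. Isolation makes the perturbed cone
      equal to \<open>P\<close>, so \<open>\<tau>0\<close> is nonnegative wherever
      \<open>\<sigma>\<close> is positive.\<close>
    have prop_pos: "\<exists>c. \<forall>a\<in>H. \<tau> a = c * \<tau>0 a"
      if \<tau>: "add_hom H \<tau>" and r: "r \<ge> 0" "\<forall>a\<in>M. \<tau> a = r * \<tau>1 a" for \<tau> :: "'a \<Rightarrow> real" and r
    proof -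
      have "\<exists>\<epsilon>>0. \<forall>p\<in>F. \<tau>0 p > 0 \<longrightarrow> \<tau>0 p + \<epsilon> * \<tau> p > 0"
      proof -
        have "\<forall>\<^sub>F \<epsilon> in at_right 0. \<forall>p\<in>F. \<tau>0 p > 0 \<longrightarrow> \<tau>0 p + \<epsilon> * \<tau> p > 0"
        proof (rule eventually_ball_finite[OF F(1)], rule ballI)
          fix p assume "p \<in> F"
          show "\<forall>\<^sub>F \<epsilon> in at_right 0. \<tau>0 p > 0 \<longrightarrow> \<tau>0 p + \<epsilon> * \<tau> p > 0"
          proof (cases "\<tau>0 p > 0")
            case True
            have "((\<lambda>\<epsilon>. \<tau>0 p + \<epsilon> * \<tau> p) \<longlongrightarrow> \<tau>0 p + 0 * \<tau> p) (at_right 0)"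
              by (intro tendsto_intros)
            then show ?thesis using order_tendstoD(1)[of _ "\<tau>0 p" _ 0] True by simp
          qed simp
        qed
        moreover have "\<forall>\<^sub>F \<epsilon> in at_right (0::real). \<epsilon> > 0" by (rule eventually_at_right_less)
        ultimately have "\<forall>\<^sub>F \<epsilon> in at_right (0::real). \<epsilon> > 0 \<and> (\<forall>p\<in>F. \<tau>0 p > 0 \<longrightarrow> \<tau>0 p + \<epsilon> * \<tau> p > 0)"
          by eventually_elim auto
        then show ?thesis using eventually_happens[of _ "at_right (0::real)"] by auto
      qed
      then obtain \<epsilon> where \<epsilon>: "\<epsilon> > 0" "\<And>p. p \<in> F \<Longrightarrow> \<tau>0 p > 0 \<Longrightarrow> \<tau>0 p + \<epsilon> * \<tau> p > 0" by blast
      define \<sigma> where "\<sigma> a = \<tau>0 a + \<epsilon> * \<tau> a" for a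
      have \<sigma>: "add_hom H \<sigma>" using \<tau>0 \<tau> unfolding add_hom_def \<sigma>_def by (simp add: algebra_simps)
      have "{a \<in> H. \<sigma> a > 0} \<union> (P \<inter> {a \<in> H. \<sigma> a = 0}) = P"
      proof (rule iso[OF pos_cone_perturb[OF \<sigma> sub P]], rule subsetI)
        fix p assume p: "p \<in> F"
        then have pP: "p \<in> P" "p \<in> H" using F PH by auto
        have "\<sigma> p \<ge> 0"
        proof (cases "\<tau>0 p > 0")
          case True
          then show ?thesis using \<epsilon>(2)[OF p] by (simp add: \<sigma>_def)
        next
          case False
          then have "\<tau>0 p = 0" using pos[OF pP(1)] by simp
          then have "p \<in> M" using pP by (simp add: M_def)
          then have "\<tau> p \<ge> 0" using r \<tau>1[OF pP(1)] by simp
          then show ?thesis using \<open>\<tau>0 p = 0\<close> \<epsilon>(1) by (simp add: \<sigma>_def)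
        qed
        then show "p \<in> {a \<in> H. \<sigma> a > 0} \<union> (P \<inter> {a \<in> H. \<sigma> a = 0})" using pP by auto
      qed
      then have mono: "\<tau>0 a \<ge> 0" if "a \<in> H" "\<sigma> a > 0" for a using that pos by blast
      show ?thesis
      proof (cases "\<forall>a\<in>H. \<sigma> a = 0")
        case True
        have "\<tau> a = (- 1 / \<epsilon>) * \<tau>0 a" if "a \<in> H" for a
        proof -
          have "\<epsilon> * \<tau> a = - \<tau>0 a" using True that unfolding \<sigma>_def by (simp add: add_eq_0_iff)
          then show ?thesis using \<epsilon>(1) by (simp add: field_simps)
        qed
        then show ?thesis by blast
      next
        case False
        then obtain h where "h \<in> H" "\<sigma> h \<noteq> 0" by blast
        from add_hom_proportional[OF \<sigma> \<tau>0 sub mono this]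
        obtain c where c: "\<forall>a\<in>H. \<tau>0 a = c * \<sigma> a" by blast
        have "c \<noteq> 0" using c h0 by auto
        then have "\<tau> a = ((1 - c) / (c * \<epsilon>)) * \<tau>0 a" if "a \<in> H" for a
          using c that \<epsilon>(1) unfolding \<sigma>_def by (simp add: field_simps)
        then show ?thesis by blast
      qed
    qed
    have proportional: "\<exists>c. \<forall>a\<in>H. \<tau> a = c * \<tau>0 a" if \<tau>: "add_hom H \<tau>" for \<tau> :: "'a \<Rightarrow> real"
    proof -
      obtain r where r: "\<forall>a\<in>M. \<tau> a = r * \<tau>1 a" using mult[OF add_hom_subset[OF \<tau> MH]] by blast
      show ?thesis
      proof (cases "r \<ge> 0")
        case True
        then show ?thesis using prop_pos[OF \<tau> True r] by blast
      next
        case False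
        have "add_hom H (\<lambda>a. - \<tau> a)" using \<tau> by (simp add: add_hom_def)
        moreover have "\<forall>a\<in>M. - \<tau> a = (- r) * \<tau>1 a" using r by simp
        ultimately obtain c where "\<forall>a\<in>H. - \<tau> a = c * \<tau>0 a" using prop_pos[of _ "- r"] False by force
        then have "\<forall>a\<in>H. \<tau> a = (- c) * \<tau>0 a" by (metis minus_minus minus_mult_left)
        then show ?thesis by blast
      qed
    qed
    \<comment> \<open>The boolean is the sign of the factor relating the monotone homomorphism of a
      cone to \<open>\<tau>0\<close>.\<close>
    define f where "f = (\<lambda>(b, Q). {a \<in> H. if b then \<tau>0 a > 0 else \<tau>0 a < 0} \<union> Q)"
    have "{Q. pos_cone H Q} \<subseteq> f ` (UNIV \<times> {Q. pos_cone M Q})"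
    proof
      fix Q assume "Q \<in> {Q. pos_cone H Q}"
      then have Q: "pos_cone H Q" by simp
      obtain \<tau> :: "'a \<Rightarrow> real" and h where \<tau>: "add_hom H \<tau>" "\<And>p. p \<in> Q \<Longrightarrow> \<tau> p \<ge> 0" "h \<in> H" "\<tau> h \<noteq> 0"
        using conrad_hom_exists[OF Suc.prems(1) Q nontriv] by blast
      obtain c where c: "\<And>a. a \<in> H \<Longrightarrow> \<tau> a = c * \<tau>0 a" using proportional[OF \<tau>(1)] by blast
      have c0: "c \<noteq> 0" using c[OF \<tau>(3)] \<tau>(4) by auto
      have "Q = {a \<in> H. \<tau> a > 0} \<union> (Q \<inter> M)"
      proof (intro equalityI subsetI)
        fix a assume a: "a \<in> Q"
        then have aH: "a \<in> H" using pos_coneD(1)[OF Q] by blast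
        show "a \<in> {a \<in> H. \<tau> a > 0} \<union> (Q \<inter> M)"
          using \<tau>(2)[OF a] a aH c[OF aH] c0 by (cases "\<tau> a = 0") (auto simp: M_def less_le)
      next
        fix a assume a: "a \<in> {a \<in> H. \<tau> a > 0} \<union> (Q \<inter> M)"
        show "a \<in> Q"
        proof (rule ccontr)
          assume "a \<notin> Q"
          then have aH: "a \<in> H" "\<tau> a > 0" using a by auto
          then have "a \<noteq> \<one>" using add_hom_one[OF \<tau>(1) sub] by auto
          then have "inv a \<in> Q" using pos_coneD(4)[OF Q aH(1)] \<open>a \<notin> Q\<close> by blast
          then show False using \<tau>(2) add_hom_inv[OF \<tau>(1) sub aH(1)] aH(2) by force
        qed
      qed
      also have "{a \<in> H. \<tau> a > 0} = {a \<in> H. if c > 0 then \<tau>0 a > 0 else \<tau>0 a < 0}"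
        using c c0 by (auto simp: zero_less_mult_iff)
      finally have "Q = f (c > 0, Q \<inter> M)" by (simp add: f_def)
      then show "Q \<in> f ` (UNIV \<times> {Q. pos_cone M Q})"
        using pos_cone_restrict[OF Q subM MH] by blast
    qed
    then have "finite {Q. pos_cone H Q}"
      by (rule finite_subset) (intro finite_imageI finite_cartesian_product finM finite)
    then show ?thesis using \<tau>0 pos proportional by blast
  qed
qed

text \<open>With finitely many cones each one is isolated, so both homomorphisms are multiples of a
  single real one and every 2 by 2 determinant of their values vanishes.\<close>

lemma finite_cones_dependent:
  assumes pz: "poly_Z k H" and fin: "finite {Q. pos_cone H Q}"
    and \<phi>: "add_hom H (\<phi> :: 'a \<Rightarrow> int)" and \<psi>: "add_hom H (\<psi> :: 'a \<Rightarrow> int)" and ab: "a \<in> H" "b \<in> H"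
  shows "\<phi> a * \<psi> b = \<phi> b * \<psi> a"
proof -
  obtain P where P: "pos_cone H P" using poly_Z_pos_cone[OF pz] by blast
  have "isolated_cone H P" using finite_cones_isolated[OF fin P poly_Z_subgroup[OF pz]] .
  then obtain \<tau>0 where proportional: "\<And>\<tau>. add_hom H (\<tau> :: 'a \<Rightarrow> real) \<Longrightarrow> \<exists>r. \<forall>a\<in>H. \<tau> a = r * \<tau>0 a"
    using isolated_cone_rigid[OF pz] by blast
  have "add_hom H (\<lambda>a. real_of_int (\<phi> a))" "add_hom H (\<lambda>a. real_of_int (\<psi> a))"
    using \<phi> \<psi> by (auto simp: add_hom_def)
  from proportional[OF this(1)] proportional[OF this(2)] obtain r s where
    "\<forall>a\<in>H. real_of_int (\<phi> a) = r * \<tau>0 a" "\<forall>a\<in>H. real_of_int (\<psi> a) = s * \<tau>0 a" by blast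
  then have "real_of_int (\<phi> a) * real_of_int (\<psi> b) = real_of_int (\<phi> b) * real_of_int (\<psi> a)"
    using ab by simp
  then show ?thesis by (metis of_int_eq_iff of_int_mult)
qed

end

section \<open>Solutions, words and the cocycle\<close>

abbreviation word_over :: "'a set \<Rightarrow> 'a word \<Rightarrow> bool" where
  "word_over X w \<equiv> fst ` set w \<subseteq> X"

primrec word_act :: "('a \<Rightarrow> 'q \<Rightarrow> 'q) \<Rightarrow> 'a word \<Rightarrow> 'q \<Rightarrow> 'q" where
  "word_act h [] = id"
| "word_act h (l # w) = (if snd l then h (fst l) else inv_into UNIV (h (fst l))) \<circ> word_act h w"

definition map_word :: "('a \<Rightarrow> 'b) \<Rightarrow> 'a word \<Rightarrow> 'b word" where
  "map_word c w = map (\<lambda>l. (c (fst l), snd l)) w"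

lemma map_word_simps [simp]:
  "map_word c [] = []" "map_word c (l # w) = (c (fst l), snd l) # map_word c w"
  "map_word c (u @ v) = map_word c u @ map_word c v"
  by (simp_all add: map_word_def)

lemma word_over_map_word: "word_over Y (map_word c w) \<longleftrightarrow> c ` fst ` set w \<subseteq> Y"
  by (simp add: map_word_def image_image)

lemma word_act_append: "word_act h (u @ v) = word_act h u \<circ> word_act h v"
  by (induction u) (auto simp: comp_assoc)

lemma word_act_cong:
  assumes "\<And>x. x \<in> X \<Longrightarrow> h x = h' (c x)" "word_over X w"
  shows "word_act h w = word_act h' (map_word c w)"
  using assms(2) by (induction w) (auto simp: assms(1))

lemma word_act_invariant:
  assumes "sg_eq X {} g f v w"
    and bij: "\<And>x. x \<in> X \<Longrightarrow> bij (h x)"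
    and rel: "\<And>x y. x \<in> X \<Longrightarrow> y \<in> X \<Longrightarrow> h x \<circ> h y = h (g x y) \<circ> h (f y x)"
  shows "word_act h v = word_act h w"
  using assms(1)
proof induction
  case (cancel u v x b)
  then have "word_act h [(x, b), (x, \<not> b)] = id"
    using bij[of x] by (auto simp: bij_is_inj inv_o_cancel surj_iff[symmetric] bij_is_surj)
  then show ?case by (simp only: word_act_append) simp
next
  case (braid u v x y)
  then have "word_act h [(x, True), (y, True)] = word_act h [(g x y, True), (f y x, True)]"
    using rel by simp
  then show ?case by (simp only: word_act_append)
qed auto

definition word_degree :: "'a word \<Rightarrow> int" where
  "word_degree w = (\<Sum>l\<leftarrow>w. if snd l then 1 else - 1)"

lemma word_degree_append: "word_degree (u @ v) = word_degree u + word_degree v"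
  by (simp add: word_degree_def)

lemma word_degree_invariant: "sg_eq X E g f v w \<Longrightarrow> word_degree v = word_degree w"
  by (induction rule: sg_eq.induct) (auto simp: word_degree_def)

definition word_inv :: "'a word \<Rightarrow> 'a word" where
  "word_inv w = rev (map (map_prod id Not) w)"

lemma word_over_inv: "word_over X (word_inv w) \<longleftrightarrow> word_over X w"
  by (auto simp: word_inv_def image_image)

lemma sg_eq_map:
  assumes "sg_eq X E g f v w"
    and c: "\<And>x. x \<in> X \<Longrightarrow> c x \<in> Y"
    and E: "\<And>x y. (x, y) \<in> E \<Longrightarrow> x \<in> X \<Longrightarrow> y \<in> X \<Longrightarrow> c x = c y"
    and g: "\<And>x y. x \<in> X \<Longrightarrow> y \<in> X \<Longrightarrow> c (g x y) = g' (c x) (c y)"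
    and f: "\<And>x y. x \<in> X \<Longrightarrow> y \<in> X \<Longrightarrow> c (f x y) = f' (c x) (c y)"
  shows "sg_eq Y {} g' f' (map_word c v) (map_word c w)"
proof -
  have wo: "word_over Y (map_word c u)" if "word_over X u" for u
    using that c unfolding word_over_map_word by auto
  show ?thesis using assms(1)
  proof induction
    case (refl w)
    then show ?case by (intro sg_eq.refl wo)
  next
    case (sym v w)
    show ?case by (rule sg_eq.sym[OF sym.IH])
  next
    case (trans u v w)
    show ?case by (rule sg_eq.trans[OF trans.IH])
  next
    case (cancel u v x b)
    then show ?case using sg_eq.cancel[OF wo[of u] wo[of v] c[of x]] by simp
  next
    case (braid u v x y)
    then show ?case using sg_eq.braid[OF wo[of u] wo[of v] c[of x] c[of y]] g f by simp
  next
    case (gen u v x y)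
    then have "word_over Y (map_word c (u @ [(x, True)] @ v))"
      by (intro wo) auto
    from sg_eq.refl[OF this] show ?case using E[OF gen(3-5)] by simp
  qed
qed

text \<open>\<open>inv_g\<close> and \<open>inv_f\<close> are the two components of involutivity;
  \<open>gg\<close> and \<open>ff\<close> are the outer components of the braid relation.\<close>

locale ybe =
  fixes X :: "'a set" and g f :: "'a \<Rightarrow> 'a \<Rightarrow> 'a"
  assumes finite_X: "finite X"
    and g_closed: "x \<in> X \<Longrightarrow> y \<in> X \<Longrightarrow> g x y \<in> X"
    and f_closed: "x \<in> X \<Longrightarrow> y \<in> X \<Longrightarrow> f x y \<in> X"
    and g_bij: "x \<in> X \<Longrightarrow> bij_betw (g x) X X"
    and f_bij: "x \<in> X \<Longrightarrow> bij_betw (f x) X X"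
    and inv_g: "x \<in> X \<Longrightarrow> y \<in> X \<Longrightarrow> g (g x y) (f y x) = x"
    and inv_f: "x \<in> X \<Longrightarrow> y \<in> X \<Longrightarrow> f (f y x) (g x y) = y"
    and gg: "x \<in> X \<Longrightarrow> y \<in> X \<Longrightarrow> z \<in> X \<Longrightarrow> g x (g y z) = g (g x y) (g (f y x) z)"
    and ff: "x \<in> X \<Longrightarrow> y \<in> X \<Longrightarrow> z \<in> X \<Longrightarrow> f z (f y x) = f (f z y) (f (g y z) x)"
begin

abbreviation wequiv :: "'a word \<Rightarrow> 'a word \<Rightarrow> bool" where
  "wequiv \<equiv> sg_eq X {} g f"

lemma g_inj: "x \<in> X \<Longrightarrow> y \<in> X \<Longrightarrow> z \<in> X \<Longrightarrow> g x y = g x z \<Longrightarrow> y = z"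
  using g_bij[of x] by (auto simp: bij_betw_def inj_on_def)

lemma f_inj: "x \<in> X \<Longrightarrow> y \<in> X \<Longrightarrow> z \<in> X \<Longrightarrow> f x y = f x z \<Longrightarrow> y = z"
  using f_bij[of x] by (auto simp: bij_betw_def inj_on_def)

lemma g_surj: "x \<in> X \<Longrightarrow> y \<in> X \<Longrightarrow> \<exists>z\<in>X. g x z = y"
  using g_bij[of x] unfolding bij_betw_def by (metis imageE)

lemma f_surj: "x \<in> X \<Longrightarrow> y \<in> X \<Longrightarrow> \<exists>z\<in>X. f x z = y"
  using f_bij[of x] unfolding bij_betw_def by (metis imageE)

text \<open>Take \<open>z\<close> to be the preimage of \<open>y\<close> under \<open>f y\<close>.
  Sending \<open>y\<close> to \<open>z\<close> gives the diagonal map \<open>T\<close> of Etingof,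
  Schedler and Soloviev.\<close>

lemma diagonal_exists: "y \<in> X \<Longrightarrow> \<exists>z\<in>X. g z y = z"
proof -
  assume y: "y \<in> X"
  obtain z where z: "z \<in> X" "f y z = y" using f_surj y by blast
  have "f y (g z y) = f y z" using inv_f[of z y] y z by simp
  then show ?thesis using f_inj g_closed y z by blast
qed

lemma diagonal_unique:
  assumes "y \<in> X" "z \<in> X" "z' \<in> X" "g z y = z" "g z' y = z'"
  shows "z = z'"
proof -
  have "f y u = y" if "u \<in> X" "g u y = u" for u
    using inv_g[of u y] g_inj[of u "f y u" y] f_closed that assms(1) by simp
  then show ?thesis using assms f_inj by metis
qed

text \<open>In relational form this is \<open>f x (T (g x y)) = T y\<close> for the diagonal map
  \<open>T\<close>.\<close>

lemma diagonal_shift: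
  assumes "x \<in> X" "y \<in> X" "w \<in> X" "g w (g x y) = w"
  shows "g (f x w) y = f x w"
proof -
  have "g (g w x) (g (f x w) y) = g (g w x) (f x w)" using gg[of w x y] inv_g[of w x] assms by simp
  then show ?thesis using g_inj assms g_closed f_closed by metis
qed

text \<open>The diagonal \<open>T\<close> is a bijection, by finiteness, and conjugates the inverse
  of \<open>g x\<close> into \<open>f x\<close>; so either of the two maps determines the other.
  This lets a retract relation defined by \<open>f\<close> control an action defined by
  \<open>g\<close>.\<close>

lemma f_eq_iff_g_eq:
  assumes x: "x \<in> X" and x': "x' \<in> X"
  shows "(\<forall>z\<in>X. f x z = f x' z) \<longleftrightarrow> (\<forall>z\<in>X. g x z = g x' z)"
proof -
  obtain T where T: "\<And>y. y \<in> X \<Longrightarrow> T y \<in> X" "\<And>y. y \<in> X \<Longrightarrow> g (T y) y = T y"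
    using diagonal_exists by metis
  have fT: "f a (T (g a y)) = T y" if "a \<in> X" "y \<in> X" for a y
    by (rule diagonal_unique[of y]) (use that T f_closed g_closed diagonal_shift in auto)
  have injT: "inj_on T X"
  proof (rule inj_onI)
    fix y y' assume y: "y \<in> X" "y' \<in> X" "T y = T y'"
    then have "g (T y) y = g (T y) y'" using T(2)[of y] T(2)[of y'] by simp
    then show "y = y'" by (rule g_inj[OF T(1)[OF y(1)] y(1,2)])
  qed
  have surjT: "T ` X = X" by (rule endo_inj_surj[OF finite_X _ injT]) (use T in auto)
  show ?thesis
  proof (intro iffI ballI)
    fix z assume eq: "\<forall>z\<in>X. f x z = f x' z" and z: "z \<in> X"
    have "f x (T (g x z)) = f x (T (g x' z))" using fT[OF x z] fT[OF x' z] eq T g_closed x x' z by simp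
    then have "T (g x z) = T (g x' z)"
      by (rule f_inj[OF x T(1)[OF g_closed[OF x z]] T(1)[OF g_closed[OF x' z]]])
    then show "g x z = g x' z" using injT g_closed x x' z by (auto simp: inj_on_def)
  next
    fix z assume eq: "\<forall>z\<in>X. g x z = g x' z" and z: "z \<in> X"
    have "z \<in> T ` X" using surjT z by simp
    then obtain u where u: "u \<in> X" "T u = z" by blast
    obtain y where y: "y \<in> X" "g x y = u" using g_surj[OF x u(1)] by blast
    have "g x' y = u" using eq y by auto
    then have "f x (T u) = T y" "f x' (T u) = T y" using fT[OF x y(1)] fT[OF x' y(1)] y by auto
    then show "f x z = f x' z" using u by simp
  qed
qed

text \<open>By \<open>ff\<close>, \<open>f (f z x)\<close> after \<open>f (g x z)\<close> equals
  \<open>f z\<close> after \<open>f x\<close>, and all maps except the first depend on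
  \<open>x\<close> only through \<open>f x\<close> and \<open>g x\<close>. For
  \<open>f (g z x)\<close> the same argument runs with \<open>gg\<close> and is carried over by
  \<open>f_eq_iff_g_eq\<close>.\<close>

lemma retract_cong:
  assumes x: "x \<in> X" and x': "x' \<in> X" and z: "z \<in> X" and u: "u \<in> X" and eq: "\<forall>z\<in>X. f x z = f x' z"
  shows "f (f z x) u = f (f z x') u" "f (g z x) u = f (g z x') u"
proof -
  have geq: "\<forall>z\<in>X. g x z = g x' z" using eq f_eq_iff_g_eq x x' by blast
  obtain v where v: "v \<in> X" "f (g x z) v = u" using f_surj g_closed x z u by blast
  have "f (f z x) u = f z (f x v)" using ff[of v x z] x z v by simp
  also have "\<dots> = f (f z x') (f (g x' z) v)" using ff[of v x' z] x' z v eq by simp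
  finally show "f (f z x) u = f (f z x') u" using geq z v by simp
  have "\<forall>u\<in>X. g (g z x) u = g (g z x') u"
  proof
    fix u assume u: "u \<in> X"
    obtain v where v: "v \<in> X" "g (f x z) v = u" using g_surj f_closed x z u by blast
    have "g (g z x) u = g z (g x v)" using gg[of z x v] x z v by simp
    also have "\<dots> = g (g z x') (g (f x' z) v)" using gg[of z x' v] x' z v geq by simp
    finally show "g (g z x) u = g (g z x') u" using eq z v by simp
  qed
  then show "f (g z x) u = f (g z x') u" using f_eq_iff_g_eq[of "g z x" "g z x'"] g_closed x x' z u by blast
qed

text \<open>Extended by the identity outside \<open>X\<close>, so that it is a bijection of the
  whole type and inverses can be taken on \<open>UNIV\<close>.\<close>

definition gperm :: "'a \<Rightarrow> 'a \<Rightarrow> 'a" where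
  "gperm x = (\<lambda>y. if y \<in> X then g x y else y)"

lemma gperm_permutes: "x \<in> X \<Longrightarrow> gperm x permutes X"
  by (rule bij_imp_permutes) (use g_bij[of x] in \<open>auto simp: gperm_def bij_betw_def inj_on_def\<close>)

lemma gperm_bij: "x \<in> X \<Longrightarrow> bij (gperm x)"
  using gperm_permutes permutes_bij by blast

lemma gperm_inv_eq: "x \<in> X \<Longrightarrow> inv_into UNIV (gperm x) u = v \<longleftrightarrow> u = gperm x v"
  using bij_inv_eq_iff[OF gperm_bij, of x v u] by auto

lemma gperm_rel: "x \<in> X \<Longrightarrow> y \<in> X \<Longrightarrow> gperm x \<circ> gperm y = gperm (g x y) \<circ> gperm (f y x)"
  by (rule ext) (simp add: gperm_def g_closed f_closed gg[symmetric])

definition wperm :: "'a word \<Rightarrow> 'a \<Rightarrow> 'a" where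
  "wperm = word_act gperm"

lemma wperm_append: "wperm (u @ v) = wperm u \<circ> wperm v"
  by (simp add: wperm_def word_act_append)

lemma wperm_permutes: "word_over X w \<Longrightarrow> wperm w permutes X"
proof (induction w)
  case Nil
  show ?case unfolding wperm_def by (simp only: word_act.simps permutes_id)
next
  case (Cons l w)
  then have "(if snd l then gperm (fst l) else inv_into UNIV (gperm (fst l))) permutes X"
    using gperm_permutes permutes_inv by auto
  moreover have "word_act gperm w permutes X" using Cons by (simp add: wperm_def)
  ultimately show ?case unfolding wperm_def word_act.simps by (intro permutes_compose)
qed

lemma wperm_bij: "word_over X w \<Longrightarrow> bij (wperm w)"
  using wperm_permutes permutes_bij by blast

lemma wperm_invariant: "wequiv v w \<Longrightarrow> wperm v = wperm w"
  unfolding wperm_def by (rule word_act_invariant[of X g f]) (auto intro: gperm_bij gperm_rel)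

text \<open>The 1-cocycle with value e_x on the letter x, where words act by permuting coordinates;
  hence the rest of the word is read at the preimage of \<open>z\<close>. The clause for inverse
  letters is forced by cancellation.\<close>

primrec cocycle :: "'a word \<Rightarrow> 'a \<Rightarrow> int" where
  "cocycle [] z = 0"
| "cocycle (l # w) z = (if snd l then of_bool (z = fst l) + cocycle w (inv_into UNIV (gperm (fst l)) z)
     else cocycle w (gperm (fst l) z) - of_bool (gperm (fst l) z = fst l))"

lemma cocycle_append:
  assumes "word_over X u"
  shows "cocycle (u @ v) z = cocycle u z + cocycle v (inv_into UNIV (wperm u) z)"
  using assms
proof (induction u arbitrary: z)
  case Nil
  show ?case by (simp add: wperm_def)
next
  case (Cons l u)
  obtain x b where l: "l = (x, b)" by (cases l)
  have bx: "bij (gperm x)" using Cons.prems l by (auto intro: gperm_bij)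
  have bu: "bij (wperm u)" using Cons.prems by (auto intro: wperm_bij)
  have "inv_into UNIV (wperm (l # u)) = inv_into UNIV (wperm u) \<circ> (if b then inv_into UNIV (gperm x) else gperm x)"
    using bx bu by (auto simp: wperm_def l o_inv_distrib bij_imp_bij_inv inv_inv_eq)
  then show ?case using Cons l by (cases b) auto
qed

lemma cocycle_pair: 
  assumes "x \<in> X" "y \<in> X"
  shows "cocycle [(x, True), (y, True)] z = of_bool (z = x) + of_bool (z = g x y)"
proof -
  have "inv_into UNIV (gperm x) z = y \<longleftrightarrow> z = gperm x y" by (rule gperm_inv_eq[OF assms(1)])
  then show ?thesis using assms by (simp add: gperm_def)
qed

lemma sg_eq_word_over: "sg_eq X E g f v w \<Longrightarrow> word_over X v \<and> word_over X w"
  by (induction rule: sg_eq.induct) (auto simp: g_closed f_closed)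

lemma cocycle_invariant: "wequiv v w \<Longrightarrow> cocycle v = cocycle w"
proof (induction rule: sg_eq.induct)
  case (cancel u v x b)
  have c: "cocycle [(x, b), (x, \<not> b)] z = 0" for z
    using gperm_bij[OF cancel(3)] by (cases b) (auto simp: bij_is_surj surj_f_inv_f)
  have p: "wperm [(x, b), (x, \<not> b)] = id"
    using wperm_invariant[OF sg_eq.cancel[of "[]" X "[]" x "{}" g f b]] cancel by (simp add: wperm_def)
  have w: "word_over X [(x, b), (x, \<not> b)]" using cancel by simp
  show ?case using cancel(1) w c p by (intro ext) (simp only: cocycle_append, simp)
next
  case (braid u v x y)
  \<comment> \<open>Both sides are the indicators of \<open>x\<close> and of \<open>g x y\<close>,
    added in opposite order, thanks to \<open>inv_g\<close>.\<close>
  have c: "cocycle [(x, True), (y, True)] z = cocycle [(g x y, True), (f y x, True)] z" for z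
    using braid by (subst (1 2) cocycle_pair) (auto simp: g_closed f_closed inv_g)
  have p: "wperm [(x, True), (y, True)] = wperm [(g x y, True), (f y x, True)]"
    using wperm_invariant[OF sg_eq.braid[of "[]" X "[]" x y "{}" g f]] braid by simp
  have w: "word_over X [(x, True), (y, True)]" "word_over X [(g x y, True), (f y x, True)]"
    using braid by (auto simp: g_closed f_closed)
  show ?case using braid(1) w c p by (intro ext) (simp only: cocycle_append)
qed auto

lemma cocycle_outside: "word_over X w \<Longrightarrow> z \<notin> X \<Longrightarrow> cocycle w z = 0"
proof (induction w arbitrary: z)
  case (Cons l w)
  have "gperm (fst l) z = z" using Cons.prems by (simp add: gperm_def)
  moreover from this have "inv_into UNIV (gperm (fst l)) z = z"
    using Cons.prems by (auto simp: gperm_inv_eq)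
  ultimately show ?case using Cons by auto
qed simp

text \<open>For \<open>z\<close> diagonal over \<open>y'\<close> the inverse letter of
  \<open>z\<close> has cocycle minus the indicator of \<open>y'\<close>, which the letter
  \<open>x\<close> moves to \<open>g x y'\<close>.\<close>

lemma cocycle_difference:
  assumes "x \<in> X" "y' \<in> X" "z \<in> X" "g z y' = z"
  shows "cocycle [(x, True), (z, False)] u = of_bool (u = x) - of_bool (u = g x y')"
proof -
  have fixed: "gperm z y' = z" using assms by (simp add: gperm_def)
  have "gperm z (inv_into UNIV (gperm x) u) = z \<longleftrightarrow> inv_into UNIV (gperm x) u = y'"
    using inj_eq[OF bij_is_inj[OF gperm_bij[OF assms(3)]], of _ y'] unfolding fixed .
  also have "\<dots> \<longleftrightarrow> u = g x y'" unfolding gperm_inv_eq[OF assms(1)] using assms(2) by (simp add: gperm_def)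
  finally show ?thesis by simp
qed

section \<open>Words modulo the defining relations\<close>

lemma sg_eq_context:
  "sg_eq X E g f v w \<Longrightarrow> word_over X s \<Longrightarrow> word_over X t \<Longrightarrow> sg_eq X E g f (s @ v @ t) (s @ w @ t)"
proof (induction rule: sg_eq.induct)
  case (refl w)
  then show ?case by (intro sg_eq.refl) auto
next
  case (sym v w)
  show ?case by (rule sg_eq.sym[OF sym.IH[OF sym.prems]])
next
  case (trans u v w)
  show ?case by (rule sg_eq.trans[OF trans.IH(1)[OF trans.prems] trans.IH(2)[OF trans.prems]])
next
  case (cancel u v x b)
  then show ?case using sg_eq.cancel[of "s @ u" X "v @ t" x] by (simp add: image_Un)
next
  case (braid u v x y)
  then show ?case using sg_eq.braid[of "s @ u" X "v @ t" x y] by (simp add: image_Un)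
next
  case (gen u v x y)
  then show ?case using sg_eq.gen[of "s @ u" X "v @ t" x y] by (simp add: image_Un)
qed

lemma sg_eq_append_left: "sg_eq X E g f v w \<Longrightarrow> word_over X t \<Longrightarrow> sg_eq X E g f (t @ v) (t @ w)"
  using sg_eq_context[of E v w t "[]"] by simp

lemma sg_eq_append_right: "sg_eq X E g f v w \<Longrightarrow> word_over X t \<Longrightarrow> sg_eq X E g f (v @ t) (w @ t)"
  using sg_eq_context[of E v w "[]" t] by simp

lemma sg_eq_append: "sg_eq X E g f v w \<Longrightarrow> sg_eq X E g f v' w' \<Longrightarrow> sg_eq X E g f (v @ v') (w @ w')"
  using sg_eq_append_left sg_eq_append_right sg_eq_word_over sg_eq.trans by metis

lemma sg_eq_inv_right: "word_over X w \<Longrightarrow> sg_eq X E g f (w @ word_inv w) []"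
proof (induction w rule: rev_induct)
  case Nil
  show ?case by (simp add: word_inv_def sg_eq.refl)
next
  case (snoc l w)
  obtain x b where l: "l = (x, b)" by (cases l)
  have "sg_eq X E g f (w @ [(x, b), (x, \<not> b)] @ word_inv w) (w @ word_inv w)"
    using snoc.prems word_over_inv[of w X] by (intro sg_eq.cancel) (auto simp: l)
  then show ?case using snoc sg_eq.trans by (fastforce simp: word_inv_def l)
qed

lemma sg_eq_inv_left: "word_over X w \<Longrightarrow> sg_eq X E g f (word_inv w @ w) []"
  using sg_eq_inv_right[of "word_inv w" E] word_over_inv[of w X]
  by (simp add: word_inv_def rev_map map_prod.compositionality comp_def)

section \<open>Positive words, left fractions and the injectivity of the cocycle\<close>

abbreviation pos_word :: "'a list \<Rightarrow> 'a word" where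
  "pos_word xs \<equiv> map (\<lambda>x. (x, True)) xs"

abbreviation neg_word :: "'a list \<Rightarrow> 'a word" where
  "neg_word xs \<equiv> map (\<lambda>x. (x, False)) xs"

lemma fst_letter_image: "fst ` (\<lambda>x. (x, b)) ` A = A"
  by (simp add: image_image)

lemma word_inv_pos_word: "word_inv (pos_word (rev ys)) = neg_word ys"
  by (simp add: word_inv_def rev_map)

lemma cocycle_pos_word_nonneg: "cocycle (pos_word xs) z \<ge> 0"
  by (induction xs arbitrary: z) auto

text \<open>A letter with positive coordinate can be brought to the front: the tail is first made to
  start with the \<open>x'\<close> for which \<open>g y x' = x\<close>, and one braid relation then
  puts \<open>x\<close> in front of the pair.\<close>

lemma pos_word_extract:
  assumes "set xs \<subseteq> X" "x \<in> X" "cocycle (pos_word xs) x > 0"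
  shows "\<exists>ys. set ys \<subseteq> X \<and> wequiv (pos_word xs) (pos_word (x # ys))"
  using assms
proof (induction xs arbitrary: x)
  case (Cons y xs)
  show ?case
  proof (cases "x = y")
    case True
    then show ?thesis using Cons.prems sg_eq.refl[of "pos_word (y # xs)" X "{}" g f]
      by (intro exI[of _ xs]) (auto simp: image_image)
  next
    case False
    have y: "y \<in> X" "set xs \<subseteq> X" using Cons.prems by auto
    obtain x' where x': "x' \<in> X" "g y x' = x" using g_surj y Cons.prems(2) by blast
    have "inv_into UNIV (gperm y) x = x'" unfolding gperm_inv_eq[OF y(1)] using x' by (simp add: gperm_def)
    then have "cocycle (pos_word xs) x' > 0" using Cons.prems(3) False by simp
    then obtain ys where ys: "set ys \<subseteq> X" "wequiv (pos_word xs) (pos_word (x' # ys))"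
      using Cons.IH[OF y(2) x'(1)] by blast
    have "wequiv (pos_word (y # xs)) (pos_word (y # x' # ys))"
      using sg_eq_append_left[OF ys(2), of "[(y, True)]"] y by simp
    moreover have "wequiv (pos_word (y # x' # ys)) (pos_word (x # f x' y # ys))"
      using sg_eq.braid[of "[]" X "pos_word ys" y x' "{}" g f] ys(1) x' y by (simp add: fst_letter_image)
    ultimately show ?thesis using sg_eq.trans ys(1) f_closed x' y
      by (intro exI[of _ "f x' y # ys"]) fastforce
  qed
qed simp

lemma cocycle_Cons_cancel:
  assumes "x \<in> X" "cocycle ((x, True) # v) = cocycle ((x, True) # w)"
  shows "cocycle v = cocycle w"
proof
  fix z
  show "cocycle v z = cocycle w z"
    using fun_cong[OF assms(2), of "gperm x z"] gperm_bij[OF assms(1)] by (simp add: bij_is_inj)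
qed

text \<open>The cocycle is injective on the positive monoid: the first letter of one word is
  extracted from the other and cancelled from both.\<close>

lemma pos_word_determined:
  assumes "set xs \<subseteq> X" "set ys \<subseteq> X" "cocycle (pos_word xs) = cocycle (pos_word ys)"
  shows "wequiv (pos_word xs) (pos_word ys)"
  using assms
proof (induction xs arbitrary: ys)
  case Nil
  have "ys = []"
  proof (rule ccontr)
    assume "ys \<noteq> []"
    then obtain y ys' where "ys = y # ys'" by (cases ys) auto
    then show False using fun_cong[OF Nil.prems(3), of y] cocycle_pos_word_nonneg[of ys' "inv_into UNIV (gperm y) y"] by simp
  qed
  then show ?case by (simp add: sg_eq.refl)
next
  case (Cons x xs)
  have x: "x \<in> X" "set xs \<subseteq> X" using Cons.prems by auto
  have "cocycle (pos_word ys) x > 0"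
    using fun_cong[OF Cons.prems(3), of x] cocycle_pos_word_nonneg[of xs "inv_into UNIV (gperm x) x"] by simp
  then obtain zs where zs: "set zs \<subseteq> X" "wequiv (pos_word ys) (pos_word (x # zs))"
    using pos_word_extract[OF Cons.prems(2) x(1)] by blast
  have "cocycle (pos_word (x # xs)) = cocycle (pos_word (x # zs))"
    using Cons.prems(3) cocycle_invariant[OF zs(2)] by (rule HOL.trans)
  then have "cocycle ((x, True) # pos_word xs) = cocycle ((x, True) # pos_word zs)"
    by (simp only: list.map)
  then have "wequiv (pos_word xs) (pos_word zs)"
    using Cons.IH[OF x(2) zs(1)] cocycle_Cons_cancel[OF x(1)] by blast
  then have "wequiv (pos_word (x # xs)) (pos_word (x # zs))"
    using sg_eq_append_left[of "{}" "pos_word xs" "pos_word zs" "[(x, True)]"] x by simp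
  then show ?case using zs(2) sg_eq.sym sg_eq.trans by blast
qed

text \<open>An Ore condition: choosing \<open>y'\<close> with \<open>f x y' = y\<close> gives the
  relation \<open>y' x = x' y\<close>, so inverse letters can be moved to the left of positive
  ones.\<close>

lemma letter_swap:
  assumes "x \<in> X" "y \<in> X"
  shows "\<exists>x'\<in>X. \<exists>y'\<in>X. wequiv [(x, True), (y, False)] [(y', False), (x', True)]"
proof -
  obtain y' where y': "y' \<in> X" "f x y' = y" using f_surj assms by blast
  let ?x' = "g y' x"
  have x': "?x' \<in> X" using g_closed y' assms by blast
  have 1: "wequiv [(y', False), (y', True), (x, True), (y, False)] [(x, True), (y, False)]"
    using sg_eq.cancel[of "[]" X "[(x, True), (y, False)]" y' "{}" g f False] assms y' by simp
  have 2: "wequiv [(y', False), (y', True), (x, True), (y, False)] [(y', False), (?x', True), (y, True), (y, False)]"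
    using sg_eq.braid[of "[(y', False)]" X "[(y, False)]" y' x "{}" g f] assms y' by simp
  have 3: "wequiv [(y', False), (?x', True), (y, True), (y, False)] [(y', False), (?x', True)]"
    using sg_eq.cancel[of "[(y', False), (?x', True)]" X "[]" y "{}" g f True] assms y' x' by simp
  show ?thesis using sg_eq.trans[OF sg_eq.sym[OF 1] sg_eq.trans[OF 2 3]] x' y' by blast
qed

lemma letter_swap_word:
  assumes "x \<in> X" "set ys \<subseteq> X"
  shows "\<exists>x'\<in>X. \<exists>ys'. set ys' \<subseteq> X \<and> wequiv ((x, True) # neg_word ys) (neg_word ys' @ [(x', True)])"
  using assms
proof (induction ys arbitrary: x)
  case Nil
  then show ?case by (intro bexI[of _ x] exI[of _ "[]"]) (auto intro!: sg_eq.refl)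
next
  case (Cons y ys)
  then obtain x' y' where xy: "x' \<in> X" "y' \<in> X" "wequiv [(x, True), (y, False)] [(y', False), (x', True)]"
    using letter_swap[of x y] by auto
  obtain x'' ys' where ys: "x'' \<in> X" "set ys' \<subseteq> X" "wequiv ((x', True) # neg_word ys) (neg_word ys' @ [(x'', True)])"
    using Cons xy by (metis insert_subset list.simps(15))
  have "wequiv ((x, True) # neg_word (y # ys)) ((y', False) # (x', True) # neg_word ys)"
    using sg_eq_append_right[OF xy(3), of "neg_word ys"] Cons.prems(2) by (simp add: fst_letter_image)
  moreover have "wequiv ((y', False) # (x', True) # neg_word ys) (neg_word (y' # ys') @ [(x'', True)])"
    using sg_eq_append_left[OF ys(3), of "[(y', False)]"] xy by simp
  ultimately show ?case using sg_eq.trans ys xy by (intro bexI[of _ x''] exI[of _ "y' # ys'"]) fastforce+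
qed

lemma ore_form:
  assumes "word_over X w"
  shows "\<exists>ys xs. set ys \<subseteq> X \<and> set xs \<subseteq> X \<and> wequiv w (neg_word ys @ pos_word xs)"
  using assms
proof (induction w)
  case Nil
  show ?case by (intro exI[of _ "[]"]) (simp add: sg_eq.refl)
next
  case (Cons l w)
  obtain x b where l: "l = (x, b)" by (cases l)
  have x: "x \<in> X" using Cons.prems l by simp
  obtain ys xs where ih: "set ys \<subseteq> X" "set xs \<subseteq> X" "wequiv w (neg_word ys @ pos_word xs)"
    using Cons by auto
  have 1: "wequiv (l # w) (l # neg_word ys @ pos_word xs)"
    using sg_eq_append_left[OF ih(3), of "[l]"] x l by simp
  show ?case
  proof (cases b)
    case True
    obtain x' ys' where s: "x' \<in> X" "set ys' \<subseteq> X" "wequiv ((x, True) # neg_word ys) (neg_word ys' @ [(x', True)])"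
      using letter_swap_word[OF x ih(1)] by blast
    have "wequiv (l # neg_word ys @ pos_word xs) (neg_word ys' @ pos_word (x' # xs))"
      using sg_eq_append_right[OF s(3), of "pos_word xs"] ih(2) l True by (simp add: fst_letter_image)
    then show ?thesis using sg_eq.trans[OF 1] s ih by (intro exI[of _ ys'] exI[of _ "x' # xs"]) auto
  next
    case False
    then show ?thesis using 1 ih x l by (intro exI[of _ "x # ys"] exI[of _ xs]) auto
  qed
qed

text \<open>Write the word as a left fraction and clear its denominator \<open>?p\<close>. Numerator
  and denominator are positive words with equal cocycles, hence equivalent.\<close>

lemma cocycle_zero_imp_trivial:
  assumes w: "word_over X w" and zero: "\<And>z. z \<in> X \<Longrightarrow> cocycle w z = 0"
  shows "wequiv w []"
proof -
  have zero': "cocycle w z = 0" for z using zero cocycle_outside[OF w] by blast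
  obtain ys xs where d: "set ys \<subseteq> X" "set xs \<subseteq> X" "wequiv w (neg_word ys @ pos_word xs)"
    using ore_form[OF w] by blast
  let ?p = "pos_word (rev ys)"
  have p: "word_over X ?p" using d(1) by (simp add: image_image)
  have 1: "wequiv (?p @ w) (?p @ neg_word ys @ pos_word xs)"
    by (rule sg_eq_append_left[OF d(3) p])
  have "wequiv (?p @ neg_word ys) []"
    using sg_eq_inv_right[OF p, of "{}"] word_inv_pos_word[of ys] by simp
  from sg_eq_append_right[OF this, of "pos_word xs"] d(2)
  have 2: "wequiv (?p @ neg_word ys @ pos_word xs) (pos_word xs)"
    by (simp add: fst_letter_image)
  have "cocycle (pos_word xs) = cocycle (?p @ w)"
    using cocycle_invariant[OF sg_eq.trans[OF 1 2]] by simp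
  also have "\<dots> = cocycle ?p" by (rule ext) (simp only: cocycle_append[OF p] zero' add_0_right)
  finally have "wequiv (pos_word xs) ?p" using d by (intro pos_word_determined) auto
  then have "wequiv (neg_word ys @ pos_word xs) (neg_word ys @ ?p)"
    using d(1) by (intro sg_eq_append_left) (simp_all add: fst_letter_image)
  moreover have "wequiv (neg_word ys @ ?p) []"
    using sg_eq_inv_left[OF p, of "{}"] word_inv_pos_word[of ys] by simp
  ultimately show ?thesis using d(3) sg_eq.trans by blast
qed

lemma cocycle_determines:
  assumes v: "word_over X v" and w: "word_over X w" and eq: "cocycle v = cocycle w"
  shows "wequiv v w"
proof -
  let ?u = "word_inv v @ w"
  have u: "word_over X ?u" using v w word_over_inv[of v X] by auto
  have vu: "wequiv (v @ ?u) w"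
    using sg_eq_append_right[OF sg_eq_inv_right[OF v, of "{}"] w] by simp
  have "cocycle ?u z = 0" for z
  proof -
    have "cocycle (v @ ?u) (wperm v z) = cocycle w (wperm v z)" using cocycle_invariant[OF vu] by simp
    then show ?thesis using cocycle_append[OF v, of ?u "wperm v z"] wperm_bij[OF v] eq by (simp add: bij_is_inj)
  qed
  then have "wequiv ?u []" using cocycle_zero_imp_trivial[OF u] by blast
  then have "wequiv (v @ ?u) v" using sg_eq_append_left[OF _ v, of "{}" ?u "[]"] by simp
  then show ?thesis using vu sg_eq.sym sg_eq.trans by blast
qed

end

section \<open>Iterated retracts\<close>

context ybe begin

section \<open>The presented group as classes of words\<close>

definition word_class :: "('a \<times> 'a) set \<Rightarrow> 'a word \<Rightarrow> 'a word set" where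
  "word_class E w = {v. sg_eq X E g f w v}"

lemma word_class_eq_iff:
  assumes "word_over X w"
  shows "word_class E v = word_class E w \<longleftrightarrow> sg_eq X E g f v w"
proof
  assume "word_class E v = word_class E w"
  moreover have "w \<in> word_class E w" using assms by (simp add: word_class_def sg_eq.refl)
  ultimately show "sg_eq X E g f v w" by (auto simp: word_class_def)
next
  assume "sg_eq X E g f v w"
  then show "word_class E v = word_class E w"
    unfolding word_class_def using sg_eq.sym sg_eq.trans by blast
qed

lemma carrier_pres_group: "carrier (pres_group X E g f) = word_class E ` {w. word_over X w}"
  by (auto simp: pres_group_def word_class_def)

lemma one_pres_group: "\<one>\<^bsub>pres_group X E g f\<^esub> = word_class E []"
  by (simp add: pres_group_def word_class_def)

lemma mult_pres_group:
  assumes "word_over X v" "word_over X w"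
  shows "word_class E v \<otimes>\<^bsub>pres_group X E g f\<^esub> word_class E w = word_class E (v @ w)"
proof -
  have "(\<exists>a\<in>word_class E v. \<exists>b\<in>word_class E w. sg_eq X E g f (a @ b) u) \<longleftrightarrow> sg_eq X E g f (v @ w) u" for u
  proof
    assume "\<exists>a\<in>word_class E v. \<exists>b\<in>word_class E w. sg_eq X E g f (a @ b) u"
    then obtain a b where "sg_eq X E g f v a" "sg_eq X E g f w b" "sg_eq X E g f (a @ b) u"
      by (auto simp: word_class_def)
    then show "sg_eq X E g f (v @ w) u" using sg_eq_append sg_eq.trans by blast
  next
    assume "sg_eq X E g f (v @ w) u"
    then show "\<exists>a\<in>word_class E v. \<exists>b\<in>word_class E w. sg_eq X E g f (a @ b) u"
      using assms by (intro bexI[of _ v] bexI[of _ w]) (auto simp: word_class_def sg_eq.refl)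
  qed
  then show ?thesis by (simp add: pres_group_def word_class_def)
qed

lemma group_pres_group: "group (pres_group X E g f)"
proof (rule groupI)
  let ?G = "pres_group X E g f"
  show "\<one>\<^bsub>?G\<^esub> \<in> carrier ?G" by (auto simp: one_pres_group carrier_pres_group)
  fix x assume "x \<in> carrier ?G"
  then obtain u where u: "word_over X u" "x = word_class E u" by (auto simp: carrier_pres_group)
  show "\<one>\<^bsub>?G\<^esub> \<otimes>\<^bsub>?G\<^esub> x = x"
    unfolding u(2) one_pres_group using mult_pres_group[of "[]" u E] u(1) by simp
  have iu: "word_over X (word_inv u)" using u(1) by (simp only: word_over_inv)
  have "word_class E (word_inv u) \<otimes>\<^bsub>?G\<^esub> x = word_class E (word_inv u @ u)"
    unfolding u(2) by (rule mult_pres_group[OF iu u(1)])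
  also have "\<dots> = \<one>\<^bsub>?G\<^esub>"
    using word_class_eq_iff[of "[]" E "word_inv u @ u"] sg_eq_inv_left[OF u(1)] by (simp add: one_pres_group)
  finally show "\<exists>y\<in>carrier ?G. y \<otimes>\<^bsub>?G\<^esub> x = \<one>\<^bsub>?G\<^esub>"
    using iu by (intro bexI[of _ "word_class E (word_inv u)"]) (auto simp: carrier_pres_group)
  fix y assume "y \<in> carrier ?G"
  then obtain v where v: "word_over X v" "y = word_class E v" by (auto simp: carrier_pres_group)
  have uv: "word_over X (u @ v)" using u v by auto
  show "x \<otimes>\<^bsub>?G\<^esub> y \<in> carrier ?G" 
    unfolding u(2) v(2) mult_pres_group[OF u(1) v(1)] carrier_pres_group using uv by blast
  fix z assume "z \<in> carrier ?G"
  then obtain w where w: "word_over X w" "z = word_class E w" by (auto simp: carrier_pres_group)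
  have vw: "word_over X (v @ w)" using v w by auto
  show "x \<otimes>\<^bsub>?G\<^esub> y \<otimes>\<^bsub>?G\<^esub> z = x \<otimes>\<^bsub>?G\<^esub> (y \<otimes>\<^bsub>?G\<^esub> z)"
    unfolding u(2) v(2) w(2) mult_pres_group[OF u(1) v(1)] mult_pres_group[OF v(1) w(1)]
      mult_pres_group[OF uv w(1)] mult_pres_group[OF u(1) vw] by simp
qed

section \<open>Quotients of a solution by a congruence\<close>

definition quot_op :: "('a \<Rightarrow> 'b) \<Rightarrow> ('a \<Rightarrow> 'a \<Rightarrow> 'a) \<Rightarrow> 'b \<Rightarrow> 'b \<Rightarrow> 'b" where
  "quot_op c h C D = c (h (inv_into X c C) (inv_into X c D))"

definition congruence :: "('a \<Rightarrow> 'b) \<Rightarrow> bool" where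
  "congruence c \<longleftrightarrow> (\<forall>x\<in>X. \<forall>x'\<in>X. \<forall>y\<in>X. \<forall>y'\<in>X. c x = c x' \<longrightarrow> c y = c y' \<longrightarrow>
     c (g x y) = c (g x' y') \<and> c (f x y) = c (f x' y'))"

lemma quot_op_class:
  assumes "congruence c" "x \<in> X" "y \<in> X"
  shows "quot_op c g (c x) (c y) = c (g x y)" "quot_op c f (c x) (c y) = c (f x y)"
proof -
  have r: "inv_into X c (c z) \<in> X" "c (inv_into X c (c z)) = c z" if "z \<in> X" for z
    using that by (auto intro: inv_into_into f_inv_into_f)
  show "quot_op c g (c x) (c y) = c (g x y)" "quot_op c f (c x) (c y) = c (f x y)"
    using assms r[OF assms(2)] r[OF assms(3)] unfolding congruence_def quot_op_def by blast+
qed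

lemma quotient_ybe:
  assumes c: "congruence c"
  shows "ybe (c ` X) (quot_op c g) (quot_op c f)"
proof -
  note q = quot_op_class[OF c]
  \<comment> \<open>Surjectivity descends to the classes; finiteness then supplies
    injectivity.\<close>
  have bij: "bij_betw (quot_op c h (c x)) (c ` X) (c ` X)"
    if "x \<in> X" "\<And>y. y \<in> X \<Longrightarrow> quot_op c h (c x) (c y) = c (h x y)" "bij_betw (h x) X X" for h x
  proof -
    have "quot_op c h (c x) ` c ` X = c ` (h x ` X)" using that(2) by (auto simp: image_image)
    also have "\<dots> = c ` X" using that(3) by (simp add: bij_betw_def)
    finally show ?thesis unfolding bij_betw_def using finite_X finite_surj_inj[of "c ` X"] by auto
  qed
  show ?thesis
  proof (unfold_locales; (elim imageE)?)
    show "finite (c ` X)" using finite_X by simp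
  next
    fix C x assume "C = c x" "x \<in> X"
    then show "bij_betw (quot_op c g C) (c ` X) (c ` X)" using bij[of x g] q g_bij by simp
  next
    fix C x assume "C = c x" "x \<in> X"
    then show "bij_betw (quot_op c f C) (c ` X) (c ` X)" using bij[of x f] q f_bij by simp
  qed (simp_all add: q g_closed f_closed inv_g inv_f gg[symmetric] ff[symmetric])
qed

section \<open>The solutions, actions and cocycles on the iterated retracts\<close>

abbreviation rrel :: "nat \<Rightarrow> 'a \<Rightarrow> 'a \<Rightarrow> bool" where
  "rrel \<equiv> ret_rel X f"

definition rclass :: "nat \<Rightarrow> 'a \<Rightarrow> 'a set" where
  "rclass m x = {y \<in> X. rrel m x y}"

abbreviation rg :: "nat \<Rightarrow> 'a set \<Rightarrow> 'a set \<Rightarrow> 'a set" where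
  "rg m \<equiv> quot_op (rclass m) g"

abbreviation rf :: "nat \<Rightarrow> 'a set \<Rightarrow> 'a set \<Rightarrow> 'a set" where
  "rf m \<equiv> quot_op (rclass m) f"

lemma ret_rel_refl: "rrel m x x"
  by (induction m arbitrary: x) auto

lemma ret_rel_sym: "rrel m x y \<Longrightarrow> rrel m y x"
  by (induction m arbitrary: x y) auto

lemma ret_rel_trans: "rrel m x y \<Longrightarrow> rrel m y z \<Longrightarrow> rrel m x z"
proof (induction m arbitrary: x y z)
  case (Suc m)
  then show ?case unfolding ret_rel.simps by blast
qed simp

lemma rclass_eq_iff:
  assumes "y \<in> X" shows "rclass m x = rclass m y \<longleftrightarrow> rrel m x y"
proof
  assume "rclass m x = rclass m y"
  moreover have "y \<in> rclass m y" using assms by (simp add: rclass_def ret_rel_refl)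
  ultimately show "rrel m x y" by (auto simp: rclass_def)
next
  assume "rrel m x y"
  then show "rclass m x = rclass m y"
    unfolding rclass_def using ret_rel_sym ret_rel_trans by blast
qed

lemma ret_rel_mono:
  "x \<in> X \<Longrightarrow> y \<in> X \<Longrightarrow> rrel m x y \<Longrightarrow> rrel (Suc m) x y"
proof (induction m arbitrary: x y)
  case 0
  then show ?case by simp
next
  case (Suc m)
  then have "\<forall>z\<in>X. rrel (Suc m) (f x z) (f y z)" using f_closed by fastforce
  then show ?case by simp
qed

text \<open>At level \<open>Suc m\<close> the relation says that two classes of the solution
  \<open>Q\<close> at level \<open>m\<close> induce the same \<open>f\<close>-maps, so the one-step
  results apply to \<open>Q\<close>. Replacing the first argument gives relation already at level
  \<open>m\<close>; replacing the second needs \<open>retract_cong\<close>.\<close>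

lemma congruence_rclass: "congruence (rclass m)"
proof (induction m)
  case 0
  show ?case unfolding congruence_def by (auto simp: rclass_eq_iff g_closed f_closed)
next
  case (Suc m)
  interpret Q: ybe "rclass m ` X" "rg m" "rf m"
    by (rule quotient_ybe[OF Suc])
  note q = quot_op_class[OF Suc]
  have rel: "rrel (Suc m) x x' \<longleftrightarrow>
      (\<forall>C\<in>rclass m ` X. rf m (rclass m x) C = rf m (rclass m x') C)"
    if "x \<in> X" "x' \<in> X" for x x'
    using that by (simp add: q rclass_eq_iff f_closed)
  show ?case
    unfolding congruence_def
  proof (intro ballI impI)
    fix x x' y y' assume x: "x \<in> X" "x' \<in> X" and y: "y \<in> X" "y' \<in> X"
      and xx: "rclass (Suc m) x = rclass (Suc m) x'" and yy: "rclass (Suc m) y = rclass (Suc m) y'"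
    have xx': "rrel (Suc m) x x'" using xx rclass_eq_iff[OF x(2)] by blast
    have yy': "rrel (Suc m) y y'" using yy rclass_eq_iff[OF y(2)] by blast
    have geq: "rclass m (g x y) = rclass m (g x' y)"
      using Q.f_eq_iff_g_eq[of "rclass m x" "rclass m x'"] rel[OF x] xx' x y by (simp add: q)
    have 1: "rrel (Suc m) (g x y) (g x' y)"
      using geq rclass_eq_iff[of "g x' y" m "g x y"] g_closed x y by (intro ret_rel_mono) auto
    have 2: "rrel (Suc m) (f x y) (f x' y)"
      using xx' f_closed x y by (intro ret_rel_mono) auto
    have yQ: "\<forall>C\<in>rclass m ` X. rf m (rclass m y) C = rf m (rclass m y') C"
      using rel[OF y] yy' by blast
    note rc = Q.retract_cong[OF imageI[OF y(1)] imageI[OF y(2)] imageI[OF x(2)] _ yQ]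
    have 3: "rrel (Suc m) (f x' y) (f x' y')"
      unfolding rel[OF f_closed[OF x(2) y(1)] f_closed[OF x(2) y(2)]] using rc(1) x y by (simp add: q)
    have 4: "rrel (Suc m) (g x' y) (g x' y')"
      unfolding rel[OF g_closed[OF x(2) y(1)] g_closed[OF x(2) y(2)]] using rc(2) x y by (simp add: q)
    have "rrel (Suc m) (g x y) (g x' y')" "rrel (Suc m) (f x y) (f x' y')"
      using ret_rel_trans 1 2 3 4 by blast+
    then show "rclass (Suc m) (g x y) = rclass (Suc m) (g x' y') \<and>
        rclass (Suc m) (f x y) = rclass (Suc m) (f x' y')"
      using rclass_eq_iff g_closed f_closed x y by blast
  qed
qed

lemma ret_ybe: "ybe (rclass m ` X) (rg m) (rf m)"
  by (rule quotient_ybe[OF congruence_rclass])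

lemmas rop_class = quot_op_class[OF congruence_rclass]

lemma rclass_g_eq:
  assumes "x \<in> X" "x' \<in> X" "z \<in> X" "rclass (Suc m) x = rclass (Suc m) x'"
  shows "rclass m (g x z) = rclass m (g x' z)"
proof -
  interpret Q: ybe "rclass m ` X" "rg m" "rf m"
    by (rule ret_ybe)
  have "\<forall>C\<in>rclass m ` X. rf m (rclass m x) C = rf m (rclass m x') C"
    using assms rclass_eq_iff[of x' "Suc m" x] by (simp add: rop_class rclass_eq_iff f_closed)
  then have "\<forall>C\<in>rclass m ` X. rg m (rclass m x) C = rg m (rclass m x') C"
    using Q.f_eq_iff_g_eq assms by blast
  then show ?thesis using assms by (simp add: rop_class)
qed

definition rperm :: "nat \<Rightarrow> 'a word \<Rightarrow> 'a set \<Rightarrow> 'a set" where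
  "rperm m w = ybe.wperm (rclass m ` X) (rg m) (map_word (rclass m) w)"

definition rcocycle :: "nat \<Rightarrow> 'a word \<Rightarrow> 'a set \<Rightarrow> int" where
  "rcocycle m w = ybe.cocycle (rclass m ` X) (rg m) (map_word (rclass m) w)"

lemma word_over_ret: "word_over X w \<Longrightarrow> word_over (rclass m ` X) (map_word (rclass m) w)"
  unfolding word_over_map_word by blast

lemma rperm_append: "rperm m (u @ v) = rperm m u \<circ> rperm m v"
  unfolding rperm_def map_word_simps by (rule ybe.wperm_append[OF ret_ybe])

lemma rperm_permutes: "word_over X w \<Longrightarrow> rperm m w permutes rclass m ` X"
  unfolding rperm_def by (rule ybe.wperm_permutes[OF ret_ybe word_over_ret])

lemma rperm_bij: "word_over X w \<Longrightarrow> bij (rperm m w)"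
  using rperm_permutes permutes_bij by blast

lemma rcocycle_append:
  "word_over X u \<Longrightarrow> rcocycle m (u @ v) C = rcocycle m u C + rcocycle m v (inv_into UNIV (rperm m u) C)"
  unfolding rcocycle_def rperm_def map_word_simps
  by (rule ybe.cocycle_append[OF ret_ybe word_over_ret])

lemma sg_eq_ret:
  assumes "sg_eq X E g f v w" "\<And>x y. (x, y) \<in> E \<Longrightarrow> rrel m x y"
  shows "sg_eq (rclass m ` X) {} (rg m) (rf m)
    (map_word (rclass m) v) (map_word (rclass m) w)"
  by (rule sg_eq_map[OF assms(1)]) (use assms(2) in \<open>auto simp: rop_class rclass_eq_iff\<close>)

lemma rcocycle_invariant:
  assumes "sg_eq X E g f v w" "\<And>x y. (x, y) \<in> E \<Longrightarrow> rrel m x y"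
  shows "rcocycle m v = rcocycle m w"
  unfolding rcocycle_def by (rule ybe.cocycle_invariant[OF ret_ybe sg_eq_ret[OF assms]])

lemma rperm_invariant:
  assumes "wequiv v w" shows "rperm m v = rperm m w"
  unfolding rperm_def by (rule ybe.wperm_invariant[OF ret_ybe sg_eq_ret[OF assms]]) simp

lemma rperm_class:
  assumes "word_over X w" "x \<in> X"
  shows "rperm m w (rclass m x) = rclass m (wperm w x)"
  using assms
proof (induction w arbitrary: x)
  case Nil
  show ?case by (simp add: rperm_def wperm_def ybe.wperm_def[OF ret_ybe])
next
  case (Cons l w)
  interpret Q: ybe "rclass m ` X" "rg m" "rf m"
    by (rule ret_ybe)
  obtain y b where l: "l = (y, b)" by (cases l)
  have y: "y \<in> X" and w: "word_over X w" using Cons.prems l by auto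
  have x': "wperm w x \<in> X" using wperm_permutes[OF w] Cons.prems(2) by (simp add: permutes_in_image)
  have gp: "Q.gperm (rclass m y) (rclass m z) = rclass m (gperm y z)" if "z \<in> X" for z
    using that y by (simp add: Q.gperm_def gperm_def rop_class)
  have ih: "Q.wperm (map_word (rclass m) w) (rclass m x) = rclass m (wperm w x)"
    using Cons.IH[OF w Cons.prems(2)] by (simp add: rperm_def)
  show ?case
  proof (cases b)
    case True
    then show ?thesis using ih gp[OF x'] l by (simp add: rperm_def Q.wperm_def wperm_def)
  next
    case False
    define z where "z = inv_into UNIV (gperm y) (wperm w x)"
    have "z \<in> X" using permutes_in_image[OF permutes_inv[OF gperm_permutes[OF y]]] x' by (simp add: z_def)
    moreover have "gperm y z = wperm w x" using gperm_inv_eq[OF y, of "wperm w x" z] z_def by simp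
    ultimately have "inv_into UNIV (Q.gperm (rclass m y)) (rclass m (wperm w x)) = rclass m z"
      using gp[of z] Q.gperm_inv_eq[of "rclass m y"] y by simp
    then show ?thesis using ih l False by (simp add: rperm_def Q.wperm_def wperm_def z_def)
  qed
qed

lemma rcocycle_letter: "x \<in> X \<Longrightarrow> rcocycle m [(x, True)] C = of_bool (C = rclass m x)"
  by (simp add: rcocycle_def ybe.cocycle.simps[OF ret_ybe])

lemma rcocycle_zero_trivial:
  assumes "word_over X w" "\<And>C. C \<in> rclass m ` X \<Longrightarrow> rcocycle m w C = 0"
  shows "sg_eq (rclass m ` X) {} (rg m) (rf m) (map_word (rclass m) w) []"
  using assms(2) unfolding rcocycle_def
  by (rule ybe.cocycle_zero_imp_trivial[OF ret_ybe word_over_ret[OF assms(1)]])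

lemma rcocycle_zero_perm:
  assumes "word_over X w" "\<And>C. C \<in> rclass m ` X \<Longrightarrow> rcocycle m w C = 0"
  shows "rperm m w = id"
  using ybe.wperm_invariant[OF ret_ybe rcocycle_zero_trivial[OF assms]]
  by (simp add: rperm_def ybe.wperm_def[OF ret_ybe])

lemma rcocycle_zero_base:
  assumes "word_over X w" "\<And>C. C \<in> rclass 0 ` X \<Longrightarrow> rcocycle 0 w C = 0"
  shows "wequiv w []"
proof -
  have cl: "the_elem (rclass 0 x) = x" if "x \<in> X" for x
  proof -
    have "rclass 0 x = {x}" using that by (auto simp: rclass_def)
    then show ?thesis by simp
  qed
  have "map_word the_elem (map_word (rclass 0) w) = w"
    using assms(1) by (induction w) (auto simp: cl)
  moreover have "wequiv (map_word the_elem (map_word (rclass 0) w)) (map_word the_elem [])"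
    by (rule sg_eq_map[OF rcocycle_zero_trivial[OF assms]])
       (auto simp: rop_class cl g_closed f_closed)
  ultimately show ?thesis by simp
qed

text \<open>A generator acts on the \<open>m\<close>-th retract through its class in the \<open>(m + 1)\<close>-st retract, so the
  action on the \<open>m\<close>-th retract factors through the structure group of the \<open>(m + 1)\<close>-st.\<close>

lemma rcocycle_zero_perm_Suc:
  assumes w: "word_over X w" and zero: "\<And>C. C \<in> rclass (Suc m) ` X \<Longrightarrow> rcocycle (Suc m) w C = 0"
  shows "rperm m w = id"
proof -
  interpret Q: ybe "rclass m ` X" "rg m" "rf m"
    by (rule ret_ybe)
  define h where "h C = Q.gperm (rclass m (inv_into X (rclass (Suc m)) C))" for C
  have h: "h (rclass (Suc m) x) = Q.gperm (rclass m x)" if x: "x \<in> X" for x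
  proof -
    let ?x = "inv_into X (rclass (Suc m)) (rclass (Suc m) x)"
    have "?x \<in> X" "rclass (Suc m) ?x = rclass (Suc m) x"
      using x by (simp_all add: inv_into_into f_inv_into_f)
    then have "Q.gperm (rclass m ?x) = Q.gperm (rclass m x)"
      using x rclass_g_eq[of ?x x _ m] by (intro ext) (auto simp: Q.gperm_def rop_class)
    then show ?thesis by (simp add: h_def)
  qed
  have "word_act (\<lambda>x. Q.gperm (rclass m x)) w = word_act h (map_word (rclass (Suc m)) w)"
    by (rule word_act_cong[OF _ w]) (simp add: h)
  also have "\<dots> = word_act h []"
  proof (rule word_act_invariant[OF rcocycle_zero_trivial[OF w zero]])
    fix C assume "C \<in> rclass (Suc m) ` X"
    then show "bij (h C)" using h Q.gperm_bij by auto
  next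
    fix C D assume "C \<in> rclass (Suc m) ` X" "D \<in> rclass (Suc m) ` X"
    then obtain x y where xy: "x \<in> X" "y \<in> X" "C = rclass (Suc m) x" "D = rclass (Suc m) y" by blast
    have "Q.gperm (rclass m x) \<circ> Q.gperm (rclass m y) =
        Q.gperm (rclass m (g x y)) \<circ> Q.gperm (rclass m (f y x))"
      using Q.gperm_rel[of "rclass m x" "rclass m y"] xy by (simp only: imageI rop_class)
    then show "h C \<circ> h D = h (rg (Suc m) C D) \<circ> h (rf (Suc m) D C)"
      using xy by (simp only: rop_class h g_closed f_closed)
  qed simp_all
  finally have "word_act (\<lambda>x. Q.gperm (rclass m x)) w = id" by simp
  moreover have "word_act (\<lambda>x. Q.gperm (rclass m x)) w = rperm m w"
    unfolding rperm_def Q.wperm_def by (rule word_act_cong[OF _ w]) simp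
  ultimately show ?thesis by simp
qed

text \<open>A zero cocycle makes the word trivial in the group of the m-th retract, and the
  projection of classes carries triviality to the next retract.\<close>

lemma rcocycle_zero_Suc:
  assumes w: "word_over X w" and zero: "\<And>C. C \<in> rclass m ` X \<Longrightarrow> rcocycle m w C = 0"
  shows "rcocycle (Suc m) w C = 0"
proof -
  interpret Q: ybe "rclass (Suc m) ` X" "rg (Suc m)" "rf (Suc m)"
    by (rule ret_ybe)
  define c where "c C = rclass (Suc m) (inv_into X (rclass m) C)" for C
  have c: "c (rclass m x) = rclass (Suc m) x" if x: "x \<in> X" for x
  proof -
    let ?x = "inv_into X (rclass m) (rclass m x)"
    have "?x \<in> X" "rclass m ?x = rclass m x"
      using x by (simp_all add: inv_into_into f_inv_into_f)
    then have "rrel (Suc m) ?x x" using x rclass_eq_iff ret_rel_mono by blast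
    then show ?thesis using x rclass_eq_iff by (simp add: c_def)
  qed
  have "sg_eq (rclass (Suc m) ` X) {} (rg (Suc m)) (rf (Suc m))
      (map_word c (map_word (rclass m) w)) (map_word c [])"
    by (rule sg_eq_map[OF rcocycle_zero_trivial[OF w zero]])
       (auto simp: rop_class c g_closed f_closed)
  moreover have "map_word c (map_word (rclass m) w) = map_word (rclass (Suc m)) w"
    using w by (induction w) (auto simp: c)
  ultimately have "rcocycle (Suc m) w = Q.cocycle []"
    using Q.cocycle_invariant unfolding rcocycle_def by fastforce
  then show ?thesis by simp
qed

text \<open>One word serves all levels, since a diagonal point stays diagonal in every retract. Its
  cocycle therefore vanishes exactly from the level on at which \<open>x\<close> and
  \<open>y\<close> merge.\<close>

lemma rcocycle_difference:
  assumes "x \<in> X" "y \<in> X"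
  shows "\<exists>w. word_over X w \<and> (\<forall>m C. rcocycle m w C = of_bool (C = rclass m x) - of_bool (C = rclass m y))"
proof -
  obtain y' where y': "y' \<in> X" "g x y' = y" using g_surj assms by blast
  obtain z where z: "z \<in> X" "g z y' = z" using diagonal_exists y' by blast
  have "rcocycle m [(x, True), (z, False)] C = of_bool (C = rclass m x) - of_bool (C = rclass m y)" for m C
  proof -
    have "rg m (rclass m z) (rclass m y') = rclass m z"
      "rg m (rclass m x) (rclass m y') = rclass m y"
      using y' z assms by (simp_all add: rop_class)
    then show ?thesis
      using ybe.cocycle_difference[OF ret_ybe, of "rclass m x" m "rclass m y'" "rclass m z" C] y' z assms
      by (simp add: rcocycle_def)
  qed
  then show ?thesis using assms z by (intro exI[of _ "[(x, True), (z, False)]"]) simp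
qed

end

section \<open>The space of left orders\<close>

lemma left_orderD:
  assumes "left_order G R"
  shows "R \<subseteq> carrier G \<times> carrier G" "x \<in> carrier G \<Longrightarrow> (x, x) \<notin> R"
    "(x, y) \<in> R \<Longrightarrow> (y, z) \<in> R \<Longrightarrow> (x, z) \<in> R"
    "x \<in> carrier G \<Longrightarrow> y \<in> carrier G \<Longrightarrow> x \<noteq> y \<Longrightarrow> (x, y) \<in> R \<or> (y, x) \<in> R"
    "a \<in> carrier G \<Longrightarrow> (x, y) \<in> R \<Longrightarrow> (a \<otimes>\<^bsub>G\<^esub> x, a \<otimes>\<^bsub>G\<^esub> y) \<in> R"
  using assms[unfolded left_order_def, THEN conjunct1]
    assms[unfolded left_order_def, THEN conjunct2, THEN conjunct1]
    assms[unfolded left_order_def, THEN conjunct2, THEN conjunct2, THEN conjunct1, rule_format, of x y z]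
    assms[unfolded left_order_def, THEN conjunct2, THEN conjunct2, THEN conjunct2, THEN conjunct1]
    assms[unfolded left_order_def, THEN conjunct2, THEN conjunct2, THEN conjunct2, THEN conjunct2]
  by simp_all

section \<open>Left orders as positive cones, and closedness of their space\<close>

context group begin

definition order_of_cone :: "'a set \<Rightarrow> ('a \<times> 'a) set" where
  "order_of_cone P = {(x, y). x \<in> carrier G \<and> y \<in> carrier G \<and> lt P x y}"

lemma carrier_subgroup: "subgroup (carrier G) G"
  by (rule subgroupI) auto

lemma left_order_of_cone:
  assumes P: "pos_cone (carrier G) P"
  shows "left_order G (order_of_cone P)"
  unfolding left_order_def
proof (intro conjI ballI allI impI)
  show "order_of_cone P \<subseteq> carrier G \<times> carrier G" by (auto simp: order_of_cone_def)
  show "(x, x) \<notin> order_of_cone P" if "x \<in> carrier G" for x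
    using lt_irrefl[OF P that] by (simp add: order_of_cone_def)
  show "(x, z) \<in> order_of_cone P" if "(x, y) \<in> order_of_cone P" "(y, z) \<in> order_of_cone P" for x y z
    using that lt_trans[OF P, of x y z] by (simp add: order_of_cone_def)
  show "(x, y) \<in> order_of_cone P \<or> (y, x) \<in> order_of_cone P"
    if "x \<in> carrier G" "y \<in> carrier G" "x \<noteq> y" for x y
    using lt_total[OF P carrier_subgroup that(1,2) _ that(3)] that by (auto simp: order_of_cone_def)
  show "(a \<otimes> x, a \<otimes> y) \<in> order_of_cone P" if "a \<in> carrier G" "(x, y) \<in> order_of_cone P" for a x y
    using that lt_left[of x y a P] by (simp add: order_of_cone_def)
qed

lemma cone_of_left_order:
  assumes "left_order G R"
  shows "\<exists>P. pos_cone (carrier G) P \<and> R = order_of_cone P"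
proof -
  note sub = left_orderD(1)[OF assms] and irr = left_orderD(2)[OF assms] and tr = left_orderD(3)[OF assms]
    and tot = left_orderD(4)[OF assms] and left = left_orderD(5)[OF assms]
  define P where "P = {a \<in> carrier G. (\<one>, a) \<in> R}"
  have "pos_cone (carrier G) P"
    unfolding pos_cone_def
  proof (intro conjI ballI impI)
    show "P \<subseteq> carrier G" "\<one> \<notin> P" using irr by (auto simp: P_def)
    show "a \<otimes> b \<in> P" if "a \<in> P" "b \<in> P" for a b
      using that left[of a \<one> b] tr[of \<one> a "a \<otimes> b"] by (simp add: P_def)
    show "a \<in> P \<or> inv a \<in> P" if "a \<in> carrier G" "a \<noteq> \<one>" for a
      using that tot[of \<one> a] left[of "inv a" a \<one>] by (auto simp: P_def)
  qed
  moreover have "R = order_of_cone P"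
  proof (intro equalityI subsetI)
    fix p assume p: "p \<in> R"
    obtain x y where xy: "p = (x, y)" by (cases p)
    have "x \<in> carrier G" "y \<in> carrier G" using p sub xy by auto
    moreover have "(inv x \<otimes> x, inv x \<otimes> y) \<in> R" using p xy calculation by (intro left) auto
    ultimately show "p \<in> order_of_cone P" using xy by (simp add: order_of_cone_def lt_def P_def)
  next
    fix p assume p: "p \<in> order_of_cone P"
    obtain x y where xy: "p = (x, y)" by (cases p)
    have c: "x \<in> carrier G" "y \<in> carrier G" and "(\<one>, inv x \<otimes> y) \<in> R"
      using p xy by (auto simp: order_of_cone_def lt_def P_def)
    then have "(x \<otimes> \<one>, x \<otimes> (inv x \<otimes> y)) \<in> R" by (intro left)
    then show "p \<in> R" using c xy by (simp add: mult_inv_cancel)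
  qed
  ultimately show ?thesis by blast
qed

lemma order_of_cone_one: "(\<one>, a) \<in> order_of_cone P \<longleftrightarrow> a \<in> carrier G \<and> a \<in> P"
  by (auto simp: order_of_cone_def lt_def)

lemma order_of_cone_inj:
  assumes "pos_cone (carrier G) P" "pos_cone (carrier G) Q" "order_of_cone P = order_of_cone Q"
  shows "P = Q"
proof -
  have "P = {a. (\<one>, a) \<in> order_of_cone P}" "Q = {a. (\<one>, a) \<in> order_of_cone Q}"
    using pos_coneD(1)[OF assms(1)] pos_coneD(1)[OF assms(2)] by (auto simp: order_of_cone_one)
  then show ?thesis using assms(3) by simp
qed

text \<open>A violated order axiom is witnessed by at most three pairs, and the cylinder fixing the
  values at these pairs contains no left order.\<close>

lemma closedin_left_orders:
  "closedin (product_topology (\<lambda>_. discrete_topology UNIV) (carrier G \<times> carrier G))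
    (lo_indicator G ` {R. left_order G R})"
proof -
  let ?I = "carrier G \<times> carrier G"
  let ?T = "product_topology (\<lambda>_. discrete_topology (UNIV :: bool set)) ?I"
  let ?S = "lo_indicator G ` {R. left_order G R}"
  have "openin ?T (topspace ?T - ?S)"
  proof (subst openin_subopen, intro ballI)
    fix s assume s: "s \<in> topspace ?T - ?S"
    define R where "R = {p \<in> ?I. s p}"
    have "lo_indicator G R = s"
      using s by (auto simp: lo_indicator_def R_def PiE_def extensional_def restrict_def fun_eq_iff)
    then have notR: "\<not> left_order G R" using s by blast
    have "\<exists>K. finite K \<and> K \<subseteq> ?I \<and> (\<forall>R'. left_order G R' \<longrightarrow> \<not> (\<forall>p\<in>K. (p \<in> R') = s p))"
    proof -
      have RI: "R \<subseteq> ?I" by (auto simp: R_def)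
      have "(\<exists>x\<in>carrier G. (x, x) \<in> R) \<or> (\<exists>x y z. (x, y) \<in> R \<and> (y, z) \<in> R \<and> (x, z) \<notin> R) \<or>
          (\<exists>x\<in>carrier G. \<exists>y\<in>carrier G. x \<noteq> y \<and> (x, y) \<notin> R \<and> (y, x) \<notin> R) \<or>
          (\<exists>a\<in>carrier G. \<exists>x y. (x, y) \<in> R \<and> (a \<otimes> x, a \<otimes> y) \<notin> R)"
      proof (rule ccontr)
        assume no: "\<not> ?thesis"
        have "left_order G R" unfolding left_order_def
        proof (intro conjI)
          show "R \<subseteq> carrier G \<times> carrier G" by (rule RI)
          show "\<forall>x\<in>carrier G. (x, x) \<notin> R"
            using no[unfolded de_Morgan_disj, THEN conjunct1] by blast
          show "\<forall>x y z. (x, y) \<in> R \<longrightarrow> (y, z) \<in> R \<longrightarrow> (x, z) \<in> R"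
            using no[unfolded de_Morgan_disj, THEN conjunct2, THEN conjunct1] by blast
          show "\<forall>x\<in>carrier G. \<forall>y\<in>carrier G. x \<noteq> y \<longrightarrow> (x, y) \<in> R \<or> (y, x) \<in> R"
            using no[unfolded de_Morgan_disj, THEN conjunct2, THEN conjunct2, THEN conjunct1] by blast
          show "\<forall>a\<in>carrier G. \<forall>x y. (x, y) \<in> R \<longrightarrow> (a \<otimes> x, a \<otimes> y) \<in> R"
            using no[unfolded de_Morgan_disj, THEN conjunct2, THEN conjunct2, THEN conjunct2] by blast
        qed
        then show False using notR by blast
      qed
      then show ?thesis
      proof (elim disjE bexE exE conjE)
        fix x assume irr: "x \<in> carrier G" "(x, x) \<in> R"
        then show ?thesis by (intro exI[of _ "{(x, x)}"]) (auto simp: R_def dest: left_orderD(2))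
      next
        fix x y z assume tr: "(x, y) \<in> R" "(y, z) \<in> R" "(x, z) \<notin> R"
        have "\<not> (\<forall>p\<in>{(x, y), (y, z), (x, z)}. (p \<in> R') = s p)" if "left_order G R'" for R'
        proof
          assume "\<forall>p\<in>{(x, y), (y, z), (x, z)}. (p \<in> R') = s p"
          then have "(x, y) \<in> R'" "(y, z) \<in> R'" "(x, z) \<notin> R'" using tr by (auto simp: R_def)
          then show False using left_orderD(3)[OF that] by blast
        qed
        then show ?thesis using tr RI by (intro exI[of _ "{(x, y), (y, z), (x, z)}"]) auto
      next
        fix x y assume tot: "x \<in> carrier G" "y \<in> carrier G" "x \<noteq> y" "(x, y) \<notin> R" "(y, x) \<notin> R"
        have "\<not> (\<forall>p\<in>{(x, y), (y, x)}. (p \<in> R') = s p)" if "left_order G R'" for R'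
        proof
          assume "\<forall>p\<in>{(x, y), (y, x)}. (p \<in> R') = s p"
          then have "(x, y) \<notin> R'" "(y, x) \<notin> R'" using tot by (auto simp: R_def)
          then show False using left_orderD(4)[OF that] tot by blast
        qed
        then show ?thesis using tot by (intro exI[of _ "{(x, y), (y, x)}"]) auto
      next
        fix a x y assume left: "a \<in> carrier G" "(x, y) \<in> R" "(a \<otimes> x, a \<otimes> y) \<notin> R"
        have "\<not> (\<forall>p\<in>{(x, y), (a \<otimes> x, a \<otimes> y)}. (p \<in> R') = s p)" if "left_order G R'" for R'
        proof
          assume "\<forall>p\<in>{(x, y), (a \<otimes> x, a \<otimes> y)}. (p \<in> R') = s p"
          then have "(x, y) \<in> R'" "(a \<otimes> x, a \<otimes> y) \<notin> R'" using left by (auto simp: R_def)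
          then show False using left_orderD(5)[OF that] left by blast
        qed
        then show ?thesis using left RI by (intro exI[of _ "{(x, y), (a \<otimes> x, a \<otimes> y)}"]) auto
      qed
    qed
    then obtain K where K: "finite K" "K \<subseteq> ?I"
      and sep: "\<And>R'. left_order G R' \<Longrightarrow> \<not> (\<forall>p\<in>K. (p \<in> R') = s p)" by blast
    let ?V = "{t \<in> topspace ?T. \<forall>p\<in>K. t p = s p}"
    have "?V \<subseteq> topspace ?T - ?S"
    proof
      fix t assume t: "t \<in> ?V"
      have "t \<notin> ?S"
      proof
        assume "t \<in> ?S"
        then obtain R' where R': "left_order G R'" "t = lo_indicator G R'" by blast
        have "(p \<in> R') = s p" if "p \<in> K" for p
        proof -
          have "t p = s p" using t that by blast
          then show ?thesis using R'(2) K(2) that by (auto simp: lo_indicator_def)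
        qed
        then show False using sep[OF R'(1)] by blast
      qed
      then show "t \<in> topspace ?T - ?S" using t by blast
    qed
    moreover have "s \<in> ?V" using s by blast
    ultimately show "\<exists>V. openin ?T V \<and> s \<in> V \<and> V \<subseteq> topspace ?T - ?S"
      using openin_cylinder[OF K] by blast
  qed
  moreover have "?S \<subseteq> topspace ?T" by (auto simp: lo_indicator_def)
  ultimately show ?thesis by (simp add: closedin_def)
qed

end

section \<open>Recurrence, the Conrad property and perfectness of the space of orders\<close>

context virt_abelian begin

lemma left_order_recurrent:
  assumes "left_order G R" shows "recurrent G R"
proof -
  obtain P where P: "pos_cone (carrier G) P" and R: "R = order_of_cone P"
    using cone_of_left_order[OF assms] by blast
  obtain N :: nat where N: "N > 0" "\<And>a. a \<in> carrier G \<Longrightarrow> lam (a [^] N) = id"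
    using exponent_exists by blast
  show ?thesis unfolding recurrent_def
  proof (intro ballI allI impI)
    fix a hs assume a: "a \<in> carrier G" and hs: "set hs \<subseteq> carrier G" "sorted_wrt (\<lambda>x y. (x, y) \<in> R) hs"
    \<comment> \<open>The recurrence sequence is the multiples of \<open>N\<close>, where the powers
      of \<open>a\<close> lie in the abelian kernel.\<close>
    have step: "(x \<otimes> a [^] (N * i), y \<otimes> a [^] (N * i)) \<in> R" if "(x, y) \<in> R" for x y and i :: nat
    proof -
      have "lam (a [^] (N * i)) = id" using a N(2) by (simp add: nat_pow_pow[symmetric] lam_pow_id)
      then show ?thesis using that a lt_right[OF P carrier_subgroup, of x y "a [^] (N * i)"]
        by (simp add: R order_of_cone_def)
    qed
    have "filterlim (\<lambda>i. N * i) at_top sequentially"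
      using N(1) by (intro filterlim_subseq) (simp add: strict_mono_def)
    moreover have "sorted_wrt (\<lambda>x y. (x, y) \<in> R) (map (\<lambda>h. h \<otimes> a [^] (N * i)) hs)" for i
      unfolding sorted_wrt_map by (rule sorted_wrt_mono_rel[OF _ hs(2)]) (rule step)
    ultimately show "\<exists>n::nat \<Rightarrow> nat. filterlim n at_top sequentially \<and>
        (\<forall>i. sorted_wrt (\<lambda>x y. (x, y) \<in> R) (map (\<lambda>h. h \<otimes> a [^] n i) hs))" by blast
  qed
qed

lemma left_order_conradian:
  assumes "left_order G R" shows "conradian G R"
proof -
  obtain P where P: "pos_cone (carrier G) P" and R: "R = order_of_cone P"
    using cone_of_left_order[OF assms] by blast
  show ?thesis unfolding conradian_def
  proof (intro allI impI)
    fix a b assume "(\<one>, a) \<in> R" "(\<one>, b) \<in> R"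
    then have ab: "a \<in> P" "b \<in> P" "a \<in> carrier G" "b \<in> carrier G" by (auto simp: R order_of_cone_one)
    obtain n :: nat where "n \<ge> 1" "lt P b (a \<otimes> b [^] n)"
      using conradian_cone[OF P carrier_subgroup ab(1,2)] by blast
    then show "\<exists>n::nat. n \<ge> 1 \<and> (b, a \<otimes> b [^] n) \<in> R" using ab by (auto simp: R order_of_cone_def)
  qed
qed

lemma infinite_left_orders:
  assumes "infinite {P. pos_cone (carrier G) P}"
  shows "infinite {R. left_order G R}"
proof
  assume fin: "finite {R. left_order G R}"
  have "inj_on order_of_cone {P. pos_cone (carrier G) P}"
    by (rule inj_onI) (use order_of_cone_inj in auto)
  moreover have "order_of_cone ` {P. pos_cone (carrier G) P} \<subseteq> {R. left_order G R}"
    using left_order_of_cone by blast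
  ultimately show False using assms inj_on_finite[OF _ _ fin] by blast
qed

lemma LO_space_cantor:
  assumes pz: "poly_Z k (carrier G)" and inf: "infinite {P. pos_cone (carrier G) P}"
    and count: "countable (carrier G)"
  shows "LO_space G homeomorphic_space subtopology euclideanreal cantor_set"
  unfolding LO_space_def
proof (rule perfect_closed_homeomorphic_cantor)
  show "countable (carrier G \<times> carrier G)" using count by simp
  have "infinite (carrier G)"
  proof
    assume "finite (carrier G)"
    then have "finite (Pow (carrier G))" by simp
    then have "finite {P. pos_cone (carrier G) P}"
      by (rule finite_subset[rotated]) (use pos_coneD(1) in auto)
    then show False using inf by simp
  qed
  then show "infinite (carrier G \<times> carrier G)"
    using finite_cartesian_productD1[of "carrier G" "carrier G"] by auto
  show "closedin (product_topology (\<lambda>_. discrete_topology UNIV) (carrier G \<times> carrier G))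
    (lo_indicator G ` {R. left_order G R})" by (rule closedin_left_orders)
  show "lo_indicator G ` {R. left_order G R} \<noteq> {}"
    using infinite_left_orders[OF inf] by (metis finite.emptyI image_is_empty)
  fix s F assume s: "s \<in> lo_indicator G ` {R. left_order G R}" and F: "finite F" "F \<subseteq> carrier G \<times> carrier G"
  obtain R where R: "left_order G R" "s = lo_indicator G R" using s by blast
  obtain P where P: "pos_cone (carrier G) P" and RP: "R = order_of_cone P"
    using cone_of_left_order[OF R(1)] by blast
  \<comment> \<open>Each prescribed comparison becomes a positive element; both quotients are
    offered and \<open>P\<close> keeps the one that is positive.\<close>
  define F' where "F' = ((\<lambda>(x, y). inv x \<otimes> y) ` F \<union> (\<lambda>(x, y). inv y \<otimes> x) ` F) \<inter> P"
  have "\<not> isolated_cone (carrier G) P" using isolated_cone_rigid[OF pz] inf by blast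
  then obtain Q where Q: "pos_cone (carrier G) Q" "F' \<subseteq> Q" "Q \<noteq> P"
    unfolding isolated_cone_def using P F(1) by (metis F'_def Int_lower2 finite_Int finite_UnI finite_imageI)
  have agree: "lt Q x y \<longleftrightarrow> lt P x y" if "(x, y) \<in> F" for x y
  proof
    have c: "x \<in> carrier G" "y \<in> carrier G" using that F(2) by auto
    show "lt Q x y" if "lt P x y" using that \<open>(x, y) \<in> F\<close> Q(2) by (force simp: lt_def F'_def)
    show "lt P x y" if xy: "lt Q x y"
    proof (rule ccontr)
      assume no: "\<not> lt P x y"
      have "x \<noteq> y" using xy lt_irrefl[OF Q(1) c(1)] by auto
      then have "lt P y x" using lt_total[OF P carrier_subgroup c no] by simp
      then have "lt Q y x" using \<open>(x, y) \<in> F\<close> Q(2) by (force simp: lt_def F'_def)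
      then show False using xy lt_trans[OF Q(1) c(1,2,1)] lt_irrefl[OF Q(1) c(1)] by blast
    qed
  qed
  let ?R = "order_of_cone Q"
  have lo: "left_order G ?R" by (rule left_order_of_cone[OF Q(1)])
  have "?R \<noteq> R" using order_of_cone_inj[OF Q(1) P] Q(3) RP by blast
  moreover have "?R \<subseteq> carrier G \<times> carrier G" "R \<subseteq> carrier G \<times> carrier G"
    unfolding RP by (auto simp: order_of_cone_def)
  ultimately obtain p where "p \<in> carrier G \<times> carrier G" "(p \<in> ?R) \<noteq> (p \<in> R)" by blast
  then have "lo_indicator G ?R p \<noteq> s p" using R(2) by (simp add: lo_indicator_def)
  then have "lo_indicator G ?R \<noteq> s" by auto
  moreover have "lo_indicator G ?R i = s i" if "i \<in> F" for i
    using that F(2) agree[of "fst i" "snd i"] unfolding R(2) RP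
    by (auto simp: lo_indicator_def order_of_cone_def)
  ultimately show "\<exists>t\<in>lo_indicator G ` {R. left_order G R}. t \<noteq> s \<and> (\<forall>i\<in>F. t i = s i)"
    using lo by blast
qed

end

section \<open>The structure group of a retractable solution\<close>

context ybe begin

abbreviation SG :: "'a word set monoid" where
  "SG \<equiv> pres_group X {} g f"

definition word_of :: "'a word set \<Rightarrow> 'a word" where
  "word_of A = (SOME w. w \<in> A)"

lemma word_of_class: "word_over X w \<Longrightarrow> wequiv w (word_of (word_class {} w))"
  using someI[of "\<lambda>v. v \<in> word_class {} w" w] by (simp add: word_of_def word_class_def sg_eq.refl)

lemma word_of_carrier:
  assumes "A \<in> carrier SG"
  shows "word_over X (word_of A)" "word_class {} (word_of A) = A"
proof -
  obtain w where w: "word_over X w" "A = word_class {} w" using assms by (auto simp: carrier_pres_group)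
  have eq: "wequiv w (word_of A)" using word_of_class[OF w(1)] w(2) by simp
  then show 1: "word_over X (word_of A)" using sg_eq_word_over by blast
  show "word_class {} (word_of A) = A"
    unfolding w(2) using word_class_eq_iff[OF w(1), of "{}" "word_of A"] sg_eq.sym[OF eq] w(2) by simp
qed

lemma word_of_mult:
  assumes "A \<in> carrier SG" "B \<in> carrier SG"
  shows "wequiv (word_of A @ word_of B) (word_of (A \<otimes>\<^bsub>SG\<^esub> B))"
proof -
  have "A \<otimes>\<^bsub>SG\<^esub> B = word_class {} (word_of A @ word_of B)"
    using mult_pres_group[OF word_of_carrier(1)[OF assms(1)] word_of_carrier(1)[OF assms(2)], of "{}"]
    unfolding word_of_carrier(2)[OF assms(1)] word_of_carrier(2)[OF assms(2)] .
  moreover have "word_over X (word_of A @ word_of B)"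
    using word_of_carrier(1)[OF assms(1)] word_of_carrier(1)[OF assms(2)] by auto
  ultimately show ?thesis using word_of_class by simp
qed

lemma word_of_one: "wequiv [] (word_of \<one>\<^bsub>SG\<^esub>)"
  using word_of_class[of "[]"] by (simp add: one_pres_group)

text \<open>For elements acting trivially the cocycle is additive, so the two products in either
  order have equal cocycles and coincide by injectivity.\<close>

lemma virt_abelian_SG: "virt_abelian SG (\<lambda>A. wperm (word_of A))"
proof -
  interpret group SG by (rule group_pres_group)
  show ?thesis
  proof unfold_locales
    show "wperm (word_of (A \<otimes>\<^bsub>SG\<^esub> B)) = wperm (word_of A) \<circ> wperm (word_of B)"
      if "A \<in> carrier SG" "B \<in> carrier SG" for A B
      using wperm_invariant[OF word_of_mult[OF that]] by (simp only: wperm_append)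
    show "wperm (word_of \<one>\<^bsub>SG\<^esub>) = id"
      using wperm_invariant[OF word_of_one] by (simp add: wperm_def)
    show "finite ((\<lambda>A. wperm (word_of A)) ` carrier SG)"
      by (rule finite_subset[OF _ finite_permutations[OF finite_X]])
         (use wperm_permutes word_of_carrier(1) in blast)
    fix A B assume A: "A \<in> carrier SG" "wperm (word_of A) = id" and B: "B \<in> carrier SG" "wperm (word_of B) = id"
    note wA = word_of_carrier(1)[OF A(1)] and wB = word_of_carrier(1)[OF B(1)]
    have "cocycle (word_of A @ word_of B) = cocycle (word_of B @ word_of A)"
      by (rule ext) (simp only: cocycle_append[OF wA] cocycle_append[OF wB] A(2) B(2) inv_id id_apply add.commute)
    then have "wequiv (word_of A @ word_of B) (word_of B @ word_of A)"
      using wA wB by (intro cocycle_determines) auto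
    moreover have "word_over X (word_of B @ word_of A)" using wA wB by auto
    ultimately have "word_class {} (word_of A @ word_of B) = word_class {} (word_of B @ word_of A)"
      using word_class_eq_iff by blast
    then show "A \<otimes>\<^bsub>SG\<^esub> B = B \<otimes>\<^bsub>SG\<^esub> A"
      using mult_pres_group[OF wA wB, of "{}"] mult_pres_group[OF wB wA, of "{}"]
      unfolding word_of_carrier(2)[OF A(1)] word_of_carrier(2)[OF B(1)] by simp
  qed
qed

section \<open>The filtration of the structure group by the iterated retracts\<close>

definition act_ker :: "nat \<Rightarrow> 'a word set set" where
  "act_ker m = {A \<in> carrier SG. rperm m (word_of A) = id}"

text \<open>Written inside \<open>act_ker m\<close>, so that it is literally the common kernel of a
  finite family of homomorphisms.\<close>

definition coc_ker :: "nat \<Rightarrow> 'a word set set" where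
  "coc_ker m = {A \<in> act_ker m. \<forall>C\<in>rclass m ` X. rcocycle m (word_of A) C = 0}"

lemma rperm_mult:
  assumes "A \<in> carrier SG" "B \<in> carrier SG"
  shows "rperm m (word_of (A \<otimes>\<^bsub>SG\<^esub> B)) = rperm m (word_of A) \<circ> rperm m (word_of B)"
  using rperm_invariant[OF word_of_mult[OF assms]] by (simp only: rperm_append)

lemma rcocycle_invariant_base: "wequiv v w \<Longrightarrow> rcocycle m v = rcocycle m w"
  by (erule rcocycle_invariant) simp

lemma rcocycle_mult:
  assumes "A \<in> carrier SG" "B \<in> carrier SG"
  shows "rcocycle m (word_of (A \<otimes>\<^bsub>SG\<^esub> B)) C =
    rcocycle m (word_of A) C + rcocycle m (word_of B) (inv_into UNIV (rperm m (word_of A)) C)"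
  unfolding rcocycle_invariant_base[OF word_of_mult[OF assms], symmetric]
  by (rule rcocycle_append[OF word_of_carrier(1)[OF assms(1)]])

lemma rcocycle_word_of_class:
  "word_over X w \<Longrightarrow> rcocycle m (word_of (word_class {} w)) = rcocycle m w"
  by (rule rcocycle_invariant_base[OF word_of_class, symmetric])

lemma coc_ker_iff:
  assumes "A \<in> carrier SG"
  shows "A \<in> coc_ker m \<longleftrightarrow> (\<forall>C\<in>rclass m ` X. rcocycle m (word_of A) C = 0)"
  using rcocycle_zero_perm[OF word_of_carrier(1)[OF assms]] assms
  unfolding coc_ker_def act_ker_def by blast

lemma subgroup_act_ker: "subgroup (act_ker m) SG"
proof -
  interpret group SG by (rule group_pres_group)
  have one: "rperm m (word_of \<one>\<^bsub>SG\<^esub>) = id"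
    using rperm_invariant[OF word_of_one, of m] by (simp add: rperm_def ybe.wperm_def[OF ret_ybe])
  show ?thesis
  proof (rule subgroupI)
    show "act_ker m \<subseteq> carrier SG" by (auto simp: act_ker_def)
    show "act_ker m \<noteq> {}" using one by (auto simp: act_ker_def)
    show "inv\<^bsub>SG\<^esub> A \<in> act_ker m" if "A \<in> act_ker m" for A
      using that rperm_mult[of "inv\<^bsub>SG\<^esub> A" A m] one by (simp add: act_ker_def)
    show "A \<otimes>\<^bsub>SG\<^esub> B \<in> act_ker m" if "A \<in> act_ker m" "B \<in> act_ker m" for A B
      using that by (simp add: act_ker_def rperm_mult)
  qed
qed

lemma add_hom_act_ker: "group.add_hom SG (act_ker m) (\<lambda>A. rcocycle m (word_of A) C)"
  unfolding group.add_hom_def[OF group_pres_group]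
  by (auto simp: act_ker_def rcocycle_mult inv_id)

lemma subgroup_coc_ker: "subgroup (coc_ker m) SG"
  unfolding coc_ker_def
  by (rule group.add_hom_family_ker_subgroup[OF group_pres_group subgroup_act_ker add_hom_act_ker])

lemma coc_ker_zero: "coc_ker 0 = {\<one>\<^bsub>SG\<^esub>}"
proof -
  interpret group SG by (rule group_pres_group)
  have "A = \<one>\<^bsub>SG\<^esub>" if "A \<in> coc_ker 0" for A
  proof -
    have A: "A \<in> carrier SG" using that by (auto simp: coc_ker_def act_ker_def)
    have "wequiv (word_of A) []"
      using that word_of_carrier(1)[OF A] by (intro rcocycle_zero_base) (auto simp: coc_ker_def)
    then have "word_class {} (word_of A) = word_class {} []" using word_class_eq_iff[of "[]"] by simp
    then show ?thesis using word_of_carrier(2)[OF A] by (simp add: one_pres_group)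
  qed
  moreover have "\<one>\<^bsub>SG\<^esub> \<in> coc_ker 0"
  proof -
    have "rcocycle 0 (word_of \<one>\<^bsub>SG\<^esub>) C = 0" for C
      unfolding rcocycle_invariant_base[OF word_of_one, symmetric]
      by (simp add: rcocycle_def ybe.cocycle.simps[OF ret_ybe])
    then show ?thesis using coc_ker_iff[OF one_closed] by blast
  qed
  ultimately show ?thesis by blast
qed

lemma coc_ker_Suc_subset: "coc_ker (Suc m) \<subseteq> act_ker m"
proof
  fix A assume A: "A \<in> coc_ker (Suc m)"
  then have c: "A \<in> carrier SG" by (auto simp: coc_ker_def act_ker_def)
  have "rperm m (word_of A) = id"
    using A by (intro rcocycle_zero_perm_Suc word_of_carrier(1)[OF c]) (auto simp: coc_ker_def)
  then show "A \<in> act_ker m" using c by (simp add: act_ker_def)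
qed

lemma coc_ker_mono: "coc_ker m \<subseteq> coc_ker (Suc m)"
proof
  fix A assume A: "A \<in> coc_ker m"
  then have c: "A \<in> carrier SG" by (auto simp: coc_ker_def act_ker_def)
  have "rcocycle (Suc m) (word_of A) C = 0" for C
    using A by (intro rcocycle_zero_Suc word_of_carrier(1)[OF c]) (auto simp: coc_ker_def)
  then show "A \<in> coc_ker (Suc m)" using coc_ker_iff[OF c] by blast
qed

lemma act_ker_total:
  assumes "\<And>x y. x \<in> X \<Longrightarrow> y \<in> X \<Longrightarrow> rrel m x y"
  shows "act_ker m = carrier SG"
proof -
  have "rperm m w = id" if w: "word_over X w" for w
  proof
    fix C
    show "rperm m w C = id C"
    proof (cases "C \<in> rclass m ` X")
      case True
      then have "rperm m w C \<in> rclass m ` X"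
        using rperm_permutes[OF w, of m] by (simp add: permutes_in_image)
      then show ?thesis using True assms rclass_eq_iff by force
    next
      case False
      then show ?thesis using rperm_permutes[OF w, of m] by (simp add: permutes_not_in)
    qed
  qed
  then show ?thesis using word_of_carrier(1) by (auto simp: act_ker_def)
qed

lemma poly_Z_act_ker: "\<exists>k. group.poly_Z SG k (act_ker m)"
proof -
  interpret group SG by (rule group_pres_group)
  have step: "\<exists>k. poly_Z k (act_ker m)" if "poly_Z k (coc_ker m)" for k m
    by (rule poly_Z_family[of "rclass m ` X" _ "\<lambda>C A. rcocycle m (word_of A) C" k])
       (use that finite_X in \<open>auto simp: subgroup_act_ker add_hom_act_ker coc_ker_def\<close>)
  show ?thesis
  proof (induction m)
    case 0
    then show ?case using step[of 0 0] poly_Z_one by (simp add: coc_ker_zero)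
  next
    case (Suc m)
    then obtain k where "poly_Z k (act_ker m)" by blast
    then have "poly_Z k (coc_ker (Suc m))" by (rule poly_Z_mono[OF _ subgroup_coc_ker coc_ker_Suc_subset])
    then show ?case by (rule step)
  qed
qed

lemma add_hom_coc_ker: "group.add_hom SG (coc_ker (Suc m)) (\<lambda>A. rcocycle m (word_of A) C)"
  by (rule group.add_hom_subset[OF group_pres_group add_hom_act_ker coc_ker_Suc_subset])

text \<open>Descent from the whole group, which is \<open>act_ker M\<close>: each
  \<open>coc_ker n\<close> is cut out of \<open>coc_ker (Suc n)\<close> by the coordinates of level
  \<open>n\<close>, which are homomorphisms there.\<close>

lemma finite_cones_coc_ker:
  assumes total: "\<And>x y. x \<in> X \<Longrightarrow> y \<in> X \<Longrightarrow> rrel M x y"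
    and fin: "finite {Q. group.pos_cone SG (carrier SG) Q}" and "m \<le> M"
  shows "finite {Q. group.pos_cone SG (coc_ker m) Q}"
proof -
  interpret group SG by (rule group_pres_group)
  have fX: "finite (rclass n ` X)" for n using finite_X by simp
  show ?thesis using \<open>m \<le> M\<close>
  proof (induction rule: inc_induct)
    case base
    have "finite {Q. pos_cone (act_ker M) Q}" using fin act_ker_total[OF total] by simp
    from finite_cones_family[OF fX this subgroup_act_ker add_hom_act_ker] show ?case
      unfolding coc_ker_def .
  next
    case (step n)
    have "coc_ker n = {A \<in> coc_ker (Suc n). \<forall>C\<in>rclass n ` X. rcocycle n (word_of A) C = 0}"
      using coc_ker_mono[of n] coc_ker_Suc_subset[of n] unfolding coc_ker_def[of n] by blast
    then show ?case
      using finite_cones_family[OF fX step.IH subgroup_coc_ker add_hom_coc_ker] by simp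
  qed
qed

text \<open>Elements with cocycle differences for the two merged pairs lie in
  \<open>coc_ker (Suc m)\<close>. The determinant of the coordinates \<open>x\<close> and
  \<open>u\<close> on them vanishes, while its diagonal entries are 1; so the coordinate
  \<open>x\<close> of the second element is nonzero, which puts \<open>x\<close> in the pair of
  \<open>u\<close> and \<open>v\<close>.\<close>

lemma merge_unique:
  assumes total: "\<And>x y. x \<in> X \<Longrightarrow> y \<in> X \<Longrightarrow> rrel M x y"
    and fin: "finite {Q. group.pos_cone SG (carrier SG) Q}" and m: "Suc m \<le> M"
    and X: "x \<in> X" "y \<in> X" "u \<in> X" "v \<in> X"
    and xy: "rrel (Suc m) x y" "\<not> rrel m x y"
    and uv: "rrel (Suc m) u v" "\<not> rrel m u v"
  shows "rrel m x u \<or> rrel m x v"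
proof -
  interpret virt_abelian SG "\<lambda>A. wperm (word_of A)" by (rule virt_abelian_SG)
  have elem: "\<exists>A\<in>coc_ker (Suc m). \<forall>C. rcocycle m (word_of A) C = of_bool (C = rclass m a) - of_bool (C = rclass m b)"
    if ab: "a \<in> X" "b \<in> X" "rrel (Suc m) a b" for a b
  proof -
    obtain w where w: "word_over X w"
      "\<And>k C. rcocycle k w C = of_bool (C = rclass k a) - of_bool (C = rclass k b)"
      using rcocycle_difference[OF ab(1,2)] by blast
    have "word_class {} w \<in> carrier SG" using w(1) by (auto simp: carrier_pres_group)
    moreover have "rclass (Suc m) a = rclass (Suc m) b" using ab rclass_eq_iff by blast
    ultimately have "word_class {} w \<in> coc_ker (Suc m)"
      by (simp add: coc_ker_iff rcocycle_word_of_class[OF w(1)] w(2))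
    then show ?thesis using w(2) rcocycle_word_of_class[OF w(1)] by (intro bexI[of _ "word_class {} w"]) simp_all
  qed
  obtain A where A: "A \<in> coc_ker (Suc m)"
    "\<And>C. rcocycle m (word_of A) C = of_bool (C = rclass m x) - of_bool (C = rclass m y)"
    using elem[OF X(1,2) xy(1)] by blast
  obtain B where B: "B \<in> coc_ker (Suc m)"
    "\<And>C. rcocycle m (word_of B) C = of_bool (C = rclass m u) - of_bool (C = rclass m v)"
    using elem[OF X(3,4) uv(1)] by blast
  obtain k where "poly_Z k (act_ker m)" using poly_Z_act_ker by blast
  then have pz: "poly_Z k (coc_ker (Suc m))" by (rule poly_Z_mono[OF _ subgroup_coc_ker coc_ker_Suc_subset])
  have ne: "rclass m x \<noteq> rclass m y" "rclass m u \<noteq> rclass m v"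
    using xy(2) uv(2) rclass_eq_iff X by blast+
  have "rcocycle m (word_of A) (rclass m x) * rcocycle m (word_of B) (rclass m u) =
      rcocycle m (word_of B) (rclass m x) * rcocycle m (word_of A) (rclass m u)"
    by (rule finite_cones_dependent[OF pz finite_cones_coc_ker[OF total fin m] add_hom_coc_ker add_hom_coc_ker A(1) B(1)])
  then have "rclass m x = rclass m u \<or> rclass m x = rclass m v"
    using ne by (cases "rclass m x = rclass m u"; cases "rclass m x = rclass m v")
      (simp_all add: A(2) B(2))
  then show ?thesis using rclass_eq_iff X by blast
qed

text \<open>The contradiction arises at the last level \<open>m\<close> before the retract collapses
  to one point. That level has just two classes; since \<open>X\<close> has at least three points,
  \<open>m\<close> is positive and one of the two classes arose by a unique merging, which the group
  must respect.\<close>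

lemma infinite_cones:
  assumes total: "\<And>x y. x \<in> X \<Longrightarrow> y \<in> X \<Longrightarrow> rrel M x y" and card: "card X \<ge> 3"
  shows "infinite {Q. group.pos_cone SG (carrier SG) Q}"
proof
  assume fin: "finite {Q. group.pos_cone SG (carrier SG) Q}"
  interpret virt_abelian SG "\<lambda>A. wperm (word_of A)" by (rule virt_abelian_SG)
  define tot where "tot k \<longleftrightarrow> (\<forall>x\<in>X. \<forall>y\<in>X. rrel k x y)" for k
  have totM: "tot M" using total by (auto simp: tot_def)
  have big: "\<not> X \<subseteq> {a, b}" for a b
  proof
    assume "X \<subseteq> {a, b}"
    then have "card X \<le> card {a, b}" by (intro card_mono) auto
    also have "\<dots> \<le> 2" by (simp add: card_insert_if)
    finally show False using card by simp
  qed
  define k where "k = (LEAST k. tot k)"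
  have k: "tot k" unfolding k_def using totM by (rule LeastI)
  have kM: "k \<le> M" unfolding k_def using totM by (rule Least_le)
  have "k \<noteq> 0"
  proof
    assume "k = 0"
    then have "\<forall>x\<in>X. \<forall>y\<in>X. x = y" using k by (simp add: tot_def)
    moreover obtain a where "a \<in> X" using big[of undefined undefined] by blast
    ultimately show False using big[of a a] by blast
  qed
  then obtain m where km: "k = Suc m" by (cases k) auto
  have "\<not> tot m" using not_less_Least[of m tot] km unfolding k_def by simp
  then obtain a b where ab: "a \<in> X" "b \<in> X" "\<not> rrel m a b" by (auto simp: tot_def)
  have Suc_tot: "rrel (Suc m) x y" if "x \<in> X" "y \<in> X" for x y
    using k that unfolding km tot_def by blast
  \<comment> \<open>A third class \<open>u\<close> would make both \<open>b, a\<close> and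
    \<open>u, a\<close> merge in the step to \<open>Suc m\<close>.\<close>
  have two: "rrel m u a \<or> rrel m u b" if u: "u \<in> X" for u
  proof (rule ccontr)
    assume no: "\<not> ?thesis"
    have "rrel m b u \<or> rrel m b a"
      using no kM km ab u Suc_tot ret_rel_sym[of m a b] ret_rel_sym[of m b a]
      by (intro merge_unique[OF total fin, of m b a u a]) auto
    then show False using no ab ret_rel_sym by blast
  qed
  show False
  proof (cases m)
    case 0
    then have "X \<subseteq> {a, b}" using two by auto
    then show False using big by blast
  next
    case (Suc n)
    \<comment> \<open>If nothing merged between \<open>n\<close> and \<open>Suc n\<close>, the
      retraction would already be stationary and could not merge \<open>a\<close> and
      \<open>b\<close> later.\<close>
    have "\<exists>p\<in>X. \<exists>q\<in>X. rrel (Suc n) p q \<and> \<not> rrel n p q"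
    proof (rule ccontr)
      assume "\<not> ?thesis"
      then have "rrel n (f a z) (f b z)" if "z \<in> X" for z
        using Suc_tot[OF ab(1,2)] Suc that f_closed[OF ab(1) that] f_closed[OF ab(2) that] by auto
      then show False using ab(3) Suc by simp
    qed
    then obtain p q where pq: "p \<in> X" "q \<in> X" "rrel (Suc n) p q" "\<not> rrel n p q" by blast
    have rel_iff: "rrel j (wperm w x) (wperm w y) \<longleftrightarrow> rrel j x y"
      if "word_over X w" "x \<in> X" "y \<in> X" for w x y j
    proof -
      have mem: "wperm w x \<in> X" "wperm w y \<in> X"
        using wperm_permutes[OF that(1)] that(2,3) by (simp_all add: permutes_in_image)
      have "rclass j (wperm w x) = rclass j (wperm w y) \<longleftrightarrow> rclass j x = rclass j y"
        using inj_eq[OF bij_is_inj[OF rperm_bij[OF that(1), of j]], of "rclass j x" "rclass j y"]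
        by (simp add: rperm_class[OF that(1)] that(2,3))
      then show ?thesis using rclass_eq_iff[OF mem(2)] rclass_eq_iff[OF that(3)] by blast
    qed
    \<comment> \<open>A word sends the merged pair \<open>p, q\<close> to another pair merged in the
      same step. By uniqueness the image of \<open>p\<close> is \<open>p\<close> or \<open>q\<close>
      up to level \<open>n\<close>, and these two agree at level \<open>m\<close>.\<close>
    have fixed: "rperm m w (rclass m p) = rclass m p" if w: "word_over X w" for w
    proof -
      have mem: "wperm w p \<in> X" "wperm w q \<in> X"
        using wperm_permutes[OF w] pq(1,2) by (simp_all add: permutes_in_image)
      have "rrel n (wperm w p) p \<or> rrel n (wperm w p) q"
        by (rule merge_unique[OF total fin _ mem pq(1,2) _ _ pq(3,4)])
           (use kM km Suc pq(3,4) in \<open>simp_all add: rel_iff[OF w pq(1,2)] del: ret_rel.simps\<close>)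
      then have "rrel m (wperm w p) p"
      proof
        assume "rrel n (wperm w p) p"
        then show ?thesis unfolding Suc by (rule ret_rel_mono[OF mem(1) pq(1)])
      next
        assume "rrel n (wperm w p) q"
        then have "rrel m (wperm w p) q" unfolding Suc by (rule ret_rel_mono[OF mem(1) pq(2)])
        then show ?thesis using pq(3) ret_rel_sym ret_rel_trans unfolding Suc by blast
      qed
      then show ?thesis using rperm_class[OF w pq(1)] rclass_eq_iff[OF pq(1)] by simp
    qed
    have hom1: "add_hom (carrier SG) (\<lambda>A. rcocycle m (word_of A) (rclass m p))"
      unfolding add_hom_def
    proof (intro ballI)
      fix A B assume AB: "A \<in> carrier SG" "B \<in> carrier SG"
      note wA = word_of_carrier(1)[OF AB(1)]
      have "inv_into UNIV (rperm m (word_of A)) (rclass m p) = rclass m p"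
        using inv_f_f[OF bij_is_inj[OF rperm_bij[OF wA, of m]], of "rclass m p"] fixed[OF wA] by simp
      then show "rcocycle m (word_of (A \<otimes>\<^bsub>SG\<^esub> B)) (rclass m p) =
          rcocycle m (word_of A) (rclass m p) + rcocycle m (word_of B) (rclass m p)"
        using rcocycle_mult[OF AB] by simp
    qed
    have hom2: "add_hom (carrier SG) (\<lambda>A. word_degree (word_of A))"
      unfolding add_hom_def using word_degree_invariant[OF word_of_mult] by (auto simp: word_degree_append)
    obtain r where r: "r \<in> X" "\<not> rrel m p r"
    proof (cases "rrel m p a")
      case True
      then have "\<not> rrel m p b" using ab(3) ret_rel_sym ret_rel_trans by blast
      then show ?thesis using that ab by blast
    qed (use that ab in blast)
    have gens: "word_class {} [(x, True)] \<in> carrier SG"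
      "rcocycle m (word_of (word_class {} [(x, True)])) C = of_bool (C = rclass m x)"
      "word_degree (word_of (word_class {} [(x, True)])) = 1" if "x \<in> X" for x C
    proof -
      have w: "word_over X [(x, True)]" using that by simp
      show "word_class {} [(x, True)] \<in> carrier SG" using w unfolding carrier_pres_group by blast
      show "rcocycle m (word_of (word_class {} [(x, True)])) C = of_bool (C = rclass m x)"
        by (simp only: rcocycle_word_of_class[OF w] rcocycle_letter[OF that])
      show "word_degree (word_of (word_class {} [(x, True)])) = 1"
        using word_degree_invariant[OF word_of_class[OF w]] by (simp add: word_degree_def)
    qed
    \<comment> \<open>On the generators \<open>p\<close> and \<open>r\<close> the fixed coordinate
      takes the values 1 and 0, whereas the degree is 1 on both; these homomorphisms are
      independent.\<close>
    obtain j where "poly_Z j (act_ker M)" using poly_Z_act_ker by blast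
    then have "poly_Z j (carrier SG)" using act_ker_total[OF total] by simp
    from finite_cones_dependent[OF this fin hom1 hom2 gens(1)[OF pq(1)] gens(1)[OF r(1)]]
    have "rclass m p = rclass m r" by (simp add: gens pq(1) r(1) split: if_splits)
    then show False using r rclass_eq_iff by blast
  qed
qed

text \<open>Generators have degree 1, so they are the same power of a cyclic generator and hence
  equal in the group. The level m cocycle is well defined on this group, and on generators it
  separates the classes of \<open>rrel m\<close>.\<close>

lemma ret_total_of_cyclic:
  assumes cyc: "cyclic_group (ret_group X g f m)" and x: "x \<in> X" and y: "y \<in> X"
  shows "rrel m x y"
proof -
  define E where "E = {(x, y). x \<in> X \<and> y \<in> X \<and> rrel m x y}"
  let ?G = "pres_group X E g f"
  interpret group ?G by (rule group_pres_group)
  define deg where "deg A = word_degree (SOME w. w \<in> A)" for A :: "'a word set"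
  have deg: "deg (word_class E w) = word_degree w" if "word_over X w" for w
  proof -
    have "sg_eq X E g f w (SOME v. v \<in> word_class E w)"
      using someI[of "\<lambda>v. v \<in> word_class E w" w] that by (simp add: word_class_def sg_eq.refl)
    then show ?thesis using word_degree_invariant by (fastforce simp: deg_def)
  qed
  have hom: "add_hom (carrier ?G) deg"
    unfolding add_hom_def
  proof (intro ballI)
    fix A B assume "A \<in> carrier ?G" "B \<in> carrier ?G"
    then obtain v w where vw: "word_over X v" "word_over X w" "A = word_class E v" "B = word_class E w"
      by (auto simp: carrier_pres_group)
    have "word_over X (v @ w)" using vw by auto
    then show "deg (A \<otimes>\<^bsub>?G\<^esub> B) = deg A + deg B"
      by (simp only: vw(3,4) mult_pres_group[OF vw(1,2)] deg vw(1,2) word_degree_append)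
  qed
  obtain a where a: "a \<in> carrier ?G" "\<And>z. z \<in> carrier ?G \<Longrightarrow> \<exists>n::int. z = a [^]\<^bsub>?G\<^esub> n"
    using cyc unfolding cyclic_group_def ret_group_def E_def by blast
  have gen: "word_over X [(z, True)]" "word_class E [(z, True)] \<in> carrier ?G" "deg (word_class E [(z, True)]) = 1"
    if "z \<in> X" for z
  proof -
    show w: "word_over X [(z, True)]" using that by simp
    show "word_class E [(z, True)] \<in> carrier ?G" using w unfolding carrier_pres_group by blast
    show "deg (word_class E [(z, True)]) = 1" using deg[OF w] by (simp add: word_degree_def)
  qed
  obtain i :: int where i: "word_class E [(x, True)] = a [^]\<^bsub>?G\<^esub> i" using a(2)[OF gen(2)[OF x]] by blast
  obtain j :: int where j: "word_class E [(y, True)] = a [^]\<^bsub>?G\<^esub> j" using a(2)[OF gen(2)[OF y]] by blast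
  have "i * deg a = 1" "j * deg a = 1"
    using gen(3)[OF x] gen(3)[OF y] add_hom_int_pow[OF hom _ a(1)] subgroup_self
    unfolding i j by simp_all
  then have "i = j" by (metis mult_cancel_right mult_zero_right zero_neq_one)
  then have "word_class E [(x, True)] = word_class E [(y, True)]" using i j by simp
  then have "sg_eq X E g f [(x, True)] [(y, True)]" using word_class_eq_iff[OF gen(1)[OF y]] by blast
  then have "rcocycle m [(x, True)] (rclass m x) = rcocycle m [(y, True)] (rclass m x)"
    by (subst rcocycle_invariant) (auto simp: E_def)
  then have "rclass m x = rclass m y" by (simp add: rcocycle_letter x y split: if_splits)
  then show ?thesis using rclass_eq_iff y by blast
qed

lemma countable_carrier: "countable (carrier SG)"
proof -
  have "{w. word_over X w} \<subseteq> lists (X \<times> UNIV)" by (auto simp: lists_eq_set)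
  moreover have "countable (lists (X \<times> (UNIV :: bool set)))"
    using finite_X by (intro countable_lists countable_SIGMA countable_finite) auto
  ultimately show ?thesis unfolding carrier_pres_group by (meson countable_image countable_subset)
qed

end

theorem theorem2:
  fixes X :: "'a set" and g f :: "'a \<Rightarrow> 'a \<Rightarrow> 'a"
  assumes "finite X" and "card X \<ge> 3"
    and "\<forall>x\<in>X. \<forall>y\<in>X. g x y \<in> X \<and> f x y \<in> X"
    and "is_solution X g f"
    and "non_degenerate X g f"
    and "symmetric_sol X g f"
    and "\<not> trivial_sol X g f"
    and "retractable X g f"
  shows "(\<exists>R. left_order (structure_group X g f) R \<and> recurrent (structure_group X g f) R)
       \<and> LO_space (structure_group X g f) homeomorphic_space subtopology euclideanreal cantor_set
       \<and> infinite {R. left_order (structure_group X g f) R \<and> conradian (structure_group X g f) R}"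
proof -
  have closed: "g x y \<in> X" "f x y \<in> X" if "x \<in> X" "y \<in> X" for x y using assms(3) that by auto
  have inv: "sol_map g f (sol_map g f (x, y)) = (x, y)" if "x \<in> X" "y \<in> X" for x y
    using assms(6) that unfolding symmetric_sol_def by blast
  have braid: "S12 (sol_map g f) (S23 (sol_map g f) (S12 (sol_map g f) (x, y, z))) =
      S23 (sol_map g f) (S12 (sol_map g f) (S23 (sol_map g f) (x, y, z)))" if "x \<in> X" "y \<in> X" "z \<in> X" for x y z
    using assms(6) that unfolding symmetric_sol_def by blast
  interpret ybe X g f
  proof
    show "bij_betw (g x) X X" "bij_betw (f x) X X" if "x \<in> X" for x
      using assms(5) that unfolding non_degenerate_def by blast+
    show "g (g x y) (f y x) = x" "f (f y x) (g x y) = y" if "x \<in> X" "y \<in> X" for x y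
      using inv[OF that] by (simp_all add: sol_map_def)
    show "g x (g y z) = g (g x y) (g (f y x) z)" "f z (f y x) = f (f z y) (f (g y z) x)"
      if "x \<in> X" "y \<in> X" "z \<in> X" for x y z
      using braid[OF that] by (simp_all add: S12_def S23_def sol_map_def)
  qed (use assms(1) closed in auto)
  have SG: "structure_group X g f = SG" by (simp add: structure_group_def)
  interpret G: virt_abelian SG "\<lambda>A. wperm (word_of A)" by (rule virt_abelian_SG)
  obtain M where "cyclic_group (ret_group X g f M)" using assms(8) unfolding retractable_def by blast
  then have total: "ret_rel X f M x y" if "x \<in> X" "y \<in> X" for x y
    using ret_total_of_cyclic that by blast
  have inf: "infinite {Q. G.pos_cone (carrier SG) Q}" by (rule infinite_cones[OF total assms(2)])
  obtain k where "G.poly_Z k (act_ker M)" using poly_Z_act_ker by blast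
  then have pz: "G.poly_Z k (carrier SG)" using act_ker_total[OF total] by simp
  have inf_lo: "infinite {R. left_order SG R}" by (rule G.infinite_left_orders[OF inf])
  then obtain R where R: "left_order SG R" by (metis (mono_tags, lifting) finite.emptyI Collect_empty_eq)
  \<comment> \<open>Every left order of the structure group is Conradian, so infinitely many orders
    suffice.\<close>
  have "{R. left_order SG R \<and> conradian SG R} = {R. left_order SG R}"
    using G.left_order_conradian by blast
  then show ?thesis
    unfolding SG using R G.left_order_recurrent[OF R] G.LO_space_cantor[OF pz inf countable_carrier] inf_lo by auto
qed

end
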